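(* Let $P_0$ be any sub-pattern tractable pattern with three parts $U_1,U_2,U_3$ such that there is at most one negative edge between $U_1$ and $U_2$, at most one negative edge between $U_2$ and $U_3$, and no edges (positive or negative) between $U_1$ and $U_3$. Let $P$ be the pattern with four parts $U_1,U_2,U_3,U_4$ obtained from $P_0$ by adding six new points $p_1,p_2\in U_1$, $r_1,r_2\in U_3$ and $q_1,q_2\in U_4$ (where $U_4=\{q_1,q_2\}$ is a new part), together with three new negative edges $\{p_1,r_1\}$, $\{p_2,q_1\}$, $\{q_2,r_2\}$. Then any such $P$ is topological-minor tractable.
   Context: A binary CSP instance is a triple $\langle V,D,C\rangle$: $V$ a finite set of variables, a finite domain $D(v)$ for each $v\in V$, and for each ordered pair of distinct variables $(u,v)$ a relation $R_{uv}\subseteq D(u)\times D(v)$, with $R_{vu}=\{(b,a):(a,b)\in R_{uv}\}$. A solution is an assignment $s$ with $s(v)\in D(v)$ and $(s(u),s(v))\in R_{uv}$ for all distinct $u,v$. A class of instances is tractable if there is a polynomial-time algorithm deciding whether any instance of the class has a solution. A pattern is a structure $\langle X,E^{\sim},E^{+},E^{-}\rangle$ where $X$ is a set of points, $E^{\sim}$ is an equivalence relation on $X$ whose classes are called parts, and $E^{+}$ (positive edges), $E^{-}$ (negative edges) are symmetric binary relations on $X$ each disjoint from $E^{\sim}$. For an instance $I$, the pattern $\mathcal{P}(I)$ has points $x_{v,a}$ ($v\in V$, $a\in D(v)$), with $x_{u,a},x_{v,b}$ in the same part iff $u=v$, and for $u\neq v$ the pair $(x_{u,a},x_{v,b})$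 is a positive edge if $(a,b)\in R_{uv}$ and a negative edge otherwise. A homomorphism of patterns is a map of points sending same-part pairs to same-part pairs, positive edges to positive edges and negative edges to negative edges; it preserves parts if points in distinct parts are mapped to points in distinct parts. $P_1 \stackrel{SP}{\rightarrow} P_2$ if there is a part-preserving homomorphism $P_1\to P_2$. The subdivision of a pattern at two distinct parts $U,V$ adds a new part containing one new point $z_{xy}$ per positive edge $\{x,y\}$ between $U$ and $V$ and two new points $z'_{xy},z''_{xy}$ per negative edge $\{x,y\}$ between $U$ and $V$, removes these edges, and adds positive edges $\{x,z_{xy}\},\{z_{xy},y\}$ respectively negative edges $\{x,z'_{xy}\},\{z''_{xy},y\}$. A subdivision of $P$ is the result of a finite (possibly empty) sequence of such operations. $P_1 \stackrel{TM}{\rightarrow} P_2$ if some subdivision of $P_1$ occurs as a sub-pattern in $P_2$. $\mathrm{CSP}_{SP}(P)$ (resp. $\mathrm{CSP}_{TM}(P)$) is the class of binary CSP instances $I$ such that it is not the case that $P \stackrel{SP}{\rightarrow} \mathcal{P}(I)$ (resp. $P \stackrel{TM}{\rightarrow} \mathcal{P}(I)$). $P$ is sub-pattern tractable if $\mathrm{CSP}_{SP}(P)$ is tractable and topological-minor tractable if $\mathrm{CSP}_{TM}(P)$ is tractable. *)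

theory Defs
  imports "HOL-Computational_Algebra.Polynomial"
begin

section \<open>Binary CSP instances\<close>

text \<open>Only the values of \<open>dmn\<close> on variables and of \<open>rel\<close> on pairs of distinct variables matter.\<close>

record ('v, 'a) csp =
  vars :: "'v set"
  dmn :: "'v \<Rightarrow> 'a set"
  rel :: "'v \<Rightarrow> 'v \<Rightarrow> ('a \<times> 'a) set"

definition is_instance :: "('v, 'a) csp \<Rightarrow> bool" where
  "is_instance I \<longleftrightarrow>
     finite (vars I) \<and> (\<forall>v\<in>vars I. finite (dmn I v)) \<and>
     (\<forall>u\<in>vars I. \<forall>v\<in>vars I. u \<noteq> v \<longrightarrow>
        rel I u v \<subseteq> dmn I u \<times> dmn I v \<and> rel I v u = (rel I u v)\<inverse>)"

definition is_solution :: "('v, 'a) csp \<Rightarrow> ('v \<Rightarrow> 'a) \<Rightarrow> bool" where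
  "is_solution I s \<longleftrightarrow>
     (\<forall>v\<in>vars I. s v \<in> dmn I v) \<and>
     (\<forall>u\<in>vars I. \<forall>v\<in>vars I. u \<noteq> v \<longrightarrow> (s u, s v) \<in> rel I u v)"


section \<open>Patterns\<close>

record 'x pattern =
  pts :: "'x set"
  same :: "('x \<times> 'x) set"
  pos :: "('x \<times> 'x) set"
  neg :: "('x \<times> 'x) set"

text \<open>Positive and negative edges are not required to be disjoint from each other, and the set of
  points is not required to be finite.\<close>

definition is_pattern :: "'x pattern \<Rightarrow> bool" where
  "is_pattern P \<longleftrightarrow>
     equiv (pts P) (same P) \<and>
     pos P \<subseteq> pts P \<times> pts P \<and> sym (pos P) \<and> pos P \<inter> same P = {} \<and>
     neg P \<subseteq> pts P \<times> pts P \<and> sym (neg P) \<and> neg P \<inter> same P = {}"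

definition parts :: "'x pattern \<Rightarrow> 'x set set" where
  "parts P = pts P // same P"

definition pattern_of :: "('v, 'a) csp \<Rightarrow> ('v \<times> 'a) pattern" where
  "pattern_of I =
    \<lparr>pts = {(v, a). v \<in> vars I \<and> a \<in> dmn I v},
     same = {((u, a), (v, b)). u \<in> vars I \<and> v \<in> vars I \<and> a \<in> dmn I u \<and> b \<in> dmn I v \<and> u = v},
     pos = {((u, a), (v, b)). u \<in> vars I \<and> v \<in> vars I \<and> a \<in> dmn I u \<and> b \<in> dmn I v \<and> u \<noteq> v \<and>
              (a, b) \<in> rel I u v},
     neg = {((u, a), (v, b)). u \<in> vars I \<and> v \<in> vars I \<and> a \<in> dmn I u \<and> b \<in> dmn I v \<and> u \<noteq> v \<and>
              (a, b) \<notin> rel I u v}\<rparr>"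

definition pattern_hom :: "('x \<Rightarrow> 'y) \<Rightarrow> 'x pattern \<Rightarrow> 'y pattern \<Rightarrow> bool" where
  "pattern_hom h P Q \<longleftrightarrow>
     h ` pts P \<subseteq> pts Q \<and>
     (\<forall>(x, y) \<in> same P. (h x, h y) \<in> same Q) \<and>
     (\<forall>(x, y) \<in> pos P. (h x, h y) \<in> pos Q) \<and>
     (\<forall>(x, y) \<in> neg P. (h x, h y) \<in> neg Q)"

definition preserves_parts :: "('x \<Rightarrow> 'y) \<Rightarrow> 'x pattern \<Rightarrow> 'y pattern \<Rightarrow> bool" where
  "preserves_parts h P Q \<longleftrightarrow>
     (\<forall>x\<in>pts P. \<forall>y\<in>pts P. (x, y) \<notin> same P \<longrightarrow> (h x, h y) \<notin> same Q)"

definition occurs_SP :: "'x pattern \<Rightarrow> 'y pattern \<Rightarrow> bool" where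
  "occurs_SP P Q \<longleftrightarrow> (\<exists>h. pattern_hom h P Q \<and> preserves_parts h P Q)"


section \<open>Subdivisions and topological minors\<close>

text \<open>The points of a subdivision are the original points together with points named after the edge
  they subdivide: \<open>Mid x y\<close> is $z_{xy}$ for a positive edge, while \<open>Near x y\<close> and \<open>Near y x\<close> are
  $z'_{xy}$ (joined to \<open>x\<close>) and $z''_{xy}$ (joined to \<open>y\<close>) for a negative edge. These names
  are always fresh: a subdivided edge is removed, and later operations only add edges that are
  incident with new points, so no edge is ever subdivided twice.\<close>

datatype 'x spoint =
    Orig 'x
  | Mid "'x spoint" "'x spoint"
  | Near "'x spoint" "'x spoint"

definition orig_pattern :: "'x pattern \<Rightarrow> 'x spoint pattern" where
  "orig_pattern P =
    \<lparr>pts = Orig ` pts P,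
     same = map_prod Orig Orig ` same P,
     pos = map_prod Orig Orig ` pos P,
     neg = map_prod Orig Orig ` neg P\<rparr>"

definition new_points ::
  "'x spoint set \<Rightarrow> 'x spoint set \<Rightarrow> 'x spoint pattern \<Rightarrow> 'x spoint set" where
  "new_points U V P =
     {Mid x y | x y. (x, y) \<in> pos P \<inter> U \<times> V} \<union>
     {Near x y | x y. (x, y) \<in> neg P \<inter> U \<times> V} \<union>
     {Near y x | x y. (x, y) \<in> neg P \<inter> U \<times> V}"

definition subdivide ::
  "'x spoint set \<Rightarrow> 'x spoint set \<Rightarrow> 'x spoint pattern \<Rightarrow> 'x spoint pattern" where
  "subdivide U V P =
    (let newpos = {(x, Mid x y) | x y. (x, y) \<in> pos P \<inter> U \<times> V} \<union>
                  {(Mid x y, y) | x y. (x, y) \<in> pos P \<inter> U \<times> V};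
         newneg = {(x, Near x y) | x y. (x, y) \<in> neg P \<inter> U \<times> V} \<union>
                  {(Near y x, y) | x y. (x, y) \<in> neg P \<inter> U \<times> V}
     in \<lparr>pts = pts P \<union> new_points U V P,
         same = same P \<union> new_points U V P \<times> new_points U V P,
         pos = (pos P - U \<times> V - V \<times> U) \<union> newpos \<union> newpos\<inverse>,
         neg = (neg P - U \<times> V - V \<times> U) \<union> newneg \<union> newneg\<inverse>\<rparr>)"

inductive subdivision :: "'x pattern \<Rightarrow> 'x spoint pattern \<Rightarrow> bool" for P where
  none: "subdivision P (orig_pattern P)"
| step: "subdivision P Q \<Longrightarrow> U \<in> parts Q \<Longrightarrow> V \<in> parts Q \<Longrightarrow> U \<noteq> V \<Longrightarrow>
           subdivision P (subdivide U V Q)"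

definition occurs_TM :: "'x pattern \<Rightarrow> 'y pattern \<Rightarrow> bool" where
  "occurs_TM P Q \<longleftrightarrow> (\<exists>S. subdivision P S \<and> occurs_SP S Q)"

text \<open>Instances use natural numbers as names of variables and of values, so that the classes below
  contain a copy of every finite instance; the names are invisible to algorithms (see
  \<open>encodes\<close>).\<close>

definition CSP_SP :: "'x pattern \<Rightarrow> (nat, nat) csp set" where
  "CSP_SP P = {I. is_instance I \<and> \<not> occurs_SP P (pattern_of I)}"

definition CSP_TM :: "'x pattern \<Rightarrow> (nat, nat) csp set" where
  "CSP_TM P = {I. is_instance I \<and> \<not> occurs_TM P (pattern_of I)}"


section \<open>Polynomial-time algorithms\<close>

text \<open>The machine model is a variable-free form of Jones' WHILE language (N. D. Jones,
  \<^emph>\<open>Computability and Complexity\<close>, MIT Press 1997): the data are binary trees, a leaf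
  plays the role of false, and every elementary operation has unit cost. As trees can only be taken
  apart, paired and tested for being a leaf, each step can be executed in constant time on a pointer
  structure with sharing, so the polynomial-time decidable problems are the same as for Turing
  machines.\<close>

datatype tree = Leaf | Node tree tree

fun left :: "tree \<Rightarrow> tree" where
  "left Leaf = Leaf"
| "left (Node l r) = l"

fun right :: "tree \<Rightarrow> tree" where
  "right Leaf = Leaf"
| "right (Node l r) = r"

fun nodes :: "tree \<Rightarrow> nat" where
  "nodes Leaf = 0"
| "nodes (Node l r) = Suc (nodes l + nodes r)"

datatype prog =
    MkLeaf
  | Input
  | GoLeft
  | GoRight
  | Pair prog prog
  | Then prog prog
  | Cond prog prog prog
  | While prog prog

text \<open>\<open>runs p x y t\<close>: on input \<open>x\<close> the program \<open>p\<close> halts with output \<open>y\<close> after \<open>t\<close> steps.\<close>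

inductive runs :: "prog \<Rightarrow> tree \<Rightarrow> tree \<Rightarrow> nat \<Rightarrow> bool" where
  mkleaf: "runs MkLeaf x Leaf 1"
| input: "runs Input x x 1"
| goleft: "runs GoLeft x (left x) 1"
| goright: "runs GoRight x (right x) 1"
| pair: "runs p x y s \<Longrightarrow> runs q x z t \<Longrightarrow> runs (Pair p q) x (Node y z) (s + t + 1)"
| seq: "runs p x y s \<Longrightarrow> runs q y z t \<Longrightarrow> runs (Then p q) x z (s + t + 1)"
| cond_true: "runs b x c s \<Longrightarrow> c \<noteq> Leaf \<Longrightarrow> runs p x y t \<Longrightarrow> runs (Cond b p q) x y (s + t + 1)"
| cond_false: "runs b x Leaf s \<Longrightarrow> runs q x y t \<Longrightarrow> runs (Cond b p q) x y (s + t + 1)"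
| while_stop: "runs b x Leaf s \<Longrightarrow> runs (While b p) x x (s + 1)"
| while_step: "runs b x c s \<Longrightarrow> c \<noteq> Leaf \<Longrightarrow> runs p x y t \<Longrightarrow> runs (While b p) y z u \<Longrightarrow>
    runs (While b p) x z (s + t + u + 1)"

inductive_cases runs_elims:
  "runs MkLeaf x y t" "runs Input x y t" "runs GoLeft x y t" "runs GoRight x y t"
  "runs (Pair p q) x y t" "runs (Then p q) x y t" "runs (Cond b p q) x y t" "runs (While b p) x y t"

lemma runs_deterministic: "runs p x y t \<Longrightarrow> runs p x y' t' \<Longrightarrow> y = y' \<and> t = t'"
proof (induction p x y t arbitrary: y' t' rule: runs.induct)
  case (pair p x y s q z t)
  from pair.prems show ?case
    by (rule runs_elims) (auto dest!: pair.IH)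
next
  case (seq p x y s q z t)
  from seq.prems show ?case
    by (rule runs_elims) (auto dest!: seq.IH(1), auto dest!: seq.IH(2))
next
  case (cond_true b x c s p y t q)
  from cond_true.prems cond_true.hyps(2) show ?case
    by - (erule runs_elims, (auto dest!: cond_true.IH)[2])
next
  case (cond_false b x s q y t p)
  from cond_false.prems show ?case
    by (rule runs_elims) (auto dest!: cond_false.IH)
next
  case (while_stop b x s p)
  from while_stop.prems show ?case
    by (rule runs_elims) (auto dest!: while_stop.IH)
next
  case (while_step b x c s p y t z u)
  from while_step.prems while_step.hyps(2) show ?case
    by - (erule runs_elims,
          (auto dest!: while_step.IH(1,2), auto dest!: while_step.IH(3))[2])
qed (auto elim: runs_elims)

text \<open>An instance is presented to an algorithm as the table of all its relations, after listing
  the variables and the values of each domain in an arbitrary order. The blocks for pairs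
  \<open>(v, v)\<close> are identity matrices, which record the sizes of the domains.\<close>

fun list_tree :: "tree list \<Rightarrow> tree" where
  "list_tree [] = Leaf"
| "list_tree (x # xs) = Node x (list_tree xs)"

definition bit_tree :: "bool \<Rightarrow> tree" where
  "bit_tree b = (if b then Node Leaf Leaf else Leaf)"

definition table :: "('v, 'a) csp \<Rightarrow> 'v list \<Rightarrow> ('v \<Rightarrow> 'a list) \<Rightarrow> tree" where
  "table I vs ds =
     list_tree (map (\<lambda>u. list_tree (map (\<lambda>v. list_tree (map (\<lambda>a. list_tree (map (\<lambda>b.
       bit_tree (if u = v then a = b else (a, b) \<in> rel I u v)) (ds v))) (ds u))) vs)) vs)"

definition encodes :: "tree \<Rightarrow> ('v, 'a) csp \<Rightarrow> bool" where
  "encodes x I \<longleftrightarrow>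
     (\<exists>vs ds. distinct vs \<and> set vs = vars I \<and>
        (\<forall>v\<in>vars I. distinct (ds v) \<and> set (ds v) = dmn I v) \<and> x = table I vs ds)"

text \<open>The algorithm is only required to halt in polynomial time and to answer correctly on
  instances of the class.\<close>

definition tractable :: "('v, 'a) csp set \<Rightarrow> bool" where
  "tractable C \<longleftrightarrow>
     (\<exists>(p :: prog) (q :: nat poly). \<forall>I\<in>C. \<forall>x. encodes x I \<longrightarrow>
        (\<exists>y t. runs p x y t \<and> t \<le> poly q (nodes x) \<and> (y \<noteq> Leaf \<longleftrightarrow> (\<exists>s. is_solution I s))))"

definition sub_pattern_tractable :: "'x pattern \<Rightarrow> bool" where
  "sub_pattern_tractable P \<longleftrightarrow> tractable (CSP_SP P)"

definition topological_minor_tractable :: "'x pattern \<Rightarrow> bool" where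
  "topological_minor_tractable P \<longleftrightarrow> tractable (CSP_TM P)"

end

theory Submission
  imports Defs
begin

text \<open>Join two variables of an instance by an edge if some pair of their values is forbidden. An
  instance contains \<open>P\<close> as a topological minor as soon as \<open>P0\<close> occurs on variables \<open>v1\<close>, \<open>v2\<close>, \<open>v3\<close>
  such that \<open>v1\<close> and \<open>v3\<close> lie on a common cycle that avoids \<open>v2\<close>. A fragment is a connected
  set \<open>A\<close> of variables with at most two neighbours outside of \<open>A\<close>, which moreover are connected
  outside of \<open>A\<close>. If \<open>A\<close> is a minimal fragment, then \<open>A\<close> and its neighbours, joined by an edge, form a
  3-connected graph, so that the required cycles exist and \<open>P0\<close> cannot occur inside \<open>A\<close> if the
  instance excludes \<open>P\<close>. Hence the algorithm for \<open>P0\<close> decides which values of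
  the neighbours extend to \<open>A\<close>, and \<open>A\<close> can be replaced by a constraint between its neighbours. The smaller
  instance still excludes \<open>P\<close>: as \<open>P\<close> has at most one negative edge between any two parts, a new
  negative edge can be subdivided along a path through \<open>A\<close>. Repeating this leaves a single variable.\<close>

section \<open>Polynomial-time functions on encoded data\<close>

text \<open>Any two vertices of a 2-connected graph with at least three vertices lie on a common
  cycle, so a graph that stays 2-connected without \<open>v2\<close> is what is needed; hence the
  aim at 3-connectivity. In \<open>P\<close> the edge between \<open>p1\<close> and
  \<open>r1\<close> is subdivided along one arc of the cycle, while \<open>U4\<close> sits on the
  other arc. The ends of the three new edges are six different points because two negative edges of
  an instance that meet in a variable need not share a value. Subdividing at two parts sends every
  edge between them through the same new part, positive edges included. \<open>P0\<close> has no
  edges between \<open>U1\<close> and \<open>U3\<close>, so the arcs carry new edges only; when a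
  fragment is eliminated, the positive edges are carried by a solution on the fragment. A second
  negative edge would be harmful there, as different forbidden pairs may need different paths. The
  program for \<open>P0\<close> is guaranteed to halt and to be correct only on instances without
  \<open>P0\<close>, which is why polynomial time is developed relative to a set of admissible
  inputs.\<close>

class enc =
  fixes encode :: "'a \<Rightarrow> tree"

instantiation tree :: enc
begin
definition encode_tree :: "tree \<Rightarrow> tree" where "encode_tree x = x"
instance ..
end

instantiation bool :: enc
begin
definition encode_bool :: "bool \<Rightarrow> tree" where "encode_bool = bit_tree"
instance ..
end

text \<open>Unary encoding costs nothing here: the only numbers that occur are positions in lists
  and lengths of lists.\<close>

instantiation nat :: enc
begin
primrec encode_nat :: "nat \<Rightarrow> tree" where
  "encode_nat 0 = Leaf"
| "encode_nat (Suc n) = Node Leaf (encode_nat n)"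
instance ..
end

instantiation list :: (enc) enc
begin
definition encode_list :: "'a list \<Rightarrow> tree" where "encode_list xs = list_tree (map encode xs)"
instance ..
end

instantiation prod :: (enc, enc) enc
begin
definition encode_prod :: "'a \<times> 'b \<Rightarrow> tree" where
  "encode_prod x = Node (encode (fst x)) (encode (snd x))"
instance ..
end

lemma encode_list_simps [simp]:
  "encode [] = Leaf" "encode (x # xs) = Node (encode x) (encode xs)"
  by (simp_all add: encode_list_def)

lemma encode_prod_simps [simp]: "encode (x, y) = Node (encode x) (encode y)"
  by (simp add: encode_prod_def)

lemma encode_bool_simps [simp]: "encode True = Node Leaf Leaf" "encode False = Leaf"
  by (simp_all add: encode_bool_def bit_tree_def)

definition sz :: "'a::enc \<Rightarrow> nat" where
  "sz x = nodes (encode x)"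

lemma sz_simps [simp]:
  "sz ([] :: 'a::enc list) = 0" "sz (x # xs) = Suc (sz x + sz xs)" "sz (a, b) = Suc (sz a + sz b)"
  "sz False = 0" "sz True = 1" "sz (n::nat) = n"
  by (induction n) (simp_all add: sz_def)

lemma length_le_sz: "length xs \<le> sz xs"
  by (induction xs) auto

lemma sz_mem: "x \<in> set xs \<Longrightarrow> sz x < sz xs"
  by (induction xs) auto

lemma sz_list_le: "(\<And>x. x \<in> set xs \<Longrightarrow> sz x \<le> b) \<Longrightarrow> sz xs \<le> length xs * Suc b"
proof (induction xs)
  case (Cons x xs)
  from Cons.prems[of x] Cons.IH Cons.prems show ?case by fastforce
qed simp

lemma sz_append [simp]: "sz (xs @ ys) = sz xs + sz ys"
  by (induction xs) auto

lemma sz_rev [simp]: "sz (rev xs) = sz xs"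
  by (induction xs) auto

lemma sz_filter: "sz (filter P xs) \<le> sz xs"
  by (induction xs) auto

section \<open>Polynomial bounds and polynomial time under a promise\<close>

definition polybd :: "'a::enc set \<Rightarrow> ('a \<Rightarrow> nat) \<Rightarrow> bool" where
  "polybd D f \<longleftrightarrow> (\<exists>q. \<forall>x\<in>D. f x \<le> poly q (sz x))"

lemma poly_nat_mono: "a \<le> b \<Longrightarrow> poly q a \<le> poly q b" for q :: "nat poly"
  by (induction q) (auto intro!: add_mono mult_mono)

lemma polybd_poly: "polybd D (\<lambda>x. poly q (sz x))"
  unfolding polybd_def by blast

lemma polybd_const: "polybd D (\<lambda>x. c)"
  unfolding polybd_def by (rule exI[of _ "[:c:]"]) simp

lemma polybd_sz: "polybd D sz"
  unfolding polybd_def by (rule exI[of _ "[:0, 1:]"]) simp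

lemma polybd_add: "polybd D f \<Longrightarrow> polybd D g \<Longrightarrow> polybd D (\<lambda>x. f x + g x)"
  unfolding polybd_def by (metis add_mono poly_add)

lemma polybd_mult: "polybd D f \<Longrightarrow> polybd D g \<Longrightarrow> polybd D (\<lambda>x. f x * g x)"
  unfolding polybd_def by (metis mult_le_mono poly_mult)

lemma polybd_Suc: "polybd D f \<Longrightarrow> polybd D (\<lambda>x. Suc (f x))"
  using polybd_add[OF polybd_const[of D 1]] by simp

lemma polybd_comp: "polybd D f \<Longrightarrow> polybd D (\<lambda>x. poly q (f x))"
  unfolding polybd_def by (metis poly_nat_mono poly_pcompose)

lemma polybd_mono: "polybd D g \<Longrightarrow> (\<And>x. x \<in> D \<Longrightarrow> f x \<le> g x) \<Longrightarrow> polybd D f"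
  unfolding polybd_def by (meson order_trans)

lemmas polybd_intros = polybd_const polybd_sz polybd_add polybd_mult polybd_Suc polybd_comp

text \<open>The set \<open>D\<close> is a promise: nothing is required of inputs outside of it.\<close>

definition ptime :: "'a::enc set \<Rightarrow> ('a \<Rightarrow> 'b::enc) \<Rightarrow> bool" where
  "ptime D f \<longleftrightarrow> polybd D (\<lambda>x. sz (f x)) \<and>
     (\<exists>p T. polybd D T \<and> (\<forall>x\<in>D. \<exists>t\<le>T x. runs p (encode x) (encode (f x)) t))"

lemma ptimeI:
  assumes "\<And>x. x \<in> D \<Longrightarrow> \<exists>t\<le>T x. runs p (encode x) (encode (f x)) t"
    and "polybd D T" "polybd D (\<lambda>x. sz (f x))"
  shows "ptime D f"
  using assms unfolding ptime_def by blast

lemma ptimeE: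
  assumes "ptime D f"
  obtains p q where "\<And>x. x \<in> D \<Longrightarrow> \<exists>t\<le>poly q (sz x). runs p (encode x) (encode (f x)) t"
    and "polybd D (\<lambda>x. sz (f x))"
  using assms unfolding ptime_def polybd_def by (meson order_trans)

lemma ptime_sz: "ptime D f \<Longrightarrow> polybd D (\<lambda>x. sz (f x))"
  by (simp add: ptime_def)

lemma polybd_subset: "polybd D f \<Longrightarrow> D' \<subseteq> D \<Longrightarrow> polybd D' f"
  unfolding polybd_def by (meson subsetD)

lemma ptime_mono:
  assumes "ptime D f" "D' \<subseteq> D"
  shows "ptime D' f"
proof -
  obtain p q where "\<And>x. x \<in> D \<Longrightarrow> \<exists>t\<le>poly q (sz x). runs p (encode x) (encode (f x)) t"
    using ptimeE[OF assms(1)] by metis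
  with assms(2) show ?thesis
    by (intro ptimeI[where T = "\<lambda>x. poly q (sz x)" and p = p] polybd_poly
          polybd_subset[OF ptime_sz[OF assms(1)]]) blast+
qed

lemma ptime_cong: "ptime D f \<Longrightarrow> (\<And>x. x \<in> D \<Longrightarrow> f x = g x) \<Longrightarrow> ptime D g"
  unfolding ptime_def polybd_def by simp

lemma ptime_id: "ptime D (\<lambda>x. x)"
  by (rule ptimeI[where p = Input and T = "\<lambda>_. 1"])
     (use input in \<open>auto intro!: polybd_intros\<close>)

text \<open>The program for \<open>g\<close> runs on the output of \<open>f\<close>, so its time is
  polynomial in the input only because the size of \<open>f x\<close> is. That size bound does not
  follow from the time bound: repeated pairing with sharing builds trees whose size is exponential
  in the number of steps.\<close>

lemma ptime_comp:
  assumes "ptime E g" "ptime D f" "\<And>x. x \<in> D \<Longrightarrow> f x \<in> E"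
  shows "ptime D (\<lambda>x. g (f x))"
proof -
  obtain p q where f: "\<And>x. x \<in> D \<Longrightarrow> \<exists>t\<le>poly q (sz x). runs p (encode x) (encode (f x)) t"
    using ptimeE[OF assms(2)] by metis
  obtain p' q' where g: "\<And>x. x \<in> E \<Longrightarrow> \<exists>t\<le>poly q' (sz x). runs p' (encode x) (encode (g x)) t"
    using ptimeE[OF assms(1)] by metis
  obtain r where r: "\<And>x. x \<in> E \<Longrightarrow> sz (g x) \<le> poly r (sz x)"
    using ptime_sz[OF assms(1)] unfolding polybd_def by auto
  show ?thesis
  proof (rule ptimeI[where p = "Then p p'" and T = "\<lambda>x. poly q (sz x) + poly q' (sz (f x)) + 1"])
    fix x assume x: "x \<in> D"
    from f[OF x] g[OF assms(3)[OF x]] obtain s t where st: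
      "s \<le> poly q (sz x)" "runs p (encode x) (encode (f x)) s"
      "t \<le> poly q' (sz (f x))" "runs p' (encode (f x)) (encode (g (f x))) t" by blast
    then show "\<exists>t\<le>poly q (sz x) + poly q' (sz (f x)) + 1.
                 runs (Then p p') (encode x) (encode (g (f x))) t"
      by (intro exI[of _ "s + t + 1"] conjI seq[OF st(2,4)]) simp
  next
    show "polybd D (\<lambda>x. poly q (sz x) + poly q' (sz (f x)) + 1)"
      by (intro polybd_intros ptime_sz[OF assms(2)])
    show "polybd D (\<lambda>x. sz (g (f x)))"
      by (rule polybd_mono[OF polybd_comp[OF ptime_sz[OF assms(2)]]]) (use r assms(3) in auto)
  qed
qed

lemma ptime_pair:
  assumes "ptime D f" "ptime D g"
  shows "ptime D (\<lambda>x. (f x, g x))"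
proof -
  obtain p q where f: "\<And>x. x \<in> D \<Longrightarrow> \<exists>t\<le>poly q (sz x). runs p (encode x) (encode (f x)) t"
    using ptimeE[OF assms(1)] by metis
  obtain p' q' where g: "\<And>x. x \<in> D \<Longrightarrow> \<exists>t\<le>poly q' (sz x). runs p' (encode x) (encode (g x)) t"
    using ptimeE[OF assms(2)] by metis
  show ?thesis
  proof (rule ptimeI[where p = "Pair p p'" and T = "\<lambda>x. poly q (sz x) + poly q' (sz x) + 1"])
    fix x assume x: "x \<in> D"
    from f[OF x] g[OF x] obtain s t where st:
      "s \<le> poly q (sz x)" "runs p (encode x) (encode (f x)) s"
      "t \<le> poly q' (sz x)" "runs p' (encode x) (encode (g x)) t" by blast
    then show "\<exists>t\<le>poly q (sz x) + poly q' (sz x) + 1.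
                 runs (Pair p p') (encode x) (encode (f x, g x)) t"
      using pair[OF st(2,4)] by (intro exI[of _ "s + t + 1"] conjI) simp_all
  next
    show "polybd D (\<lambda>x. sz (f x, g x))"
      unfolding sz_simps by (intro polybd_intros ptime_sz assms)
  qed (intro polybd_intros)
qed

lemma ptime_if:
  assumes "ptime D b" "ptime {x \<in> D. b x} f" "ptime {x \<in> D. \<not> b x} g"
  shows "ptime D (\<lambda>x. if b x then f x else g x)"
proof -
  obtain p q where b: "\<And>x. x \<in> D \<Longrightarrow> \<exists>t\<le>poly q (sz x). runs p (encode x) (encode (b x)) t"
    using ptimeE[OF assms(1)] by metis
  obtain p1 q1 where f: "\<And>x. x \<in> {x \<in> D. b x} \<Longrightarrow>
      \<exists>t\<le>poly q1 (sz x). runs p1 (encode x) (encode (f x)) t"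
    using ptimeE[OF assms(2)] by metis
  obtain p2 q2 where g: "\<And>x. x \<in> {x \<in> D. \<not> b x} \<Longrightarrow>
      \<exists>t\<le>poly q2 (sz x). runs p2 (encode x) (encode (g x)) t"
    using ptimeE[OF assms(3)] by metis
  obtain r1 r2 where r: "\<And>x. x \<in> {x \<in> D. b x} \<Longrightarrow> sz (f x) \<le> poly r1 (sz x)"
      "\<And>x. x \<in> {x \<in> D. \<not> b x} \<Longrightarrow> sz (g x) \<le> poly r2 (sz x)"
    using assms(2,3)[THEN ptime_sz] unfolding polybd_def by auto
  show ?thesis
  proof (rule ptimeI[where p = "Cond p p1 p2" and
        T = "\<lambda>x. poly q (sz x) + (poly q1 (sz x) + poly q2 (sz x)) + 1"])
    fix x assume x: "x \<in> D"
    from b[OF x] obtain s where s: "s \<le> poly q (sz x)" "runs p (encode x) (encode (b x)) s"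
      by blast
    show "\<exists>t\<le>poly q (sz x) + (poly q1 (sz x) + poly q2 (sz x)) + 1.
            runs (Cond p p1 p2) (encode x) (encode (if b x then f x else g x)) t"
    proof (cases "b x")
      case True
      with f[of x] x obtain t where t: "t \<le> poly q1 (sz x)" "runs p1 (encode x) (encode (f x)) t"
        by blast
      from cond_true[OF s(2) _ t(2), of p2] s(1) t(1) True show ?thesis
        by (intro exI[of _ "s + t + 1"]) simp
    next
      case False
      with g[of x] x obtain t where t: "t \<le> poly q2 (sz x)" "runs p2 (encode x) (encode (g x)) t"
        by blast
      from cond_false[of p "encode x" s p2 "encode (g x)" t p1] s t False show ?thesis
        by (intro exI[of _ "s + t + 1"]) simp
    qed
  next
    show "polybd D (\<lambda>x. sz (if b x then f x else g x))"
      by (rule polybd_mono[OF polybd_add[OF polybd_poly[of _ r1] polybd_poly[of _ r2]]])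
         (use r in \<open>auto intro: trans_le_add1 trans_le_add2\<close>)
  qed (intro polybd_intros)
qed

text \<open>One pass of a while loop handles one list element. \<open>E\<close> contains the calls
  of \<open>g\<close> that really arise, and \<open>B\<close> bounds every intermediate accumulator;
  a step that doubles its accumulator would otherwise produce exponentially large values.\<close>

lemma ptime_fold:
  fixes f :: "'x::enc \<Rightarrow> 'y::enc list" and i :: "'x \<Rightarrow> 'a::enc"
  assumes f: "ptime D f" and i: "ptime D i" and g: "ptime E (\<lambda>(y, a, x). g y a x)"
    and E: "\<And>x ys y zs. x \<in> D \<Longrightarrow> f x = ys @ y # zs \<Longrightarrow>
              (y, fold (\<lambda>y a. g y a x) ys (i x), x) \<in> E"
    and B: "polybd D B"
    and sz_le: "\<And>x ys zs. x \<in> D \<Longrightarrow> f x = ys @ zs \<Longrightarrow> sz (fold (\<lambda>y a. g y a x) ys (i x)) \<le> B x"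
  shows "ptime D (\<lambda>x. fold (\<lambda>y a. g y a x) (f x) (i x))"
proof -
  obtain pf qf where pf: "\<And>x. x \<in> D \<Longrightarrow> \<exists>t\<le>poly qf (sz x). runs pf (encode x) (encode (f x)) t"
    using ptimeE[OF f] by metis
  obtain pi qi where pi: "\<And>x. x \<in> D \<Longrightarrow> \<exists>t\<le>poly qi (sz x). runs pi (encode x) (encode (i x)) t"
    using ptimeE[OF i] by metis
  obtain pg qg where pg: "\<And>x. x \<in> E \<Longrightarrow>
      \<exists>t\<le>poly qg (sz x). runs pg (encode x) (encode ((\<lambda>(y, a, x). g y a x) x)) t"
    using ptimeE[OF g] by metis
  \<comment> \<open>The loop state is \<open>(rest of the list, accumulator, x)\<close>, and the
    loop test \<open>GoLeft\<close> fails exactly when the rest is \<open>Leaf\<close>. The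
    component \<open>x\<close> is carried along unchanged because programs have no
    variables.\<close>
  define body where "body = Pair (Then GoLeft GoRight)
    (Pair (Then (Pair (Then GoLeft GoLeft) GoRight) pg) (Then GoRight GoRight))"
  \<comment> \<open>Uniform time bound for a single call of \<open>g\<close>: its argument consists
    of an element of \<open>f x\<close>, an accumulator and \<open>x\<close>, and the two
    \<open>Suc\<close> count the pairing nodes.\<close>
  define M where "M x = poly qg (Suc (Suc (sz (f x) + B x + sz x)))" for x
  \<comment> \<open>A pass costs \<open>t + 16\<close> steps, within the bound:
    \<open>t + 14\<close> for the body, one for the test and one for the loop itself. The final
    \<open>2\<close> pays for the failing test.\<close>
  have loop: "\<exists>t\<le>length zs * (M x + 18) + 2. runs (While GoLeft body)
      (Node (encode zs) (Node (encode (fold (\<lambda>y a. g y a x) ys (i x))) (encode x)))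
      (Node Leaf (Node (encode (fold (\<lambda>y a. g y a x) (ys @ zs) (i x))) (encode x))) t"
    if x: "x \<in> D" and eq: "f x = ys @ zs" for x ys zs
    using eq
  proof (induction zs arbitrary: ys)
    case Nil
    have "runs GoLeft (Node Leaf r) Leaf 1" for r
      using goleft[of "Node Leaf r"] by simp
    from while_stop[OF this, of body] show ?case
      by (intro exI[of _ 2]) (simp add: numeral_2_eq_2)
  next
    case (Cons y zs)
    let ?a = "fold (\<lambda>y a. g y a x) ys (i x)"
    let ?s = "Node (encode (y # zs)) (Node (encode ?a) (encode x))"
    have fx: "y \<in> set (f x)" using Cons.prems by simp
    obtain t where t: "t \<le> poly qg (sz (y, ?a, x))"
      "runs pg (encode (y, ?a, x)) (encode (g y ?a x)) t"
      using pg[OF E[OF x Cons.prems]] by auto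
    have "sz (y, ?a, x) \<le> Suc (Suc (sz (f x) + B x + sz x))"
      using sz_mem[OF fx] sz_le[OF x Cons.prems] by simp
    from poly_nat_mono[OF this, of qg] t(1) have tM: "t \<le> M x" unfolding M_def by simp
    obtain u where u: "u \<le> length zs * (M x + 18) + 2" "runs (While GoLeft body)
      (Node (encode zs) (Node (encode (g y ?a x)) (encode x)))
      (Node Leaf (Node (encode (fold (\<lambda>y a. g y a x) (ys @ y # zs) (i x))) (encode x))) u"
      using Cons.IH[of "ys @ [y]"] Cons.prems by auto
    have r1: "runs (Then GoLeft GoRight) ?s (encode zs) 3"
      using seq[OF goleft[of ?s] goright] by (simp add: eval_nat_numeral)
    have r2: "runs (Pair (Then GoLeft GoLeft) GoRight) ?s (encode (y, ?a, x)) 5"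
      using pair[OF seq[OF goleft[of ?s] goleft] goright[of ?s]] by (simp add: eval_nat_numeral)
    have r3: "runs (Then GoRight GoRight) ?s (encode x) 3"
      using seq[OF goright[of ?s] goright] by (simp add: eval_nat_numeral)
    have body: "runs body ?s (Node (encode zs) (Node (encode (g y ?a x)) (encode x))) (t + 14)"
      unfolding body_def using pair[OF r1 pair[OF seq[OF r2 t(2)] r3]]
      by (simp add: eval_nat_numeral)
    have "runs (While GoLeft body) ?s
      (Node Leaf (Node (encode (fold (\<lambda>y a. g y a x) (ys @ y # zs) (i x))) (encode x)))
      (1 + (t + 14) + u + 1)"
      by (rule while_step[OF goleft _ body u(2)]) simp
    then show ?case using tM u(1) by (intro exI[of _ "1 + (t + 14) + u + 1"]) simp
  qed
  show ?thesis
  proof (rule ptimeI[where p = "Then (Pair pf (Pair pi Input)) (Then (While GoLeft body) (Then GoRight GoLeft))"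
        and T = "\<lambda>x. poly qf (sz x) + poly qi (sz x) + (sz (f x) * (M x + 18) + 2) + 8"])
    fix x assume x: "x \<in> D"
    obtain s where s: "s \<le> poly qf (sz x)" "runs pf (encode x) (encode (f x)) s"
      using pf[OF x] by blast
    obtain s' where s': "s' \<le> poly qi (sz x)" "runs pi (encode x) (encode (i x)) s'"
      using pi[OF x] by blast
    obtain t where t: "t \<le> length (f x) * (M x + 18) + 2" "runs (While GoLeft body)
      (Node (encode (f x)) (Node (encode (i x)) (encode x)))
      (Node Leaf (Node (encode (fold (\<lambda>y a. g y a x) (f x) (i x))) (encode x))) t"
      using loop[OF x, of "[]" "f x"] by auto
    have *: "runs (Then GoRight GoLeft)
      (Node Leaf (Node (encode (fold (\<lambda>y a. g y a x) (f x) (i x))) (encode x)))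
      (encode (fold (\<lambda>y a. g y a x) (f x) (i x))) 3"
      using seq[OF goright[of "Node Leaf (Node (encode (fold (\<lambda>y a. g y a x) (f x) (i x))) (encode x))"] goleft]
      by (simp add: eval_nat_numeral)
    have "t \<le> sz (f x) * (M x + 18) + 2"
      using t(1) mult_right_mono[OF length_le_sz[of "f x"], of "M x + 18"] by linarith
    with s(1) s'(1) show "\<exists>t\<le>poly qf (sz x) + poly qi (sz x) + (sz (f x) * (M x + 18) + 2) + 8.
        runs (Then (Pair pf (Pair pi Input)) (Then (While GoLeft body) (Then GoRight GoLeft)))
          (encode x) (encode (fold (\<lambda>y a. g y a x) (f x) (i x))) t"
      by (intro exI[of _ "s + (s' + 1 + 1) + 1 + (t + 3 + 1) + 1"] conjI
            seq[OF pair[OF s(2) pair[OF s'(2) input]] seq[OF t(2) *]]) simp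
  next
    show "polybd D (\<lambda>x. poly qf (sz x) + poly qi (sz x) + (sz (f x) * (M x + 18) + 2) + 8)"
      unfolding M_def by (intro polybd_intros ptime_sz[OF f] B)
    show "polybd D (\<lambda>x. sz (fold (\<lambda>y a. g y a x) (f x) (i x)))"
      by (rule polybd_mono[OF B]) (use sz_le in auto)
  qed
qed

lemma ptime_fold_inv:
  fixes f :: "'x::enc \<Rightarrow> 'y::enc list" and i :: "'x \<Rightarrow> 'a::enc"
  assumes f: "ptime D f" and i: "ptime D i" and g: "ptime E (\<lambda>(y, a, x). g y a x)"
    and init: "\<And>x. x \<in> D \<Longrightarrow> Inv x (i x)"
    and step: "\<And>x y a. x \<in> D \<Longrightarrow> y \<in> set (f x) \<Longrightarrow> Inv x a \<Longrightarrow> (y, a, x) \<in> E \<and> Inv x (g y a x)"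
    and B: "polybd D B"
    and sz_le: "\<And>x a. x \<in> D \<Longrightarrow> Inv x a \<Longrightarrow> sz a \<le> B x"
  shows "ptime D (\<lambda>x. fold (\<lambda>y a. g y a x) (f x) (i x))"
proof -
  have inv: "Inv x (fold (\<lambda>y a. g y a x) ys (i x))" if "x \<in> D" "f x = ys @ zs" for x ys zs
    using that(2)
    by (induction ys arbitrary: zs rule: rev_induct) (use init step that(1) in auto)
  show ?thesis
    by (rule ptime_fold[OF f i g _ B]) (use inv step sz_le in \<open>force, blast\<close>)
qed

section \<open>Closure of polynomial time under the basic operations\<close>

lemma ptime_fst:
  fixes f :: "'a::enc \<Rightarrow> 'b::enc \<times> 'c::enc"
  assumes "ptime D f"
  shows "ptime D (\<lambda>x. fst (f x))"
proof -
  have "runs GoLeft (encode z) (encode (fst z)) 1" for z :: "'b \<times> 'c"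
    using goleft[of "encode z"] by (cases z) simp
  moreover have "sz (fst z) \<le> sz z" for z :: "'b \<times> 'c"
    by (cases z) simp
  ultimately have "ptime UNIV (fst :: 'b \<times> 'c \<Rightarrow> 'b)"
    by (intro ptimeI[OF _ polybd_const[of _ 1] polybd_mono[OF polybd_sz], where p = GoLeft]) blast+
  from ptime_comp[OF this assms UNIV_I] show ?thesis .
qed

lemma ptime_snd:
  fixes f :: "'a::enc \<Rightarrow> 'b::enc \<times> 'c::enc"
  assumes "ptime D f"
  shows "ptime D (\<lambda>x. snd (f x))"
proof -
  have "runs GoRight (encode z) (encode (snd z)) 1" for z :: "'b \<times> 'c"
    using goright[of "encode z"] by (cases z) simp
  moreover have "sz (snd z) \<le> sz z" for z :: "'b \<times> 'c"
    by (cases z) simp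
  ultimately have "ptime UNIV (snd :: 'b \<times> 'c \<Rightarrow> 'c)"
    by (intro ptimeI[OF _ polybd_const[of _ 1] polybd_mono[OF polybd_sz], where p = GoRight]) blast+
  from ptime_comp[OF this assms UNIV_I] show ?thesis .
qed

lemma runs_tree: "\<exists>p t. \<forall>x. runs p x y t"
proof (induction y)
  case Leaf
  then show ?case by (metis mkleaf)
next
  case (Node y z)
  then show ?case by (metis pair)
qed

lemma ptime_const: "ptime D (\<lambda>x. c)"
proof -
  obtain p t where "\<And>x. runs p x (encode c) t" using runs_tree by blast
  then show ?thesis
    by (intro ptimeI[where p = p and T = "\<lambda>_. t"]) (auto intro!: polybd_intros)
qed

text \<open>A nonempty list already counts as true in the machine model; the conditional merely
  replaces it by the canonical tree for \<open>True\<close>. Bounded quantifiers and comparisons of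
  numbers are reduced to this test.\<close>

lemma ptime_neq_Nil:
  fixes f :: "'a::enc \<Rightarrow> 'b::enc list"
  assumes "ptime D f"
  shows "ptime D (\<lambda>x. f x \<noteq> [])"
proof -
  let ?p = "Cond Input (Pair MkLeaf MkLeaf) MkLeaf"
  have run: "runs ?p (encode xs) (encode (xs \<noteq> [])) (if xs \<noteq> [] then 5 else 3)" for xs :: "'b list"
  proof (cases xs)
    case Nil
    then show ?thesis using cond_false[OF input mkleaf] by (simp add: eval_nat_numeral)
  next
    case (Cons y ys)
    then show ?thesis using cond_true[OF input _ pair[OF mkleaf mkleaf]] by (simp add: eval_nat_numeral)
  qed
  have "\<exists>t\<le>5. runs ?p (encode xs) (encode (xs \<noteq> [])) t" for xs :: "'b list"
    by (rule exI[of _ "if xs \<noteq> [] then 5 else 3"], rule conjI, simp, rule run)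
  moreover have "sz b \<le> 1" for b :: bool by (cases b) auto
  ultimately have "ptime UNIV (\<lambda>xs :: 'b list. xs \<noteq> [])"
    by (intro ptimeI[OF _ polybd_const[of _ 5] polybd_mono[OF polybd_const[of _ 1]], where p = ?p]) blast+
  from ptime_comp[OF this assms UNIV_I] show ?thesis .
qed

text \<open>Programs only see encodings, so values with equal encodings can be exchanged across
  types: a list cell is a pair, and a number is a list of leaves.\<close>

lemma ptime_encode_eq: "ptime D f \<Longrightarrow> (\<And>x. x \<in> D \<Longrightarrow> encode (g x) = encode (f x)) \<Longrightarrow> ptime D g"
  unfolding ptime_def polybd_def sz_def by simp

lemma ptime_Cons: "ptime D f \<Longrightarrow> ptime D g \<Longrightarrow> ptime D (\<lambda>x. f x # g x)"
  by (rule ptime_encode_eq[OF ptime_pair]) simp_all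

lemma fold_Cons: "fold (\<lambda>y a. y # a) ys a = rev ys @ a"
  by (induction ys arbitrary: a) auto

lemma ptime_fold_Cons: "ptime D f \<Longrightarrow> ptime D g \<Longrightarrow> ptime D (\<lambda>x. fold (\<lambda>y a. y # a) (f x) (g x))"
proof (rule ptime_fold[where E = UNIV and B = "\<lambda>x. sz (f x) + sz (g x)"])
  show "ptime UNIV (\<lambda>(y, a, x). y # a)"
    unfolding split_def by (intro ptime_Cons ptime_fst ptime_snd ptime_id)
  show "sz (fold (\<lambda>y a. y # a) ys (g x)) \<le> sz (f x) + sz (g x)" if "f x = ys @ zs" for x ys zs
    using that by (simp add: fold_Cons)
qed (auto intro!: polybd_intros ptime_sz)

lemma ptime_rev: "ptime D f \<Longrightarrow> ptime D (\<lambda>x. rev (f x))"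
  using ptime_fold_Cons[OF _ ptime_const[of D "[]"]] by (simp add: fold_Cons)

lemma ptime_append: "ptime D f \<Longrightarrow> ptime D g \<Longrightarrow> ptime D (\<lambda>x. f x @ g x)"
  using ptime_fold_Cons[OF ptime_rev] by (simp add: fold_Cons)

text \<open>The promise for \<open>g\<close> records that \<open>y\<close> comes from
  \<open>f x\<close>, so \<open>g\<close> may rely on properties of the list elements. The fold
  builds the result in reverse.\<close>

lemma ptime_map:
  assumes f: "ptime D f" and g: "ptime {(x, y). x \<in> D \<and> y \<in> set (f x)} (\<lambda>z. g (fst z) (snd z))"
  shows "ptime D (\<lambda>x. map (g x) (f x))"
proof -
  let ?E = "{(x, y). x \<in> D \<and> y \<in> set (f x)}"
  obtain q where q: "\<And>x y. x \<in> D \<Longrightarrow> y \<in> set (f x) \<Longrightarrow> sz (g x y) \<le> poly q (sz (x, y))"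
    using ptime_sz[OF g] unfolding polybd_def by fastforce
  have fold: "fold (\<lambda>y a. g x y # a) ys [] = rev (map (g x) ys)" for x ys
    by (induction ys rule: rev_induct) auto
  have "ptime D (\<lambda>x. fold (\<lambda>y a. g x y # a) (f x) [])"
  proof (rule ptime_fold[where E = "{(y, a, x). (x, y) \<in> ?E}" and B = "\<lambda>x. sz (f x) * Suc (poly q (Suc (sz x + sz (f x))))"])
    show "ptime {(y, a, x). (x, y) \<in> ?E} (\<lambda>(y, a, x). g x y # a)"
      unfolding split_def
    proof (intro ptime_Cons)
      show "ptime {p. (snd (snd p), fst p) \<in> {p. fst p \<in> D \<and> snd p \<in> set (f (fst p))}}
              (\<lambda>p. g (snd (snd p)) (fst p))"
        by (rule ptime_comp[OF g, of _ "\<lambda>p. (snd (snd p), fst p)", simplified])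
           (auto intro!: ptime_pair ptime_fst ptime_snd ptime_id)
    qed (intro ptime_fst ptime_snd ptime_id)
    fix x ys zs assume x: "x \<in> D" and eq: "f x = ys @ zs"
    have "sz (g x y) \<le> poly q (Suc (sz x + sz (f x)))" if "y \<in> set ys" for y
    proof -
      have y: "y \<in> set (f x)" using that eq by simp
      have "sz (x, y) \<le> Suc (sz x + sz (f x))" using sz_mem[OF y] by simp
      then show ?thesis using q[OF x y] poly_nat_mono order_trans by blast
    qed
    then have "sz (map (g x) ys) \<le> length (map (g x) ys) * Suc (poly q (Suc (sz x + sz (f x))))"
      by (intro sz_list_le) auto
    also have "\<dots> \<le> sz (f x) * Suc (poly q (Suc (sz x + sz (f x))))"
      using length_le_sz[of ys] by (intro mult_right_mono) (auto simp: eq)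
    finally show "sz (fold (\<lambda>y a. g x y # a) ys []) \<le> \<dots>" by (simp add: fold)
  qed (use f in \<open>auto intro!: polybd_intros ptime_sz ptime_const\<close>)
  from ptime_rev[OF this] show ?thesis by (simp add: fold)
qed

lemma ptime_concat: "ptime D f \<Longrightarrow> ptime D (\<lambda>x. concat (f x))"
proof -
  assume f: "ptime D f"
  have fold: "fold (\<lambda>y a. rev y @ a) yss [] = rev (concat yss)" for yss :: "'b list list"
    by (induction yss rule: rev_induct) auto
  have le: "sz (concat yss) \<le> sz yss" for yss :: "'b list list"
    by (induction yss) auto
  have "ptime D (\<lambda>x. fold (\<lambda>y a. rev y @ a) (f x) [])"
  proof (rule ptime_fold[where E = UNIV and B = "\<lambda>x. sz (f x)"])
    show "ptime UNIV (\<lambda>(y, a, x). rev y @ a)"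
      unfolding split_def by (intro ptime_append ptime_rev ptime_fst ptime_snd ptime_id)
    show "sz (fold (\<lambda>y a. rev y @ a) ys []) \<le> sz (f x)" if "f x = ys @ zs" for x ys zs
      using le[of ys] that by (simp add: fold)
  qed (use f in \<open>auto intro!: polybd_intros ptime_sz ptime_const\<close>)
  from ptime_rev[OF this] show ?thesis by (simp add: fold)
qed

lemma ptime_filter:
  assumes f: "ptime D f" and g: "ptime {(x, y). x \<in> D \<and> y \<in> set (f x)} (\<lambda>z. g (fst z) (snd z))"
  shows "ptime D (\<lambda>x. filter (g x) (f x))"
proof -
  have "ptime D (\<lambda>x. concat (map (\<lambda>y. if g x y then [y] else []) (f x)))"
    by (intro ptime_concat ptime_map f ptime_if g ptime_Cons ptime_snd ptime_id ptime_const)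
  moreover have "concat (map (\<lambda>y. if P y then [y] else []) ys) = filter P ys" for P and ys :: "'b list"
    by (induction ys) auto
  ultimately show ?thesis by simp
qed

lemma ptime_Bex:
  assumes "ptime D f" "ptime {(x, y). x \<in> D \<and> y \<in> set (f x)} (\<lambda>z. g (fst z) (snd z))"
  shows "ptime D (\<lambda>x. \<exists>y\<in>set (f x). g x y)"
  using ptime_neq_Nil[OF ptime_filter[OF assms]]
  by (rule ptime_cong) (auto simp: filter_empty_conv)

lemma ptime_not: "ptime D f \<Longrightarrow> ptime D (\<lambda>x. \<not> f x)"
  by (drule ptime_if[OF _ ptime_const[of _ False] ptime_const[of _ True]], erule ptime_cong) simp

lemma ptime_conj: "ptime D f \<Longrightarrow> ptime {x \<in> D. f x} g \<Longrightarrow> ptime D (\<lambda>x. f x \<and> g x)"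
  by (drule (1) ptime_if[OF _ _ ptime_const[of _ False]], erule ptime_cong) simp

lemma ptime_disj: "ptime D f \<Longrightarrow> ptime {x \<in> D. \<not> f x} g \<Longrightarrow> ptime D (\<lambda>x. f x \<or> g x)"
  by (drule ptime_if[OF _ ptime_const[of _ True]], assumption, erule ptime_cong) simp

lemma ptime_imp: "ptime D f \<Longrightarrow> ptime {x \<in> D. f x} g \<Longrightarrow> ptime D (\<lambda>x. f x \<longrightarrow> g x)"
  by (drule (1) ptime_if[OF _ _ ptime_const[of _ True]], erule ptime_cong) simp

lemma ptime_Ball:
  assumes "ptime D f" "ptime {(x, y). x \<in> D \<and> y \<in> set (f x)} (\<lambda>z. g (fst z) (snd z))"
  shows "ptime D (\<lambda>x. \<forall>y\<in>set (f x). g x y)"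
  using ptime_not[OF ptime_Bex[OF assms(1) ptime_not[OF assms(2)]]] by simp

text \<open>Numbers are encoded in unary, that is, as lists of leaves.\<close>

lemma encode_replicate: "encode (replicate n False) = encode n"
  by (induction n) auto

lemma ptime_replicate: "ptime D f \<Longrightarrow> ptime D (\<lambda>x. replicate (f x) False)"
  by (erule ptime_encode_eq) (simp add: encode_replicate)

lemma ptime_pred:
  fixes f :: "'a::enc \<Rightarrow> nat"
  assumes "ptime D f"
  shows "ptime D (\<lambda>x. f x - 1)"
proof -
  have "right (encode n) = encode (n - 1)" for n :: nat by (cases n) auto
  then have "runs GoRight (encode n) (encode (n - 1)) 1" for n :: nat
    using goright[of "encode n"] by simp
  then have "ptime UNIV (\<lambda>n :: nat. n - 1)"
    by (intro ptimeI[OF _ polybd_const[of _ 1] polybd_mono[OF polybd_sz], where p = GoRight]) auto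
  from ptime_comp[OF this assms UNIV_I] show ?thesis .
qed

lemma ptime_minus:
  fixes f g :: "_ \<Rightarrow> nat"
  assumes "ptime D f" "ptime D g" shows "ptime D (\<lambda>x. f x - g x)"
proof -
  have fold: "fold (\<lambda>_ a. a - 1) ys n = n - length ys" for ys :: "bool list" and n :: nat
    by (induction ys arbitrary: n) auto
  have "ptime D (\<lambda>x. fold (\<lambda>_ a. a - 1) (replicate (g x) False) (f x))"
  proof (rule ptime_fold[where E = UNIV and B = "\<lambda>x. sz (f x)"])
    show "ptime UNIV (\<lambda>(y::bool, a::nat, x). a - 1)"
      unfolding split_def by (intro ptime_pred ptime_fst ptime_snd ptime_id)
    show "polybd D (\<lambda>x. sz (f x))" by (rule ptime_sz) fact
  qed (use assms in \<open>auto intro: ptime_replicate simp: fold simp del: One_nat_def\<close>)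
  then show ?thesis unfolding fold by simp
qed

lemma ptime_le: "ptime D f \<Longrightarrow> ptime D g \<Longrightarrow> ptime D (\<lambda>x. f x \<le> g x)" for f g :: "_ \<Rightarrow> nat"
  using ptime_not[OF ptime_neq_Nil[OF ptime_replicate[OF ptime_minus[of D f g]]]] by simp

lemma ptime_eq: "ptime D f \<Longrightarrow> ptime D g \<Longrightarrow> ptime D (\<lambda>x. f x = g x)" for f g :: "_ \<Rightarrow> nat"
  unfolding order_eq_iff by (intro ptime_conj ptime_le) (erule ptime_mono, blast)+

lemma ptime_eq2: "ptime D f \<Longrightarrow> ptime D g \<Longrightarrow> ptime D (\<lambda>x. f x = g x)" for f g :: "_ \<Rightarrow> nat \<times> nat"
  unfolding prod_eq_iff by (intro ptime_conj ptime_eq ptime_fst ptime_snd) (erule ptime_mono, blast)+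

lemma ptime_eq4: "ptime D f \<Longrightarrow> ptime D g \<Longrightarrow> ptime D (\<lambda>x. f x = g x)"
  for f g :: "_ \<Rightarrow> (nat \<times> nat) \<times> (nat \<times> nat)"
  unfolding prod_eq_iff[where 'a = "nat \<times> nat"]
  by (intro ptime_conj ptime_eq2 ptime_fst ptime_snd) (erule ptime_mono, blast)+

lemma ptime_length: "ptime D f \<Longrightarrow> ptime D (\<lambda>x. length (f x))"
proof -
  assume f: "ptime D f"
  have "ptime D (\<lambda>x. map (\<lambda>_. False) (f x))"
    by (intro ptime_map f ptime_const)
  then show ?thesis
    by (rule ptime_encode_eq) (simp add: map_replicate_const encode_replicate)
qed

definition enum :: "'a list \<Rightarrow> (nat \<times> 'a) list" where
  "enum xs = zip [0..<length xs] xs"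

text \<open>The length of the accumulator serves as the index of the next element, so no separate
  counter is carried.\<close>

lemma ptime_enum: "ptime D f \<Longrightarrow> ptime D (\<lambda>x. enum (f x))"
proof -
  assume f: "ptime D f"
  let ?g = "\<lambda>y a. ((length a, y) # a)"
  have fold: "fold ?g ys [] = rev (enum ys)" for ys :: "'b list"
    by (induction ys rule: rev_induct) (auto simp: enum_def)
  have le: "sz (enum ys) \<le> length ys * Suc (Suc (length ys + sz ys))" for ys :: "'b list"
  proof -
    have "sz z \<le> Suc (length ys + sz ys)" if "z \<in> set (enum ys)" for z
    proof -
      from that obtain i where "i < length ys" "z = (i, ys ! i)" by (auto simp: enum_def set_zip)
      then show ?thesis using sz_mem[of "ys ! i" ys] by simp
    qed
    from sz_list_le[of "enum ys", OF this] show ?thesis by (simp add: enum_def)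
  qed
  have "ptime D (\<lambda>x. fold ?g (f x) [])"
  proof (rule ptime_fold[where E = UNIV and B = "\<lambda>x. sz (f x) * Suc (Suc (sz (f x) + sz (f x)))"])
    show "ptime UNIV (\<lambda>(y, a, x). ?g y a)"
      unfolding split_def by (intro ptime_Cons ptime_pair ptime_length ptime_fst ptime_snd ptime_id)
    fix x and ys zs :: "'b list" assume eq: "f x = ys @ zs"
    have "sz (enum ys) \<le> sz (f x) * Suc (Suc (sz (f x) + sz (f x)))"
      by (rule order_trans[OF le mult_le_mono]) (use length_le_sz[of ys] in \<open>auto simp: eq\<close>)
    then show "sz (fold ?g ys []) \<le> \<dots>" by (simp add: fold)
  qed (use f in \<open>auto intro!: polybd_intros ptime_sz ptime_const\<close>)
  from ptime_rev[OF this] show ?thesis by (simp add: fold)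
qed

text \<open>The algorithm is written in terms of these operations, so that its running time is read
  off from the shape of its definitions. Iterations, which need a size bound, and calls of the
  solver for \<open>P0\<close>, which carry a promise, are treated separately.\<close>

lemmas ptime_intros = ptime_fst ptime_snd ptime_pair ptime_id ptime_const ptime_if ptime_Cons
  ptime_append ptime_map ptime_concat ptime_filter ptime_Bex ptime_Ball ptime_not ptime_conj
  ptime_disj ptime_imp ptime_le ptime_eq ptime_eq2 ptime_eq4 ptime_length ptime_enum ptime_neq_Nil

section \<open>Connectivity and cycles\<close>

definition conn :: "('v \<times> 'v) set \<Rightarrow> 'v set \<Rightarrow> 'v \<Rightarrow> 'v \<Rightarrow> bool" where
  "conn E X a b \<longleftrightarrow> a \<in> X \<and> b \<in> X \<and> (a, b) \<in> (E \<inter> X \<times> X)\<^sup>*"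

definition connected :: "('v \<times> 'v) set \<Rightarrow> 'v set \<Rightarrow> bool" where
  "connected E A \<longleftrightarrow> (\<forall>a\<in>A. \<forall>b\<in>A. conn E A a b)"

definition nbh :: "('v \<times> 'v) set \<Rightarrow> 'v set \<Rightarrow> 'v set \<Rightarrow> 'v set" where
  "nbh E V A = {y \<in> V - A. \<exists>x\<in>A. (x, y) \<in> E}"

definition linked :: "('v \<times> 'v) set \<Rightarrow> 'v list \<Rightarrow> bool" where
  "linked E xs \<longleftrightarrow> successively (\<lambda>x y. (x, y) \<in> E) xs"

lemma linked_simps [simp]:
  "linked E []" "linked E [x]" "linked E (x # y # ys) \<longleftrightarrow> (x, y) \<in> E \<and> linked E (y # ys)"
  by (simp_all add: linked_def)

lemma linked_append:
  "linked E (xs @ ys) \<longleftrightarrow>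
     linked E xs \<and> linked E ys \<and> (xs = [] \<or> ys = [] \<or> (last xs, hd ys) \<in> E)"
  by (auto simp: linked_def successively_append_iff)

lemma linked_Cons: "linked E (x # xs) \<longleftrightarrow> (xs = [] \<or> (x, hd xs) \<in> E) \<and> linked E xs"
  by (cases xs) auto

lemma linked_rev: "sym E \<Longrightarrow> linked E (rev xs) \<longleftrightarrow> linked E xs"
  unfolding linked_def successively_rev by (metis (no_types, lifting) sym_def successively_mono)

lemma conn_refl: "a \<in> X \<Longrightarrow> conn E X a a"
  by (simp add: conn_def)

lemma conn_step: "conn E X a b \<Longrightarrow> (b, c) \<in> E \<Longrightarrow> c \<in> X \<Longrightarrow> conn E X a c"
  unfolding conn_def by (auto intro: rtrancl_into_rtrancl)

lemma conn_trans: "conn E X a b \<Longrightarrow> conn E X b c \<Longrightarrow> conn E X a c"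
  unfolding conn_def by (auto intro: rtrancl_trans)

lemma conn_sym: "sym E \<Longrightarrow> conn E X a b \<Longrightarrow> conn E X b a"
proof -
  assume "sym E" "conn E X a b"
  moreover from \<open>sym E\<close> have "sym ((E \<inter> X \<times> X)\<^sup>*)"
    by (intro sym_rtrancl) (auto simp: sym_def)
  ultimately show ?thesis unfolding conn_def by (auto dest: symD)
qed

lemma conn_mem: "conn E X a b \<Longrightarrow> a \<in> X \<and> b \<in> X"
  by (simp add: conn_def)

lemma conn_mono:
  assumes "conn E X a b" "X \<subseteq> Y" "E \<inter> X \<times> X \<subseteq> F"
  shows "conn F Y a b"
proof -
  have "(E \<inter> X \<times> X)\<^sup>* \<subseteq> (F \<inter> Y \<times> Y)\<^sup>*"
    using assms(2,3) by (intro rtrancl_mono) auto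
  with assms(1,2) show ?thesis unfolding conn_def by auto
qed

lemma conn_induct [consumes 1, case_names refl step]:
  assumes "conn E X a b" "a \<in> X \<Longrightarrow> P a"
    and "\<And>y z. conn E X a y \<Longrightarrow> (y, z) \<in> E \<Longrightarrow> z \<in> X \<Longrightarrow> P y \<Longrightarrow> P z"
  shows "P b"
proof -
  have "(a, b) \<in> (E \<inter> X \<times> X)\<^sup>*" "a \<in> X" using assms(1) by (auto simp: conn_def)
  then show ?thesis
  proof (induction rule: rtrancl_induct)
    case base
    then show ?case by (rule assms(2))
  next
    case (step y z)
    then show ?case using assms(3)[of y z] by (auto simp: conn_def)
  qed
qed

text \<open>Induction along the connection; if the next vertex already lies on the path, the path is
  cut off there.\<close>

lemma conn_path:
  assumes "conn E X a b" "a \<noteq> b"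
  shows "\<exists>xs. distinct (a # xs @ [b]) \<and> set xs \<subseteq> X \<and> linked E (a # xs @ [b])"
proof -
  have "b = a \<or> (\<exists>xs. distinct (a # xs @ [b]) \<and> set xs \<subseteq> X \<and> linked E (a # xs @ [b]))"
    using assms(1)
  proof (induction rule: conn_induct)
    case (step y z)
    show ?case
    proof (cases "z = a")
      case z: False
      show ?thesis
      proof (cases "y = a")
        case True
        then show ?thesis using step z by (intro disjI2 exI[of _ "[]"]) auto
      next
        case False
        then obtain xs where xs: "distinct (a # xs @ [y])" "set xs \<subseteq> X" "linked E (a # xs @ [y])"
          using step by blast
        show ?thesis
        proof (cases "z \<in> set (xs @ [y])")
          case True
          then obtain us vs where "xs @ [y] = us @ z # vs" by (meson split_list)
          then have eq: "a # xs @ [y] = (a # us @ [z]) @ vs" by simp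
          have "linked E (a # us @ [z])" "distinct (a # us @ [z])"
            using xs(1,3) unfolding eq linked_append distinct_append by auto
          moreover have "set us \<subseteq> X"
            using arg_cong[OF \<open>xs @ [y] = us @ z # vs\<close>, of set] xs(2) conn_mem[OF step(1)] by auto
          ultimately show ?thesis by blast
        next
          case False
          then show ?thesis
            using xs step(2,3) z conn_mem[OF step(1)] linked_append[of E "a # xs @ [y]" "[z]"]
            by (intro disjI2 exI[of _ "xs @ [y]"]) auto
        qed
      qed
    qed auto
  qed auto
  with assms(2) show ?thesis by auto
qed

definition component :: "('v \<times> 'v) set \<Rightarrow> 'v set \<Rightarrow> 'v \<Rightarrow> 'v set" where
  "component E X p = {y. conn E X p y}"

lemma component_sub: "component E X p \<subseteq> X"
  by (auto simp: component_def conn_def)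

lemma component_self: "p \<in> X \<Longrightarrow> p \<in> component E X p"
  by (simp add: component_def conn_refl)

lemma component_closed: "y \<in> component E X p \<Longrightarrow> (y, z) \<in> E \<Longrightarrow> z \<in> X \<Longrightarrow> z \<in> component E X p"
  unfolding component_def by (auto intro: conn_step)

lemma connectedI: "sym E \<Longrightarrow> (\<And>y. y \<in> A \<Longrightarrow> conn E A p y) \<Longrightarrow> connected E A"
  unfolding connected_def by (metis conn_sym conn_trans)

lemma connected_component: "sym E \<Longrightarrow> connected E (component E X p)"
proof (rule connectedI[of E _ p])
  fix y assume "y \<in> component E X p"
  then have "conn E X p y" by (simp add: component_def)
  then show "conn E (component E X p) p y"
  proof (induction rule: conn_induct)
    case refl
    then show ?case by (intro conn_refl component_self)
  next
    case (step y z)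
    then show ?case using component_closed[of y E X p z] by (auto intro: conn_step simp: component_def)
  qed
qed

text \<open>Two internally disjoint paths, not both of which are the edge from \<open>s\<close> to \<open>t\<close>.\<close>

definition on_cycle :: "('v \<times> 'v) set \<Rightarrow> 'v set \<Rightarrow> 'v \<Rightarrow> 'v \<Rightarrow> bool" where
  "on_cycle E L s t \<longleftrightarrow> (\<exists>cs ds. ds \<noteq> [] \<and> distinct (s # t # cs @ ds) \<and> set (cs @ ds) \<subseteq> L \<and>
     linked E (s # cs @ [t]) \<and> linked E (s # ds @ [t]))"

section \<open>Two vertices of a 2-connected graph lie on a common cycle\<close>

lemma on_cycleI:
  "ds \<noteq> [] \<Longrightarrow> distinct (s # t # cs @ ds) \<Longrightarrow> set (cs @ ds) \<subseteq> L \<Longrightarrow>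
     linked E (s # cs @ [t]) \<Longrightarrow> linked E (s # ds @ [t]) \<Longrightarrow> on_cycle E L s t"
  unfolding on_cycle_def by blast

text \<open>Leave \<open>s\<close> by an edge other than the one to \<open>t\<close> and continue to
  \<open>t\<close> without returning to \<open>s\<close>; together with the edge from
  \<open>s\<close> to \<open>t\<close> this closes a cycle.\<close>

lemma on_cycle_edge:
  assumes "sym E" and conn: "\<And>x. x \<in> L \<Longrightarrow> connected E (L - {x})"
    and "s \<in> L" "t \<in> L" "s \<noteq> t" "z \<in> L" "z \<noteq> s" "z \<noteq> t" "(s, t) \<in> E"
  shows "on_cycle E L s t"
proof -
  \<comment> \<open>The third vertex \<open>z\<close> only serves to show that \<open>s\<close> has
    a neighbour besides \<open>t\<close>.\<close>
  have "conn E (L - {t}) s z" using conn[of t] assms by (auto simp: connected_def)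
  then obtain xs where xs: "distinct (s # xs @ [z])" "set xs \<subseteq> L - {t}" "linked E (s # xs @ [z])"
    using conn_path assms(7) by metis
  define n where "n = hd (xs @ [z])"
  have n: "(s, n) \<in> E" "n \<in> L" "n \<noteq> s" "n \<noteq> t"
    using xs assms unfolding n_def by (cases xs; auto)+
  have "conn E (L - {s}) n t" using conn[of s] n assms by (auto simp: connected_def)
  then obtain ys where "distinct (n # ys @ [t])" "set ys \<subseteq> L - {s}" "linked E (n # ys @ [t])"
    using conn_path n(4) by metis
  then show ?thesis
    using n assms by (intro on_cycleI[of "n # ys" _ _ "[]"]) auto
qed

text \<open>A cycle through \<open>s\<close> and a neighbour \<open>t'\<close> of \<open>t\<close>
  is modified. If \<open>t\<close> lies on it, the same cycle is split at \<open>t\<close> instead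
  of \<open>t'\<close>. Otherwise a path from \<open>t\<close> that avoids \<open>t'\<close> is
  followed until it first meets the cycle; one new arc leads from \<open>s\<close> through
  \<open>t'\<close> to \<open>t\<close>, the other through the meeting point.\<close>

lemma on_cycle_step:
  assumes "sym E" and conn: "\<And>x. x \<in> L \<Longrightarrow> connected E (L - {x})"
    and "s \<in> L" "t' \<in> L" "t \<in> L" "s \<noteq> t" "(t', t) \<in> E" "on_cycle E L s t'"
  shows "on_cycle E L s t"
proof -
  obtain cs ds where C: "ds \<noteq> []" "distinct (s # t' # cs @ ds)" "set (cs @ ds) \<subseteq> L"
      "linked E (s # cs @ [t'])" "linked E (s # ds @ [t'])"
    using assms(8) unfolding on_cycle_def by blast
  have rev: "linked E (rev xs) \<longleftrightarrow> linked E xs" for xs using linked_rev assms(1) .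
  have "(t, t') \<in> E" using assms(1,7) by (auto dest: symD)
  consider "t = t'" | "t \<in> set cs" | "t \<in> set ds" | "t \<notin> {s, t'} \<union> set cs \<union> set ds"
    using assms(6) by blast
  then show ?thesis
  proof cases
    case 1
    then show ?thesis using assms(8) by simp
  next
    case 2
    then obtain c1 c2 where eq: "cs = c1 @ t # c2" by (meson split_list)
    have "linked E (s # c1 @ [t])"
      using C(4) eq linked_append[of E "s # c1 @ [t]" "c2 @ [t']"] by simp
    moreover have "linked E ((s # c1) @ (t # c2 @ [t']))" using C(4) eq by simp
    then have "linked E (rev (t # c2 @ [t']))" unfolding rev linked_append by simp
    then have "linked E (s # (ds @ [t'] @ rev c2) @ [t])"
      using C(5) linked_append[of E "s # ds @ [t']" "rev c2 @ [t]"] by (auto simp: linked_Cons)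
    ultimately show ?thesis using C eq assms(3-6)
      by (intro on_cycleI[of "ds @ [t'] @ rev c2" _ _ c1]) auto
  next
    case 3
    then obtain d1 d2 where eq: "ds = d1 @ t # d2" by (meson split_list)
    have "linked E (s # d1 @ [t])"
      using C(5) eq linked_append[of E "s # d1 @ [t]" "d2 @ [t']"] by simp
    moreover have "linked E ((s # d1) @ (t # d2 @ [t']))" using C(5) eq by simp
    then have "linked E (rev (t # d2 @ [t']))" unfolding rev linked_append by simp
    then have "linked E (s # (cs @ [t'] @ rev d2) @ [t])"
      using C(4) linked_append[of E "s # cs @ [t']" "rev d2 @ [t]"] by (auto simp: linked_Cons)
    ultimately show ?thesis using C eq assms(3-6)
      by (intro on_cycleI[of "cs @ [t'] @ rev d2" _ _ d1]) auto
  next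
    case 4
    have "conn E (L - {t'}) t s" using conn[of t'] assms(3-6) C(2) 4 by (auto simp: connected_def)
    then obtain rs where R: "distinct (t # rs @ [s])" "set rs \<subseteq> L - {t'}" "linked E (t # rs @ [s])"
      using conn_path assms(6) by metis
    have "\<exists>y\<in>set (rs @ [s]). y \<in> {s} \<union> set cs \<union> set ds" by simp
    \<comment> \<open>\<open>y\<close> is the first vertex of the path on the old cycle, so
      \<open>ys\<close> is disjoint from the cycle. Such a vertex exists because the path ends in
      \<open>s\<close>.\<close>
    then obtain ys y zs where split: "rs @ [s] = ys @ y # zs" "y \<in> {s} \<union> set cs \<union> set ds"
      "\<And>z. z \<in> set ys \<Longrightarrow> z \<notin> {s} \<union> set cs \<union> set ds"
      using split_list_first_prop[of "rs @ [s]" "\<lambda>y. y \<in> {s} \<union> set cs \<union> set ds"] by blast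
    have eq: "t # rs @ [s] = (t # ys @ [y]) @ zs" using split(1) by simp
    have ys: "distinct (t # ys @ [y])" "linked E (t # ys @ [y])"
      using R(1,3) unfolding eq linked_append distinct_append by auto
    have "set ys \<subseteq> set (rs @ [s])" unfolding split(1) by auto
    then have "set ys \<subseteq> L - {t'}" using R(2) split(3) by auto
    have ret: "linked E (y # rev ys @ [t])" using ys(2) rev[of "t # ys @ [y]"] by simp
    have close: "linked E (s # (bs @ [t']) @ [t])" if "linked E (s # bs @ [t'])" for bs
      using that assms(7) linked_append[of E "s # bs @ [t']" "[t]"] by auto
    have detour: "linked E (s # (a1 @ y # rev ys) @ [t])" if "linked E (s # (a1 @ y # a2) @ [t'])" for a1 a2
    proof -
      have "linked E ((s # a1 @ [y]) @ (a2 @ [t']))" using that by simp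
      then have "linked E (s # a1 @ [y])" unfolding linked_append by blast
      then show ?thesis
        using ret linked_append[of E "s # a1 @ [y]" "rev ys @ [t]"] by (simp add: linked_Cons)
    qed
    \<comment> \<open>If \<open>y = s\<close>, the path itself is one of the arcs. Otherwise it
      replaces the piece of an arc between \<open>y\<close> and \<open>t'\<close>, and the other arc
      is prolonged by the edge from \<open>t'\<close> to \<open>t\<close>.\<close>
    consider "y = s" | "y \<in> set cs" | "y \<in> set ds" using split(2) by blast
    then show ?thesis
    proof cases
      case 1
      then show ?thesis
        using C 4 ys ret close[OF C(4)] split(3) \<open>set ys \<subseteq> L - {t'}\<close> assms(3-6)
        by (intro on_cycleI[of "cs @ [t']" _ _ "rev ys"]) auto
    next
      case 2
      then obtain c1 c2 where eq: "cs = c1 @ y # c2" by (meson split_list)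
      show ?thesis
        using C 4 ys close[OF C(5)] detour[of c1 c2] split(3) \<open>set ys \<subseteq> L - {t'}\<close> assms(3-6) eq
        by (intro on_cycleI[of "ds @ [t']" _ _ "c1 @ y # rev ys"]) auto
    next
      case 3
      then obtain d1 d2 where eq: "ds = d1 @ y # d2" by (meson split_list)
      show ?thesis
        using C 4 ys close[OF C(4)] detour[of d1 d2] split(3) \<open>set ys \<subseteq> L - {t'}\<close> assms(3-6) eq
        by (intro on_cycleI[of "cs @ [t']" _ _ "d1 @ y # rev ys"]) auto
    qed
  qed
qed

text \<open>Whitney's theorem, by induction along a connection from \<open>s\<close> to
  \<open>t\<close>: each step moves the second vertex on the cycle to a neighbour.\<close>

lemma on_cycle_2_connected:
  assumes "sym E" and conn: "\<And>x. x \<in> L \<Longrightarrow> connected E (L - {x})"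
    and "s \<in> L" "t \<in> L" "s \<noteq> t" "z \<in> L" "z \<noteq> s" "z \<noteq> t"
  shows "on_cycle E L s t"
proof -
  have third: "\<exists>z\<in>L. z \<noteq> s \<and> z \<noteq> y" if "y \<noteq> s" for y
    using assms(4-8) by (cases "y = t") auto
  have "conn E (L - {z}) s t" using conn[of z] assms by (auto simp: connected_def)
  then have "conn E L s t" by (rule conn_mono) auto
  then have "t = s \<or> on_cycle E L s t"
  proof (induction rule: conn_induct)
    case (step y t)
    show ?case
    proof (cases "t = s \<or> y = s")
      case True
      then show ?thesis
        using step assms third[of t] on_cycle_edge[OF assms(1) conn, of s t] by auto
    next
      case False
      then show ?thesis
        using step assms conn_mem[OF step(1)] on_cycle_step[OF assms(1) conn, of s y t] by auto
    qed
  qed auto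
  with assms(5) show ?thesis by auto
qed

section \<open>Minimal fragments\<close>

text \<open>\<open>u = w\<close> is allowed and covers sets with at most one neighbour; the last
  condition then holds trivially.\<close>

definition fragment :: "('v \<times> 'v) set \<Rightarrow> 'v set \<Rightarrow> 'v set \<Rightarrow> 'v \<Rightarrow> 'v \<Rightarrow> bool" where
  "fragment E V A u w \<longleftrightarrow> A \<noteq> {} \<and> A \<subseteq> V \<and> connected E A \<and> u \<in> V - A \<and> w \<in> V - A \<and>
     nbh E V A \<subseteq> {u, w} \<and> conn E (V - A) u w"

text \<open>The additional edges stand for a path outside of \<open>A\<close>.\<close>

definition torso :: "('v \<times> 'v) set \<Rightarrow> 'v set \<Rightarrow> 'v set \<Rightarrow> ('v \<times> 'v) set" where
  "torso E V A = E \<inter> (A \<union> nbh E V A) \<times> (A \<union> nbh E V A) \<union>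
     {(a, b). a \<in> nbh E V A \<and> b \<in> nbh E V A \<and> a \<noteq> b}"

locale minimal_fragment =
  fixes E :: "('v \<times> 'v) set" and V A :: "'v set" and u w :: 'v
  assumes sym: "sym E"
    and fragment: "fragment E V A u w"
    and minimal: "\<And>B u w. B \<subset> A \<Longrightarrow> \<not> fragment E V B u w"
begin

lemma fragment_facts: "A \<noteq> {}" "A \<subseteq> V" "connected E A" "nbh E V A \<subseteq> {u, w}" "conn E (V - A) u w"
  using fragment by (auto simp: fragment_def)

text \<open>With at most one neighbour, both boundary vertices can be taken to be \<open>z\<close>,
  and connectivity outside is trivial.\<close>

lemma not_subfragment:
  assumes "B \<subset> A" "B \<noteq> {}" "connected E B" "z \<in> V - B" "nbh E V B \<subseteq> {z}"
  shows False
  using minimal[OF assms(1), of z z] assms fragment_facts(2)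
  by (auto simp: fragment_def intro: conn_refl)

lemma sym_torso: "sym (torso E V A)"
  using sym by (auto simp: torso_def sym_def)

text \<open>If the deletion disconnected the torso, some component \<open>K\<close> of the remainder
  would miss the neighbours of \<open>A\<close>, as these are pairwise adjacent in the torso. The
  neighbours of \<open>K\<close> are among \<open>v\<close> and \<open>x\<close>, so by minimality
  \<open>v\<close> and \<open>x\<close> are disconnected outside of \<open>K\<close>. Then one of
  them is cut off from the neighbours of \<open>A\<close>, and adding its side to \<open>K\<close>
  gives a connected set with at most one neighbour, again contradicting minimality unless this set
  is \<open>A\<close> itself.\<close>

lemma torso_3_connected:
  assumes v: "v \<in> A" and x: "x \<in> A \<union> nbh E V A"
  shows "connected (torso E V A) (A \<union> nbh E V A - {v} - {x})"
proof (rule ccontr)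
  define N where "N = nbh E V A"
  define W where "W = A \<union> N - {v} - {x}"
  let ?T = "torso E V A"
  assume "\<not> connected ?T (A \<union> nbh E V A - {v} - {x})"
  then obtain p q where pq: "p \<in> W" "q \<in> W" "\<not> conn ?T W p q"
    unfolding connected_def W_def N_def by blast
  have NV: "N \<subseteq> V - A" by (auto simp: N_def nbh_def)
  have N_conn: "conn E (V - A) a b" if "a \<in> N" "b \<in> N" for a b
    using that fragment_facts(4,5) conn_sym[OF sym fragment_facts(5)] conn_mem[OF fragment_facts(5)]
    unfolding N_def[symmetric] by (auto intro: conn_refl)
  have A_step: "z \<in> A \<union> N" if "y \<in> A" "(y, z) \<in> E" "z \<in> V" for y z
    using that by (auto simp: N_def nbh_def)
  \<comment> \<open>Inside \<open>A\<close> the torso edges are edges of \<open>E\<close>, and an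
    edge that leaves \<open>K\<close> can only end in a deleted vertex.\<close>
  have component: "K \<subseteq> A - {v}" "p \<in> K" "connected E K" "nbh E V K \<subseteq> {v, x}"
    if "p \<in> W" "K = component ?T W p" "K \<inter> N = {}" for p K
  proof -
    show KA: "K \<subseteq> A - {v}" using that component_sub[of ?T W p] by (auto simp: W_def)
    show "p \<in> K" using that component_self by metis
    have "conn E K a b" if "conn ?T K a b" for a b
      by (rule conn_mono[OF that]) (use KA NV in \<open>auto simp: torso_def N_def\<close>)
    then show "connected E K"
      using connected_component[OF sym_torso, of W p] that(2) by (auto simp: connected_def)
    show "nbh E V K \<subseteq> {v, x}"
    proof
      fix y assume "y \<in> nbh E V K"
      then obtain z where z: "z \<in> K" "(z, y) \<in> E" "y \<in> V" "y \<notin> K" by (auto simp: nbh_def)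
      then have y: "y \<in> A \<union> N" using A_step KA by blast
      then have "(z, y) \<in> ?T" using z KA by (auto simp: torso_def N_def)
      then show "y \<in> {v, x}"
        using component_closed[of z ?T W p y] z y that(2) by (auto simp: W_def)
    qed
  qed
  have main: False if pq: "p \<in> W" "q \<in> W" "q \<notin> component ?T W p" "component ?T W p \<inter> N = {}" for p q
  proof -
    define K where "K = component ?T W p"
    have K: "K \<subseteq> A - {v}" "p \<in> K" "connected E K" "nbh E V K \<subseteq> {v, x}"
      using component[OF pq(1) K_def] pq(4) by (auto simp: K_def)
    have KV: "K \<subseteq> V" "K \<subset> A" "v \<in> V - K" "x \<in> V - K"
      using K(1) v x fragment_facts(2) NV component_sub[of ?T W p]
      by (auto simp: K_def W_def N_def)
    have nb: "v \<in> nbh E V K" "x \<in> nbh E V K"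
      using not_subfragment[OF KV(2) _ K(3) KV(3)] not_subfragment[OF KV(2) _ K(3) KV(4)] K by blast+
    \<comment> \<open>Only a failure of connectivity outside can keep \<open>K\<close> from being a
      smaller fragment.\<close>
    have not_conn: "\<not> conn E (V - K) v x"
      using minimal[OF KV(2), of v x] K KV by (auto simp: fragment_def)
    \<comment> \<open>\<open>Y\<close> is the side of \<open>z\<close> outside of \<open>K\<close>.
      As it misses the neighbours of \<open>A\<close>, it stays inside \<open>A\<close>; as it does
      not contain \<open>z'\<close>, the union of \<open>K\<close> and \<open>Y\<close> has no
      neighbour except \<open>z'\<close>.\<close>
    have absorb: "K \<union> Y \<subseteq> A \<and> z' \<notin> K \<union> Y \<and> nbh E V (K \<union> Y) \<subseteq> {z'} \<and> connected E (K \<union> Y)"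
      if Y: "Y = component E (V - K) z" "Y \<inter> N = {}" "z \<in> A" and z: "{z, z'} = {v, x}" for z z' Y
    proof -
      have zK: "z \<in> V - K" "z' \<in> V - K" "z \<in> nbh E V K" using z KV nb by (auto simp: doubleton_eq_iff)
      have "y \<in> A" if "conn E (V - K) z y" for y
        using that
      proof (induction rule: conn_induct)
        case (step y y')
        then have "conn E (V - K) z y'" by (auto intro: conn_step)
        then have "y' \<notin> N" using Y by (auto simp: component_def)
        then show ?case using step A_step by blast
      qed (rule Y(3))
      then have YA: "Y \<subseteq> A" by (auto simp: Y(1) component_def)
      have nc: "\<not> conn E (V - K) z z'"
        using not_conn conn_sym[OF sym] z by (auto simp: doubleton_eq_iff)
      then have z'Y: "z' \<notin> Y" by (simp add: Y(1) component_def)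
      have "nbh E V (K \<union> Y) \<subseteq> {z'}"
      proof
        fix y assume "y \<in> nbh E V (K \<union> Y)"
        then obtain r where r: "r \<in> K \<union> Y" "(r, y) \<in> E" "y \<in> V" "y \<notin> K" "y \<notin> Y"
          by (auto simp: nbh_def)
        have "r \<notin> Y" using component_closed[of r E "V - K" z y] r Y(1) by auto
        with r have "y \<in> nbh E V K" by (auto simp: nbh_def)
        moreover have "z \<in> Y" using zK Y(1) component_self by metis
        ultimately show "y \<in> {z'}" using K(4) r z by (auto simp: doubleton_eq_iff)
      qed
      moreover have "connected E (K \<union> Y)"
      proof (rule connectedI[OF sym, of _ p])
        obtain r where r: "r \<in> K" "(r, z) \<in> E" using zK(3) by (auto simp: nbh_def)
        have zY: "z \<in> Y" using zK Y(1) component_self by metis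
        have 1: "conn E (K \<union> Y) p r"
           by (rule conn_mono[of E K p r]) (use K(2,3) r(1) in \<open>auto simp: connected_def\<close>)
        then have 2: "conn E (K \<union> Y) p z" by (rule conn_step) (use r zY in auto)
        fix y assume "y \<in> K \<union> Y"
        then show "conn E (K \<union> Y) p y"
        proof
          assume "y \<in> K"
          with K(2,3) have "conn E K p y" by (simp add: connected_def)
          then show ?thesis by (rule conn_mono) auto
        next
          assume "y \<in> Y"
          then have "conn E Y z y"
            using connected_component[OF sym, of "V - K" z] zY Y(1) by (auto simp: connected_def)
          then have "conn E (K \<union> Y) z y" by (rule conn_mono) auto
          with 2 show ?thesis by (rule conn_trans)
        qed
      qed
      ultimately show ?thesis using YA K(1) z'Y zK by auto
    qed
    \<comment> \<open>The neighbours of \<open>A\<close> are connected to each other outside of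
      \<open>A\<close>, so if both sides met them, \<open>v\<close> and \<open>x\<close> would be
      connected outside of \<open>K\<close>.\<close>
    have disj: "component E (V - K) v \<inter> N = {} \<or> component E (V - K) x \<inter> N = {}"
    proof (rule ccontr)
      assume "\<not> ?thesis"
      then obtain a b where ab: "a \<in> N" "conn E (V - K) v a" "b \<in> N" "conn E (V - K) x b"
        by (auto simp: component_def)
      have "conn E (V - K) a b" by (rule conn_mono[OF N_conn[OF ab(1,3)]]) (use KV in auto)
      then show False using ab not_conn conn_sym[OF sym] conn_trans by metis
    qed
    then show False
    proof
      define Y where "Y = component E (V - K) v"
      assume "component E (V - K) v \<inter> N = {}"
      then have Y: "K \<union> Y \<subseteq> A" "x \<notin> K \<union> Y" "nbh E V (K \<union> Y) \<subseteq> {x}" "connected E (K \<union> Y)"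
        using absorb[OF Y_def _ v, of x] by (auto simp: Y_def)
      \<comment> \<open>The enlarged set contains \<open>v\<close>, so here it can be all of
        \<open>A\<close>. Then \<open>x\<close> is the only possible neighbour of \<open>A\<close>,
        and the component of \<open>q\<close> gives the contradiction: it lies on the side of
        \<open>v\<close> and so cannot have \<open>x\<close> as a neighbour.\<close>
      have eq: "K \<union> Y = A"
        using not_subfragment[of "K \<union> Y" x] Y K(2) KV by blast
      then have "N \<subseteq> {x}" using Y(3) by (simp add: N_def)
      define K2 where "K2 = component ?T W q"
      have "K2 \<inter> N = {}" using \<open>N \<subseteq> {x}\<close> component_sub[of ?T W q] by (auto simp: K2_def W_def)
      note K2 = component[OF pq(2) K2_def this]
      have "K2 \<inter> K = {}"
        using pq(3) conn_sym[OF sym_torso] conn_trans unfolding K2_def K_def component_def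
        by (metis (no_types, lifting) disjoint_iff mem_Collect_eq)
      then have "K2 \<subseteq> Y" using K2(1) eq by auto
      have "x \<notin> nbh E V K2"
      proof
        assume "x \<in> nbh E V K2"
        then obtain r where "r \<in> Y" "(r, x) \<in> E" using \<open>K2 \<subseteq> Y\<close> by (auto simp: nbh_def)
        then have "x \<in> Y" using component_closed[of r E "V - K" v x] KV by (auto simp: Y_def)
        with Y(2) show False by simp
      qed
      then show False
        using not_subfragment[of K2 v] K2 v fragment_facts(2) by blast
    next
      assume D: "component E (V - K) x \<inter> N = {}"
      then have "x \<in> A" using component_self[of x "V - K" E] KV x by (auto simp: N_def)
      then have "K \<union> component E (V - K) x \<subset> A" "nbh E V (K \<union> component E (V - K) x) \<subseteq> {v}"
        "connected E (K \<union> component E (V - K) x)" "v \<notin> K \<union> component E (V - K) x"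
        using absorb[OF refl D, of v] v by auto
      then show False using not_subfragment[of "K \<union> component E (V - K) x" v] K(2) KV by blast
    qed
  qed
  have "component ?T W p \<inter> N = {} \<or> component ?T W q \<inter> N = {}"
  proof (rule ccontr)
    assume "\<not> ?thesis"
    then obtain a b where ab: "a \<in> N" "conn ?T W p a" "b \<in> N" "conn ?T W q b"
      by (auto simp: component_def)
    then have "conn ?T W a b"
      using conn_mem[OF ab(2)] conn_mem[OF ab(4)]
      by (cases "a = b") (auto simp: torso_def N_def intro!: conn_refl conn_step[OF conn_refl])
    then show False using ab pq(3) conn_sym[OF sym_torso] conn_trans by metis
  qed
  then show False
    using main[of p q] main[of q p] pq conn_sym[OF sym_torso] unfolding component_def by blast
qed

text \<open>Only a torso with the three vertices \<open>v1\<close>, \<open>v2\<close>,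
  \<open>v3\<close> could fail. Then \<open>A\<close> has no neighbours and a single vertex is a
  smaller fragment: \<open>{v1}\<close> if \<open>v2\<close> and \<open>v3\<close> are adjacent,
  otherwise \<open>{v2}\<close>, which can only have the neighbour \<open>v1\<close>.\<close>

lemma torso_third:
  assumes "v1 \<in> A" "v2 \<in> A" "v3 \<in> A" "distinct [v1, v2, v3]"
  shows "\<exists>z\<in>A \<union> nbh E V A - {v2}. z \<noteq> v1 \<and> z \<noteq> v3"
proof (rule ccontr)
  assume "\<not> ?thesis"
  then have A: "A = {v1, v2, v3}" "nbh E V A = {}"
    using assms by (auto simp: nbh_def)
  have single: "connected E {y}" for y by (auto simp: connected_def intro: conn_refl)
  have nb: "nbh E V {y} \<subseteq> A - {y}" if "y \<in> A" for y
    using A(2) that by (auto simp: nbh_def)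
  show False
  proof (cases "(v2, v3) \<in> E")
    case True
    then have "conn E (V - {v1}) v2 v3"
      using assms fragment_facts(2) by (intro conn_step[OF conn_refl]) auto
    then show False
      using minimal[of "{v1}" v2 v3] single nb[of v1] assms fragment_facts(2) A(1)
      by (auto simp: fragment_def)
  next
    case False
    then have "nbh E V {v2} \<subseteq> {v1}" using nb[of v2] A by (auto simp: nbh_def)
    then show False
      using not_subfragment[of "{v2}" v1] single assms fragment_facts(2) A(1) by auto
  qed
qed

lemma torso_cycle:
  assumes "v1 \<in> A" "v2 \<in> A" "v3 \<in> A" "distinct [v1, v2, v3]"
  shows "on_cycle (torso E V A) (A \<union> nbh E V A - {v2}) v1 v3"
  using torso_third[OF assms] torso_3_connected[OF assms(2)] assms
  by (auto intro: on_cycle_2_connected[OF sym_torso])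

end

section \<open>Subdividing along routes\<close>

text \<open>The invariant behind the freshness of names: a point named after an edge is present only
  when that edge is gone. Hence the points added by a subdivision are new.\<close>

definition fresh :: "'x spoint pattern \<Rightarrow> bool" where
  "fresh S \<longleftrightarrow>
     (\<forall>x y. Mid x y \<in> pts S \<longrightarrow> x \<in> pts S \<and> y \<in> pts S \<and> (x, y) \<notin> pos S \<and> (y, x) \<notin> pos S) \<and>
     (\<forall>x y. Near x y \<in> pts S \<longrightarrow> x \<in> pts S \<and> y \<in> pts S \<and> (x, y) \<notin> neg S \<and> (y, x) \<notin> neg S)"

definition single_neg :: "'x pattern \<Rightarrow> bool" where
  "single_neg S \<longleftrightarrow> (\<forall>x y x' y'. (x, y) \<in> neg S \<longrightarrow> (x', y') \<in> neg S \<longrightarrow>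
     (x, x') \<in> same S \<longrightarrow> (y, y') \<in> same S \<longrightarrow> x = x' \<and> y = y')"

section \<open>Invariants of subdivisions\<close>

lemma patternD:
  assumes "is_pattern P"
  shows "equiv (pts P) (same P)"
    and "(x, y) \<in> pos P \<Longrightarrow> x \<in> pts P \<and> y \<in> pts P \<and> (y, x) \<in> pos P \<and> (x, y) \<notin> same P"
    and "(x, y) \<in> neg P \<Longrightarrow> x \<in> pts P \<and> y \<in> pts P \<and> (y, x) \<in> neg P \<and> (x, y) \<notin> same P"
    and "(x, y) \<in> same P \<Longrightarrow> x \<in> pts P \<and> y \<in> pts P \<and> (y, x) \<in> same P"
    and "x \<in> pts P \<Longrightarrow> (x, x) \<in> same P"
    and "(x, y) \<in> same P \<Longrightarrow> (y, z) \<in> same P \<Longrightarrow> (x, z) \<in> same P"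
  using assms unfolding is_pattern_def equiv_def refl_on_def
  by (auto dest: symD intro: transD)

lemma patternI:
  assumes "\<And>x. x \<in> pts P \<Longrightarrow> (x, x) \<in> same P"
    and "\<And>x y. (x, y) \<in> same P \<Longrightarrow> x \<in> pts P \<and> y \<in> pts P \<and> (y, x) \<in> same P"
    and "\<And>x y z. (x, y) \<in> same P \<Longrightarrow> (y, z) \<in> same P \<Longrightarrow> (x, z) \<in> same P"
    and "\<And>x y. (x, y) \<in> pos P \<Longrightarrow> x \<in> pts P \<and> y \<in> pts P \<and> (y, x) \<in> pos P \<and> (x, y) \<notin> same P"
    and "\<And>x y. (x, y) \<in> neg P \<Longrightarrow> x \<in> pts P \<and> y \<in> pts P \<and> (y, x) \<in> neg P \<and> (x, y) \<notin> same P"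
  shows "is_pattern P"
  unfolding is_pattern_def equiv_def refl_on_def
proof (intro conjI)
  show "same P \<subseteq> pts P \<times> pts P" "sym (same P)"
    by (auto intro!: symI dest: assms(2))
  show "\<forall>x\<in>pts P. (x, x) \<in> same P" "trans (same P)"
    using assms(1,3) by (blast intro: transI)+
  show "pos P \<subseteq> pts P \<times> pts P" "sym (pos P)" "pos P \<inter> same P = {}"
    by (auto intro!: symI dest: assms(4))
  show "neg P \<subseteq> pts P \<times> pts P" "sym (neg P)" "neg P \<inter> same P = {}"
    by (auto intro!: symI dest: assms(5))
qed

lemma orig_pattern_simps:
  "x \<in> pts (orig_pattern P) \<longleftrightarrow> (\<exists>a. x = Orig a \<and> a \<in> pts P)"
  "(x, y) \<in> same (orig_pattern P) \<longleftrightarrow> (\<exists>a b. x = Orig a \<and> y = Orig b \<and> (a, b) \<in> same P)"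
  "(x, y) \<in> pos (orig_pattern P) \<longleftrightarrow> (\<exists>a b. x = Orig a \<and> y = Orig b \<and> (a, b) \<in> pos P)"
  "(x, y) \<in> neg (orig_pattern P) \<longleftrightarrow> (\<exists>a b. x = Orig a \<and> y = Orig b \<and> (a, b) \<in> neg P)"
  by (auto simp: orig_pattern_def)

lemma orig_pattern_facts:
  assumes "is_pattern P"
  shows "is_pattern (orig_pattern P)" "fresh (orig_pattern P)"
    and "single_neg P \<Longrightarrow> single_neg (orig_pattern P)"
proof -
  note D = patternD[OF assms]
  show "is_pattern (orig_pattern P)"
  proof (rule patternI, goal_cases)
    case (3 x y z) then show ?case using D(6) by (auto simp: orig_pattern_simps)
  qed (auto simp: orig_pattern_simps dest: D(2-5))
  show "fresh (orig_pattern P)" by (auto simp: fresh_def orig_pattern_simps)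
  show "single_neg (orig_pattern P)" if "single_neg P"
  proof -
    have "x = x' \<and> y = y'"
      if "(x, y) \<in> neg P" "(x', y') \<in> neg P" "(x, x') \<in> same P" "(y, y') \<in> same P" for x y x' y'
      using \<open>single_neg P\<close> that unfolding single_neg_def by blast
    then show ?thesis unfolding single_neg_def orig_pattern_simps by blast
  qed
qed

lemma partD:
  assumes "is_pattern P" "U \<in> parts P" "V \<in> parts P" "U \<noteq> V"
  shows "U \<subseteq> pts P" "V \<subseteq> pts P" "U \<inter> V = {}"
    and "x \<in> U \<Longrightarrow> (x, y) \<in> same P \<longleftrightarrow> y \<in> U"
    and "x \<in> V \<Longrightarrow> (x, y) \<in> same P \<longleftrightarrow> y \<in> V"
proof -
  note D = patternD[OF assms(1)]
  obtain a b where ab: "a \<in> pts P" "U = same P `` {a}" "b \<in> pts P" "V = same P `` {b}"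
    using assms(2,3) unfolding parts_def by (auto elim!: quotientE)
  show "U \<subseteq> pts P" "V \<subseteq> pts P" using ab D(4) by auto
  show "x \<in> U \<Longrightarrow> (x, y) \<in> same P \<longleftrightarrow> y \<in> U" "x \<in> V \<Longrightarrow> (x, y) \<in> same P \<longleftrightarrow> y \<in> V"
    using ab D(4) D(6) by blast+
  show "U \<inter> V = {}" using assms(2-4) quotient_disj[OF D(1)] unfolding parts_def by blast
qed

lemma subdivide_simps:
  "pts (subdivide U V S) = pts S \<union> new_points U V S"
  "same (subdivide U V S) = same S \<union> new_points U V S \<times> new_points U V S"
  "(p, q) \<in> pos (subdivide U V S) \<longleftrightarrow>
     (p, q) \<in> pos S \<and> (p, q) \<notin> U \<times> V \<and> (p, q) \<notin> V \<times> U \<or>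
     (\<exists>x y. (x, y) \<in> pos S \<and> x \<in> U \<and> y \<in> V \<and>
        ((p, q) = (x, Mid x y) \<or> (p, q) = (Mid x y, x) \<or> (p, q) = (Mid x y, y) \<or> (p, q) = (y, Mid x y)))"
  "(p, q) \<in> neg (subdivide U V S) \<longleftrightarrow>
     (p, q) \<in> neg S \<and> (p, q) \<notin> U \<times> V \<and> (p, q) \<notin> V \<times> U \<or>
     (\<exists>x y. (x, y) \<in> neg S \<and> x \<in> U \<and> y \<in> V \<and>
        ((p, q) = (x, Near x y) \<or> (p, q) = (Near x y, x) \<or> (p, q) = (Near y x, y) \<or> (p, q) = (y, Near y x)))"
  unfolding subdivide_def Let_def by auto

text \<open>A negative edge between \<open>U\<close> and \<open>V\<close> turns into one edge at
  each of them, leading to the new part, so two parts never gain a second negative edge.\<close>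

lemma subdivide_facts:
  assumes S: "is_pattern S" "fresh S" and UV: "U \<in> parts S" "V \<in> parts S" "U \<noteq> V"
  shows "is_pattern (subdivide U V S)" "fresh (subdivide U V S)"
    and "single_neg S \<Longrightarrow> single_neg (subdivide U V S)" and "new_points U V S \<inter> pts S = {}"
proof -
  let ?N = "new_points U V S"
  note D = patternD[OF S(1)] and p = partD[OF S(1) UV]
  have sep: "(x, y) \<notin> same S" if "x \<in> U" "y \<in> V" for x y using p that by blast
  show disj: "?N \<inter> pts S = {}"
    using S(2) D unfolding fresh_def new_points_def by blast
  have N: "z \<in> ?N \<longleftrightarrow> (\<exists>x y. x \<in> U \<and> y \<in> V \<and>
      ((x, y) \<in> pos S \<and> z = Mid x y \<or> (x, y) \<in> neg S \<and> (z = Near x y \<or> z = Near y x)))" for z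
    unfolding new_points_def by blast
  have NS: "z \<in> ?N \<Longrightarrow> x \<in> pts S \<Longrightarrow> (x, z) \<notin> same S \<and> (z, x) \<notin> same S" for x z
    using disj D(4) by blast
  have NN: "(x, y) \<in> same S \<Longrightarrow> x \<notin> ?N \<and> y \<notin> ?N" for x y
    using disj D(4) by blast
  show "is_pattern (subdivide U V S)"
  proof (rule patternI, goal_cases)
    case (1 x) then show ?case by (auto simp: subdivide_simps intro: D)
  next
    case (2 x y) then show ?case by (auto simp: subdivide_simps dest: D(2-4))
  next
    case (3 x y z) then show ?case using NN D(6) by (auto simp: subdivide_simps)
  next
    case (4 x y)
    then consider "(x, y) \<in> pos S" "(x, y) \<notin> U \<times> V" "(x, y) \<notin> V \<times> U"
      | a b where "(a, b) \<in> pos S" "a \<in> U" "b \<in> V"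
        "(x, y) = (a, Mid a b) \<or> (x, y) = (Mid a b, a) \<or> (x, y) = (Mid a b, b) \<or> (x, y) = (b, Mid a b)"
      unfolding subdivide_simps by blast
    then show ?case
    proof cases
      case 1
      then show ?thesis using D(2)[OF 1(1)] disj by (auto simp: subdivide_simps)
    next
      case (2 a b)
      then have "Mid a b \<in> ?N" using N by blast
      then show ?thesis using 2 D(2)[OF 2(1)] disj NS by (auto simp: subdivide_simps)
    qed
  next
    case (5 x y)
    then consider "(x, y) \<in> neg S" "(x, y) \<notin> U \<times> V" "(x, y) \<notin> V \<times> U"
      | a b where "(a, b) \<in> neg S" "a \<in> U" "b \<in> V"
        "(x, y) = (a, Near a b) \<or> (x, y) = (Near a b, a) \<or> (x, y) = (Near b a, b) \<or> (x, y) = (b, Near b a)"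
      unfolding subdivide_simps by blast
    then show ?case
    proof cases
      case 1
      then show ?thesis using D(3)[OF 1(1)] disj by (auto simp: subdivide_simps)
    next
      case (2 a b)
      then have "Near a b \<in> ?N" "Near b a \<in> ?N" using N by blast+
      then show ?thesis using 2 D(3)[OF 2(1)] disj NS by (auto simp: subdivide_simps)
    qed
  qed
  show "fresh (subdivide U V S)"
  proof -
    have old: "x \<in> pts S \<and> y \<in> pts S \<and> (x, y) \<notin> pos S \<and> (y, x) \<notin> pos S" if "Mid x y \<in> pts S" for x y
      using S(2) that unfolding fresh_def by blast
    have old': "x \<in> pts S \<and> y \<in> pts S \<and> (x, y) \<notin> neg S \<and> (y, x) \<notin> neg S" if "Near x y \<in> pts S" for x y
      using S(2) that unfolding fresh_def by blast
    have newpos: "p \<in> ?N \<or> q \<in> ?N" if "(p, q) \<in> pos (subdivide U V S)" "(p, q) \<notin> pos S" for p q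
      using that N unfolding subdivide_simps by blast
    have newneg: "p \<in> ?N \<or> q \<in> ?N" if "(p, q) \<in> neg (subdivide U V S)" "(p, q) \<notin> neg S" for p q
      using that N unfolding subdivide_simps by blast
    have 1: "x \<in> pts S \<and> y \<in> pts S \<and> (x, y) \<notin> pos (subdivide U V S) \<and> (y, x) \<notin> pos (subdivide U V S)"
      if "Mid x y \<in> pts S \<union> ?N" for x y
    proof (cases "Mid x y \<in> pts S")
      case True
      then show ?thesis using old newpos disj by blast
    next
      case False
      then have xy: "x \<in> U" "y \<in> V" "(x, y) \<in> pos S" using that N by auto
      then have "x \<in> pts S" "y \<in> pts S" using p by auto
      moreover have "(x, y) \<notin> pos (subdivide U V S)" "(y, x) \<notin> pos (subdivide U V S)"
        using xy disj \<open>x \<in> pts S\<close> \<open>y \<in> pts S\<close> N unfolding subdivide_simps by blast+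
      ultimately show ?thesis by blast
    qed
    have 2: "x \<in> pts S \<and> y \<in> pts S \<and> (x, y) \<notin> neg (subdivide U V S) \<and> (y, x) \<notin> neg (subdivide U V S)"
      if "Near x y \<in> pts S \<union> ?N" for x y
    proof (cases "Near x y \<in> pts S")
      case True
      then show ?thesis using old' newneg disj by blast
    next
      case False
      then have xy: "x \<in> U \<and> y \<in> V \<or> y \<in> U \<and> x \<in> V" "(x, y) \<in> neg S"
        using that N D(3) by auto
      then have "x \<in> pts S" "y \<in> pts S" using p by auto
      moreover have "(x, y) \<notin> neg (subdivide U V S)" "(y, x) \<notin> neg (subdivide U V S)"
        using xy disj \<open>x \<in> pts S\<close> \<open>y \<in> pts S\<close> N unfolding subdivide_simps by blast+
      ultimately show ?thesis by blast
    qed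
    show ?thesis unfolding fresh_def subdivide_simps(1) using 1 2 by blast
  qed
  show "single_neg (subdivide U V S)" if one: "single_neg S"
  proof -
    have oneD: "x = x' \<and> y = y'" if "(x, y) \<in> neg S" "(x', y') \<in> neg S" "(x, x') \<in> same S" "(y, y') \<in> same S"
      for x y x' y' using one that unfolding single_neg_def by blast
    have uniq: "x = x' \<and> y = y'" if "(x, y) \<in> neg S" "(x', y') \<in> neg S" "x \<in> U" "x' \<in> U" "y \<in> V" "y' \<in> V"
      for x y x' y' using oneD[of x y x' y'] that p by blast
    \<comment> \<open>The new negative edges, oriented from the old point to the new one; the part
      of the old point, \<open>U\<close> or \<open>V\<close>, tells them apart.\<close>
    define R where "R = {(q, z). \<exists>x y. (x, y) \<in> neg S \<and> x \<in> U \<and> y \<in> V \<and>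
        ((q, z) = (x, Near x y) \<or> (q, z) = (y, Near y x))}"
    have RE: thesis if "(q, z) \<in> R"
      "\<And>x y. (x, y) \<in> neg S \<Longrightarrow> x \<in> U \<Longrightarrow> y \<in> V \<Longrightarrow> q = x \<Longrightarrow> z = Near x y \<Longrightarrow> thesis"
      "\<And>x y. (x, y) \<in> neg S \<Longrightarrow> x \<in> U \<Longrightarrow> y \<in> V \<Longrightarrow> q = y \<Longrightarrow> z = Near y x \<Longrightarrow> thesis" for q z thesis
      using that unfolding R_def by blast
    have R: "q \<in> pts S \<and> z \<in> ?N" if "(q, z) \<in> R" for q z
      using that by (rule RE) (use N p(1,2) in auto)
    have Runiq: "q = q' \<and> z = z'" if "(q, z) \<in> R" "(q', z') \<in> R" and s: "(q, q') \<in> same S" for q z q' z'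
      using that(1)
    proof (rule RE)
      fix x y assume 1: "(x, y) \<in> neg S" "x \<in> U" "y \<in> V" "q = x" "z = Near x y"
      from that(2) show ?thesis
      proof (rule RE)
        fix x' y' assume "(x', y') \<in> neg S" "x' \<in> U" "y' \<in> V" "q' = x'" "z' = Near x' y'"
        then show ?thesis using 1 uniq[of x y x' y'] by simp
      next
        fix x' y' assume "y' \<in> V" "q' = y'"
        then show ?thesis using 1 s sep[of x y'] by simp
      qed
    next
      fix x y assume 1: "(x, y) \<in> neg S" "x \<in> U" "y \<in> V" "q = y" "z = Near y x"
      from that(2) show ?thesis
      proof (rule RE)
        fix x' y' assume "(x', y') \<in> neg S" "x' \<in> U" "y' \<in> V" "q' = y'" "z' = Near y' x'"
        then show ?thesis using 1 uniq[of x y x' y'] by simp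
      next
        fix x' y' assume "x' \<in> U" "q' = x'"
        then show ?thesis using 1 s sep[of x' y] D(4) by blast
      qed
    qed
    have cases: "(x, y) \<in> neg S \<or> (x, y) \<in> R \<or> (y, x) \<in> R" if "(x, y) \<in> neg (subdivide U V S)" for x y
      using that unfolding subdivide_simps R_def by blast
    show ?thesis
      unfolding single_neg_def
    proof (intro allI impI)
      fix x y x' y'
      assume *: "(x, y) \<in> neg (subdivide U V S)" "(x', y') \<in> neg (subdivide U V S)"
        "(x, x') \<in> same (subdivide U V S)" "(y, y') \<in> same (subdivide U V S)"
      from *(3,4) have s: "(x, x') \<in> same S \<or> x \<in> ?N \<and> x' \<in> ?N" "(y, y') \<in> same S \<or> y \<in> ?N \<and> y' \<in> ?N"
        unfolding subdivide_simps by auto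
      have negN: "a \<notin> ?N \<and> b \<notin> ?N" if "(a, b) \<in> neg S" for a b using D(3)[OF that] disj by blast
      have RN: "a \<notin> ?N \<and> b \<in> ?N" if "(a, b) \<in> R" for a b using R[OF that] disj by blast
      have mem: "x \<in> ?N \<longleftrightarrow> x' \<in> ?N" "y \<in> ?N \<longleftrightarrow> y' \<in> ?N" using s NN by blast+
      consider "(x, y) \<in> neg S" "(x', y') \<in> neg S" | "(x, y) \<in> R" "(x', y') \<in> R"
        | "(y, x) \<in> R" "(y', x') \<in> R"
        using cases[OF *(1)] cases[OF *(2)] negN RN mem by meson
      then show "x = x' \<and> y = y'"
      proof cases
        case 1
        then show ?thesis using s negN oneD by meson
      next
        case 2
        then show ?thesis using s RN Runiq by meson
      next
        case 3
        then show ?thesis using s RN Runiq by meson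
      qed
    qed
  qed
qed

lemma subdivision_facts:
  assumes "subdivision P S" "is_pattern P"
  shows "is_pattern S \<and> fresh S \<and> (single_neg P \<longrightarrow> single_neg S)"
  using assms
  by (induction) (auto simp: orig_pattern_facts subdivide_facts)

text \<open>The parts are the fibres of \<open>fst\<close>, while the edge sets are arbitrary. This
  admits intermediate targets in which edges stand for routes and points of different parts may be
  joined by no edge at all, unlike in the pattern of an instance.\<close>

definition tgt :: "('v \<times> 'a) set \<Rightarrow> (('v \<times> 'a) \<times> ('v \<times> 'a)) set \<Rightarrow> (('v \<times> 'a) \<times> ('v \<times> 'a)) set \<Rightarrow>
    ('v \<times> 'a) pattern" where
  "tgt X Ps Ng = \<lparr>pts = X, same = {(x, y). x \<in> X \<and> y \<in> X \<and> fst x = fst y}, pos = Ps, neg = Ng\<rparr>"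

lemma occurs_SP_tgtI:
  assumes "\<And>x. x \<in> pts S \<Longrightarrow> h x \<in> X"
    and "\<And>x y. (x, y) \<in> same S \<Longrightarrow> h x \<in> X \<and> h y \<in> X \<and> fst (h x) = fst (h y)"
    and "\<And>x y. x \<in> pts S \<Longrightarrow> y \<in> pts S \<Longrightarrow> (x, y) \<notin> same S \<Longrightarrow> fst (h x) \<noteq> fst (h y)"
    and "\<And>x y. (x, y) \<in> pos S \<Longrightarrow> (h x, h y) \<in> Ps" "\<And>x y. (x, y) \<in> neg S \<Longrightarrow> (h x, h y) \<in> Ng"
  shows "occurs_SP S (tgt X Ps Ng)"
  unfolding occurs_SP_def pattern_hom_def preserves_parts_def tgt_def
  by (rule exI[of _ h]) (auto dest: assms)

lemma occurs_SP_tgtE: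
  assumes "occurs_SP S (tgt X Ps Ng)"
  obtains h where "\<And>x. x \<in> pts S \<Longrightarrow> h x \<in> X"
    and "\<And>x y. x \<in> pts S \<Longrightarrow> y \<in> pts S \<Longrightarrow> fst (h x) = fst (h y) \<Longrightarrow> (x, y) \<in> same S"
    and "\<And>x y. (x, y) \<in> same S \<Longrightarrow> fst (h x) = fst (h y)"
    and "\<And>x y. (x, y) \<in> pos S \<Longrightarrow> (h x, h y) \<in> Ps" "\<And>x y. (x, y) \<in> neg S \<Longrightarrow> (h x, h y) \<in> Ng"
proof -
  obtain h where h: "pattern_hom h S (tgt X Ps Ng)" "preserves_parts h S (tgt X Ps Ng)"
    using assms by (auto simp: occurs_SP_def)
  show thesis
  proof (rule that[of h])
    show X: "h x \<in> X" if "x \<in> pts S" for x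
      using h(1) that by (auto simp: pattern_hom_def tgt_def)
    show "(x, y) \<in> same S" if "x \<in> pts S" "y \<in> pts S" "fst (h x) = fst (h y)" for x y
      using h(2) X that by (auto simp: preserves_parts_def tgt_def)
    show "fst (h x) = fst (h y)" if "(x, y) \<in> same S" for x y
      using h(1) that by (auto simp: pattern_hom_def tgt_def)
    show "(h x, h y) \<in> Ps" if "(x, y) \<in> pos S" for x y
      using h(1) that by (auto simp: pattern_hom_def tgt_def)
    show "(h x, h y) \<in> Ng" if "(x, y) \<in> neg S" for x y
      using h(1) that by (auto simp: pattern_hom_def tgt_def)
  qed
qed

text \<open>Edges between \<open>u\<close> and \<open>w\<close> stand for detours via the new
  variable \<open>c\<close>. If the occurrence uses both \<open>u\<close> and \<open>w\<close>, one
  more subdivision, at the two parts lying over them, absorbs the detour; otherwise no such edge is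
  used.\<close>

lemma occurs_TM_step:
  assumes P: "is_pattern P" and occ: "occurs_TM P (tgt X' Ps' Ng')"
    and sym: "sym Ps" "sym Ng" "sym Ps'" "sym Ng'"
    and uwc: "u \<noteq> w" and X': "X' \<subseteq> X" "\<And>x. x \<in> X' \<Longrightarrow> fst x \<noteq> c"
    and keep: "\<And>a b. (a, b) \<in> Ps' \<Longrightarrow> {fst a, fst b} \<noteq> {u, w} \<Longrightarrow> (a, b) \<in> Ps"
      "\<And>a b. (a, b) \<in> Ng' \<Longrightarrow> {fst a, fst b} \<noteq> {u, w} \<Longrightarrow> (a, b) \<in> Ng"
    and pos: "\<And>a b. (a, b) \<in> Ps' \<Longrightarrow> fst a = u \<Longrightarrow> fst b = w \<Longrightarrow>
      \<exists>e\<in>X. fst e = c \<and> (a, e) \<in> Ps \<and> (e, b) \<in> Ps"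
    and neg: "\<And>a b. (a, b) \<in> Ng' \<Longrightarrow> fst a = u \<Longrightarrow> fst b = w \<Longrightarrow>
      \<exists>f\<in>X. \<exists>f'\<in>X. fst f = c \<and> fst f' = c \<and> (a, f) \<in> Ng \<and> (f', b) \<in> Ng"
  shows "occurs_TM P (tgt X Ps Ng)"
proof -
  obtain S where S: "subdivision P S" and "occurs_SP S (tgt X' Ps' Ng')"
    using occ by (auto simp: occurs_TM_def)
  then obtain h where h: "\<And>x. x \<in> pts S \<Longrightarrow> h x \<in> X'"
    "\<And>x y. x \<in> pts S \<Longrightarrow> y \<in> pts S \<Longrightarrow> fst (h x) = fst (h y) \<Longrightarrow> (x, y) \<in> same S"
    "\<And>x y. (x, y) \<in> same S \<Longrightarrow> fst (h x) = fst (h y)"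
    "\<And>x y. (x, y) \<in> pos S \<Longrightarrow> (h x, h y) \<in> Ps'" "\<And>x y. (x, y) \<in> neg S \<Longrightarrow> (h x, h y) \<in> Ng'"
    by (elim occurs_SP_tgtE) (rule that; assumption)
  have pat: "is_pattern S" "fresh S" using subdivision_facts[OF S P] by auto
  note D = patternD[OF pat(1)]
  define U where "U = {x \<in> pts S. fst (h x) = u}"
  define V where "V = {x \<in> pts S. fst (h x) = w}"
  show ?thesis
  proof (cases "U = {} \<or> V = {}")
    case True
    have ne: "{fst (h x), fst (h y)} \<noteq> {u, w}" if "x \<in> pts S" "y \<in> pts S" for x y
      using that True uwc unfolding U_def V_def doubleton_eq_iff by auto
    have "occurs_SP S (tgt X Ps Ng)"
    proof (rule occurs_SP_tgtI[of S h])
      show "h x \<in> X" if "x \<in> pts S" for x using h(1)[OF that] X'(1) by blast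
      then show "h x \<in> X \<and> h y \<in> X \<and> fst (h x) = fst (h y)" if "(x, y) \<in> same S" for x y
        using h(3)[OF that] D(4)[OF that] by blast
      show "fst (h x) \<noteq> fst (h y)" if "x \<in> pts S" "y \<in> pts S" "(x, y) \<notin> same S" for x y
        using h(2) that by blast
      show "(h x, h y) \<in> Ps" if "(x, y) \<in> pos S" for x y
        using keep(1)[OF h(4)[OF that]] ne D(2)[OF that] by blast
      show "(h x, h y) \<in> Ng" if "(x, y) \<in> neg S" for x y
        using keep(2)[OF h(5)[OF that]] ne D(3)[OF that] by blast
    qed
    then show ?thesis using S by (auto simp: occurs_TM_def)
  next
    case False
    then obtain a b where ab: "a \<in> U" "b \<in> V" by auto
    have part: "{x \<in> pts S. fst (h x) = fst (h a)} \<in> parts S" if "a \<in> pts S" for a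
    proof -
      have "x \<in> pts S \<and> fst (h x) = fst (h a) \<longleftrightarrow> (a, x) \<in> same S" for x
        using h(2)[of a x] h(3)[of a x] D(4)[of a x] that by metis
      then have "{x \<in> pts S. fst (h x) = fst (h a)} = same S `` {a}" by auto
      then show ?thesis using that unfolding parts_def by (simp add: quotientI)
    qed
    have parts: "U \<in> parts S" "V \<in> parts S"
      using part[of a] part[of b] ab by (simp_all add: U_def V_def)
    have UV: "U \<noteq> V" using ab uwc by (auto simp: U_def V_def)
    note S' = step[OF S parts UV]
    note F = subdivide_facts[OF pat parts UV]
    let ?N = "new_points U V S"
    \<comment> \<open>The middle point depends only on the images of the two ends. The choice need
      not be injective, since all new points form a single part over \<open>c\<close>.\<close>
    define e where "e p = (SOME e. e \<in> X \<and> fst e = c \<and> (fst p, e) \<in> Ps \<and> (e, snd p) \<in> Ps)" for p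
    have e: "e (a, b) \<in> X \<and> fst (e (a, b)) = c \<and> (a, e (a, b)) \<in> Ps \<and> (e (a, b), b) \<in> Ps"
      if ab: "(a, b) \<in> Ps'" "fst a = u" "fst b = w" for a b
    proof -
      obtain r where "r \<in> X \<and> fst r = c \<and> (fst (a, b), r) \<in> Ps \<and> (r, snd (a, b)) \<in> Ps"
        using pos[OF ab] by auto
      from someI[of "\<lambda>r. r \<in> X \<and> fst r = c \<and> (fst (a, b), r) \<in> Ps \<and> (r, snd (a, b)) \<in> Ps", OF this]
      show ?thesis unfolding e_def by simp
    qed
    define f where "f p = (SOME f. fst f \<in> X \<and> snd f \<in> X \<and> fst (fst f) = c \<and> fst (snd f) = c \<and>
      (fst p, fst f) \<in> Ng \<and> (snd f, snd p) \<in> Ng)" for p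
    have f: "fst (f (a, b)) \<in> X \<and> snd (f (a, b)) \<in> X \<and> fst (fst (f (a, b))) = c \<and>
        fst (snd (f (a, b))) = c \<and> (a, fst (f (a, b))) \<in> Ng \<and> (snd (f (a, b)), b) \<in> Ng"
      if ab: "(a, b) \<in> Ng'" "fst a = u" "fst b = w" for a b
    proof -
      obtain r r' where "r \<in> X" "r' \<in> X" "fst r = c" "fst r' = c" "(a, r) \<in> Ng" "(r', b) \<in> Ng"
        using neg[OF ab] by auto
      then have "fst (r, r') \<in> X \<and> snd (r, r') \<in> X \<and> fst (fst (r, r')) = c \<and> fst (snd (r, r')) = c \<and>
        (fst (a, b), fst (r, r')) \<in> Ng \<and> (snd (r, r'), snd (a, b)) \<in> Ng" by simp
      from someI[of "\<lambda>f. fst f \<in> X \<and> snd f \<in> X \<and> fst (fst f) = c \<and> fst (snd f) = c \<and>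
        (fst (a, b), fst f) \<in> Ng \<and> (snd f, snd (a, b)) \<in> Ng", OF this]
      show ?thesis unfolding f_def by simp
    qed
    \<comment> \<open>\<open>Near x y\<close> belongs to the end over \<open>u\<close> or to the end
      over \<open>w\<close> according to whether \<open>x\<close> lies in \<open>U\<close>, and
      \<open>f\<close> expects the point over \<open>u\<close> first. No new point has the form
      \<open>Orig\<close>, so that branch is arbitrary.\<close>
    define g where "g z = (if z \<in> pts S then h z else
      (case z of Orig _ \<Rightarrow> undefined | Mid x y \<Rightarrow> e (h x, h y)
       | Near x y \<Rightarrow> if x \<in> U then fst (f (h x, h y)) else snd (f (h y, h x))))" for z
    have g_old: "g z = h z" if "z \<in> pts S" for z using that by (simp add: g_def)
    have new: "Mid x y \<notin> pts S" if "(x, y) \<in> pos S" for x y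
      using pat(2) that unfolding fresh_def by blast
    have new': "Near x y \<notin> pts S \<and> Near y x \<notin> pts S" if "(x, y) \<in> neg S" for x y
      using pat(2) that unfolding fresh_def by blast
    have Mid: "g (Mid x y) \<in> X" "fst (g (Mid x y)) = c" "(h x, g (Mid x y)) \<in> Ps" "(g (Mid x y), h x) \<in> Ps"
      "(g (Mid x y), h y) \<in> Ps" "(h y, g (Mid x y)) \<in> Ps"
      if "(x, y) \<in> pos S" "x \<in> U" "y \<in> V" for x y
    proof -
      have *: "g (Mid x y) = e (h x, h y)" using new[OF that(1)] by (simp add: g_def)
      have "fst (h x) = u" "fst (h y) = w" using that by (auto simp: U_def V_def)
      from e[OF h(4)[OF that(1)] this] symD[OF sym(1)]
      show "g (Mid x y) \<in> X" "fst (g (Mid x y)) = c" "(h x, g (Mid x y)) \<in> Ps" "(g (Mid x y), h x) \<in> Ps"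
        "(g (Mid x y), h y) \<in> Ps" "(h y, g (Mid x y)) \<in> Ps"
        unfolding * by blast+
    qed
    have Near: "g (Near x y) \<in> X" "fst (g (Near x y)) = c" "(h x, g (Near x y)) \<in> Ng" "(g (Near x y), h x) \<in> Ng"
      "g (Near y x) \<in> X" "fst (g (Near y x)) = c" "(g (Near y x), h y) \<in> Ng" "(h y, g (Near y x)) \<in> Ng"
      if "(x, y) \<in> neg S" "x \<in> U" "y \<in> V" for x y
    proof -
      have "y \<notin> U" using that uwc by (auto simp: U_def V_def)
      then have *: "g (Near x y) = fst (f (h x, h y))" "g (Near y x) = snd (f (h x, h y))"
        using new'[OF that(1)] that(2) by (simp_all add: g_def)
      have "fst (h x) = u" "fst (h y) = w" using that by (auto simp: U_def V_def)
      from f[OF h(5)[OF that(1)] this] symD[OF sym(2)]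
      show "g (Near x y) \<in> X" "fst (g (Near x y)) = c" "(h x, g (Near x y)) \<in> Ng" "(g (Near x y), h x) \<in> Ng"
        "g (Near y x) \<in> X" "fst (g (Near y x)) = c" "(g (Near y x), h y) \<in> Ng" "(h y, g (Near y x)) \<in> Ng"
        unfolding * by blast+
    qed
    have gN: "g z \<in> X \<and> fst (g z) = c" if "z \<in> ?N" for z
      using that Mid Near unfolding new_points_def by auto
    have old_pair: "{fst (h x), fst (h y)} \<noteq> {u, w}"
      if "(x, y) \<notin> U \<times> V" "(x, y) \<notin> V \<times> U" "x \<in> pts S" "y \<in> pts S" for x y
      using that unfolding U_def V_def doubleton_eq_iff by auto
    have "occurs_SP (subdivide U V S) (tgt X Ps Ng)"
    proof (rule occurs_SP_tgtI[of _ g], goal_cases)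
      case (1 x)
      then show ?case using gN g_old h(1) X'(1) by (auto simp: subdivide_simps)
    next
      case (2 x y)
      then have "(x, y) \<in> same S \<or> x \<in> ?N \<and> y \<in> ?N" by (auto simp: subdivide_simps)
      then show ?case
      proof
        assume s: "(x, y) \<in> same S"
        then show ?thesis using D(4)[OF s] h(1,3) g_old X'(1) by auto
      next
        assume "x \<in> ?N \<and> y \<in> ?N"
        then show ?thesis using gN by metis
      qed
    next
      case (3 x y)
      then have xy: "x \<in> pts S \<or> x \<in> ?N" "y \<in> pts S \<or> y \<in> ?N" "(x, y) \<notin> same S" "x \<notin> ?N \<or> y \<notin> ?N"
        by (auto simp: subdivide_simps)
      then consider "x \<in> pts S" "y \<in> pts S" | "x \<in> pts S" "y \<in> ?N" | "x \<in> ?N" "y \<in> pts S" by blast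
      then show ?case
      proof cases
        case 1
        then show ?thesis using g_old h(2) xy(3) by metis
      next
        case 2
        then show ?thesis using g_old gN[of y] h(1) X'(2) by metis
      next
        case 3
        then show ?thesis using g_old gN[of x] h(1) X'(2) by metis
      qed
    next
      case (4 x y)
      then show ?case unfolding subdivide_simps
      proof (elim disjE exE conjE)
        assume *: "(x, y) \<in> pos S" "(x, y) \<notin> U \<times> V" "(x, y) \<notin> V \<times> U"
        then show ?thesis using D(2)[OF *(1)] keep(1)[OF h(4) old_pair] g_old by auto
      next
        fix p q assume *: "(p, q) \<in> pos S" "p \<in> U" "q \<in> V" "(x, y) = (p, Mid p q)"
        then show ?thesis using Mid[OF *(1-3)] g_old by (auto simp: U_def)
      next
        fix p q assume *: "(p, q) \<in> pos S" "p \<in> U" "q \<in> V" "(x, y) = (Mid p q, p)"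
        then show ?thesis using Mid[OF *(1-3)] g_old by (auto simp: U_def)
      next
        fix p q assume *: "(p, q) \<in> pos S" "p \<in> U" "q \<in> V" "(x, y) = (Mid p q, q)"
        then show ?thesis using Mid[OF *(1-3)] g_old by (auto simp: V_def)
      next
        fix p q assume *: "(p, q) \<in> pos S" "p \<in> U" "q \<in> V" "(x, y) = (q, Mid p q)"
        then show ?thesis using Mid[OF *(1-3)] g_old by (auto simp: V_def)
      qed
    next
      case (5 x y)
      then show ?case unfolding subdivide_simps
      proof (elim disjE exE conjE)
        assume *: "(x, y) \<in> neg S" "(x, y) \<notin> U \<times> V" "(x, y) \<notin> V \<times> U"
        then show ?thesis using D(3)[OF *(1)] keep(2)[OF h(5) old_pair] g_old by auto
      next
        fix p q assume *: "(p, q) \<in> neg S" "p \<in> U" "q \<in> V" "(x, y) = (p, Near p q)"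
        then show ?thesis using Near[OF *(1-3)] g_old by (auto simp: U_def)
      next
        fix p q assume *: "(p, q) \<in> neg S" "p \<in> U" "q \<in> V" "(x, y) = (Near p q, p)"
        then show ?thesis using Near[OF *(1-3)] g_old by (auto simp: U_def)
      next
        fix p q assume *: "(p, q) \<in> neg S" "p \<in> U" "q \<in> V" "(x, y) = (Near q p, q)"
        then show ?thesis using Near[OF *(1-3)] g_old by (auto simp: V_def)
      next
        fix p q assume *: "(p, q) \<in> neg S" "p \<in> U" "q \<in> V" "(x, y) = (q, Near q p)"
        then show ?thesis using Near[OF *(1-3)] g_old by (auto simp: V_def)
      qed
    qed
    then show ?thesis using S' by (auto simp: occurs_TM_def)
  qed
qed

text \<open>A negative route may enter and leave a variable by different points, like the points $z'$ and
  $z''$ of a subdivision.\<close>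

primrec posroute :: "('v \<times> 'a) set \<Rightarrow> (('v \<times> 'a) \<times> ('v \<times> 'a)) set \<Rightarrow> 'v list \<Rightarrow> 'v \<times> 'a \<Rightarrow> 'v \<times> 'a \<Rightarrow> bool" where
  "posroute X Ps [] a b \<longleftrightarrow> (a, b) \<in> Ps"
| "posroute X Ps (c # cs) a b \<longleftrightarrow> (\<exists>e\<in>X. fst e = c \<and> (a, e) \<in> Ps \<and> posroute X Ps cs e b)"

primrec negroute :: "('v \<times> 'a) set \<Rightarrow> (('v \<times> 'a) \<times> ('v \<times> 'a)) set \<Rightarrow> 'v list \<Rightarrow> 'v \<times> 'a \<Rightarrow> 'v \<times> 'a \<Rightarrow> bool" where
  "negroute X Ng [] a b \<longleftrightarrow> (a, b) \<in> Ng"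
| "negroute X Ng (c # cs) a b \<longleftrightarrow>
     (\<exists>f\<in>X. \<exists>f'\<in>X. fst f = c \<and> fst f' = c \<and> (a, f) \<in> Ng \<and> negroute X Ng cs f' b)"

lemma occurs_SP_mono:
  assumes "occurs_SP S (tgt X' Ps' Ng')" "X' \<subseteq> X" "Ps' \<subseteq> Ps" "Ng' \<subseteq> Ng"
  shows "occurs_SP S (tgt X Ps Ng)"
proof -
  from assms(1) obtain h where h: "pattern_hom h S (tgt X' Ps' Ng')" "preserves_parts h S (tgt X' Ps' Ng')"
    by (auto simp: occurs_SP_def)
  have X: "h x \<in> X'" if "x \<in> pts S" for x
    using h(1) that by (auto simp: pattern_hom_def tgt_def)
  have "pattern_hom h S (tgt X Ps Ng)"
    using h(1) assms(2-4) unfolding pattern_hom_def tgt_def by auto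
  moreover have "preserves_parts h S (tgt X Ps Ng)"
    using h(2) X unfolding preserves_parts_def tgt_def by auto
  ultimately show ?thesis by (auto simp: occurs_SP_def)
qed

lemma occurs_TM_mono:
  "occurs_TM P (tgt X' Ps' Ng') \<Longrightarrow> X' \<subseteq> X \<Longrightarrow> Ps' \<subseteq> Ps \<Longrightarrow> Ng' \<subseteq> Ng \<Longrightarrow>
     occurs_TM P (tgt X Ps Ng)"
  unfolding occurs_TM_def by (meson occurs_SP_mono)

text \<open>Induction on the route: a single detour via its first variable \<open>c\<close> leaves
  edges from \<open>c\<close> to \<open>w\<close> that stand for the rest of the route.\<close>

lemma occurs_TM_route:
  assumes P: "is_pattern P" and occ: "occurs_TM P (tgt X' Ps' Ng')"
    and sub: "Ps' \<subseteq> X' \<times> X'" "Ng' \<subseteq> X' \<times> X'" "Ps \<subseteq> X \<times> X" "Ng \<subseteq> X \<times> X"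
    and sym: "sym Ps" "sym Ng" "sym Ps'" "sym Ng'"
    and uw: "u \<noteq> w" "distinct cs" "u \<notin> set cs" "w \<notin> set cs"
    and X': "X' \<subseteq> X" "\<And>x. x \<in> X' \<Longrightarrow> fst x \<notin> set cs"
    and keep: "\<And>a b. (a, b) \<in> Ps' \<Longrightarrow> {fst a, fst b} \<noteq> {u, w} \<Longrightarrow> (a, b) \<in> Ps"
      "\<And>a b. (a, b) \<in> Ng' \<Longrightarrow> {fst a, fst b} \<noteq> {u, w} \<Longrightarrow> (a, b) \<in> Ng"
    and route: "\<And>a b. (a, b) \<in> Ps' \<Longrightarrow> fst a = u \<Longrightarrow> fst b = w \<Longrightarrow> posroute X Ps cs a b"
      "\<And>a b. (a, b) \<in> Ng' \<Longrightarrow> fst a = u \<Longrightarrow> fst b = w \<Longrightarrow> negroute X Ng cs a b"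
  shows "occurs_TM P (tgt X Ps Ng)"
  using occ sym(3,4) uw X' keep route sub(1,2)
proof (induction cs arbitrary: u X' Ps' Ng')
  case Nil
  have "(a, b) \<in> Ps" if "(a, b) \<in> Ps'" for a b
    using Nil.prems(10)[OF that] Nil.prems(12)[OF that] Nil.prems(12)[OF symD[OF Nil.prems(2) that]] sym(1)
    by (auto simp: doubleton_eq_iff dest: symD)
  moreover have "(a, b) \<in> Ng" if "(a, b) \<in> Ng'" for a b
    using Nil.prems(11)[OF that] Nil.prems(13)[OF that] Nil.prems(13)[OF symD[OF Nil.prems(3) that]] sym(2)
    by (auto simp: doubleton_eq_iff dest: symD)
  ultimately have "Ps' \<subseteq> Ps" "Ng' \<subseteq> Ng" by auto
  then show ?case using occurs_TM_mono Nil.prems(1,8) by blast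
next
  case (Cons c cs)
  define X2 where "X2 = X' \<union> {x \<in> X. fst x = c}"
  \<comment> \<open>Intermediate target: the old edges \<open>R'\<close> except those between
    \<open>u\<close> and \<open>w\<close>, real edges \<open>R\<close> between \<open>u\<close> and
    \<open>c\<close>, and virtual edges between \<open>c\<close> and \<open>w\<close> wherever the
    rest of the route, described by \<open>Q\<close>, exists.\<close>
  define glue where "glue R' R Q = {(a, b) \<in> R'. {fst a, fst b} \<noteq> {u, w}}
     \<union> {(a, e). (a, e) \<in> R \<and> a \<in> X' \<and> e \<in> X \<and> fst a = u \<and> fst e = c}
     \<union> {(e, a). (a, e) \<in> R \<and> a \<in> X' \<and> e \<in> X \<and> fst a = u \<and> fst e = c}
     \<union> {(e, b). e \<in> X \<and> b \<in> X' \<and> fst e = c \<and> fst b = w \<and> Q e b}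
     \<union> {(b, e). e \<in> X \<and> b \<in> X' \<and> fst e = c \<and> fst b = w \<and> Q e b}"
    for R' R Q
  have glue_sym: "sym (glue R' R Q)" if "sym R'" for R' R Q
    using that unfolding glue_def sym_def by (auto simp: insert_commute)
  define Ps2 where "Ps2 = glue Ps' Ps (posroute X Ps cs)"
  define Ng2 where "Ng2 = glue Ng' Ng (negroute X Ng cs)"
  have c: "c \<noteq> u" "c \<noteq> w" using Cons.prems by auto
  have "occurs_TM P (tgt X2 Ps2 Ng2)"
  proof (rule occurs_TM_step[OF P Cons.prems(1), of _ _ u w _ c])
    show "sym Ps2" "sym Ng2" using glue_sym Cons.prems(2,3) by (auto simp: Ps2_def Ng2_def)
    show "\<exists>e\<in>X2. fst e = c \<and> (a, e) \<in> Ps2 \<and> (e, b) \<in> Ps2"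
      if ab: "(a, b) \<in> Ps'" "fst a = u" "fst b = w" for a b
    proof -
      obtain e where e: "e \<in> X" "fst e = c" "(a, e) \<in> Ps" "posroute X Ps cs e b"
        using Cons.prems(12)[OF ab] by auto
      moreover have "a \<in> X'" "b \<in> X'" using Cons.prems(14) ab(1) by auto
      ultimately have "e \<in> X2 \<and> (a, e) \<in> Ps2 \<and> (e, b) \<in> Ps2"
        using ab(2,3) unfolding X2_def Ps2_def glue_def by blast
      with e(2) show ?thesis by blast
    qed
    show "\<exists>f\<in>X2. \<exists>f'\<in>X2. fst f = c \<and> fst f' = c \<and> (a, f) \<in> Ng2 \<and> (f', b) \<in> Ng2"
      if ab: "(a, b) \<in> Ng'" "fst a = u" "fst b = w" for a b
    proof -
      obtain f f' where f: "f \<in> X" "fst f = c" "f' \<in> X" "fst f' = c" "(a, f) \<in> Ng" "negroute X Ng cs f' b"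
        using Cons.prems(13)[OF ab] by auto
      moreover have "a \<in> X'" "b \<in> X'" using Cons.prems(15) ab(1) by auto
      ultimately have "f \<in> X2 \<and> f' \<in> X2 \<and> (a, f) \<in> Ng2 \<and> (f', b) \<in> Ng2"
        using ab(2,3) unfolding X2_def Ng2_def glue_def by blast
      with f(2,4) show ?thesis by blast
    qed
    show "fst x \<noteq> c" if "x \<in> X'" for x using Cons.prems(9)[OF that] by auto
    show "(a, b) \<in> Ps2" if "(a, b) \<in> Ps'" "{fst a, fst b} \<noteq> {u, w}" for a b
      using that by (auto simp: Ps2_def glue_def)
    show "(a, b) \<in> Ng2" if "(a, b) \<in> Ng'" "{fst a, fst b} \<noteq> {u, w}" for a b
      using that by (auto simp: Ng2_def glue_def)
    show "X' \<subseteq> X2" by (auto simp: X2_def)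
  qed (fact Cons.prems)+
  moreover have "sym Ps2" "sym Ng2" using glue_sym Cons.prems(2,3) by (auto simp: Ps2_def Ng2_def)
  moreover have "X2 \<subseteq> X" "\<And>x. x \<in> X2 \<Longrightarrow> fst x \<notin> set cs" "c \<noteq> w" "distinct cs" "c \<notin> set cs" "w \<notin> set cs"
    using Cons.prems by (auto simp: X2_def)
  moreover have glue_keep: "(a, b) \<in> R"
    if *: "(a, b) \<in> glue R' R Q" "{fst a, fst b} \<noteq> {c, w}" "sym R"
      and "\<And>a b. (a, b) \<in> R' \<Longrightarrow> {fst a, fst b} \<noteq> {u, w} \<Longrightarrow> (a, b) \<in> R" for a b R' R Q
    using * that(4)[of a b] symD[OF *(3), of b a] unfolding glue_def by (auto simp: doubleton_eq_iff)
  then have "(a, b) \<in> Ps" if "(a, b) \<in> Ps2" "{fst a, fst b} \<noteq> {c, w}" for a b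
    using Cons.prems(10) that sym(1) unfolding Ps2_def by blast
  moreover have "(a, b) \<in> Ng" if "(a, b) \<in> Ng2" "{fst a, fst b} \<noteq> {c, w}" for a b
    using glue_keep[of a b Ng' Ng] Cons.prems(11) that sym(2) unfolding Ng2_def by blast
  moreover have glue_route: "Q a b"
    if "(a, b) \<in> glue R' R Q" "fst a = c" "fst b = w" "R' \<subseteq> X' \<times> X'" for a b R' R Q
  proof -
    have "(a, b) \<notin> R'" using that(2,4) Cons.prems(9)[of a] by auto
    then show ?thesis
      using that(1-3) c Cons.prems(4) unfolding glue_def by (auto simp: doubleton_eq_iff)
  qed
  then have "posroute X Ps cs a b" if "(a, b) \<in> Ps2" "fst a = c" "fst b = w" for a b
    using that Cons.prems(14) unfolding Ps2_def by blast
  moreover have "negroute X Ng cs a b" if "(a, b) \<in> Ng2" "fst a = c" "fst b = w" for a b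
    using that glue_route[of a b Ng' Ng] Cons.prems(15) unfolding Ng2_def by blast
  moreover have "Ps2 \<subseteq> X2 \<times> X2" "Ng2 \<subseteq> X2 \<times> X2"
    using Cons.prems(14,15) unfolding Ps2_def Ng2_def glue_def X2_def by auto
  ultimately show ?case by (intro Cons.IH[of X2 Ps2 Ng2 c])
qed

section \<open>Instances given by forbidden pairs\<close>

text \<open>Symmetrised, so that a forbidden pair may be recorded in one orientation only, as
  \<open>elim_neg\<close> does for the new ones.\<close>

definition allowed :: "('p \<times> 'p) set \<Rightarrow> 'p \<Rightarrow> 'p \<Rightarrow> bool" where
  "allowed N p q \<longleftrightarrow> (p, q) \<notin> N \<and> (q, p) \<notin> N"

lemma allowed_sym: "allowed N p q \<longleftrightarrow> allowed N q p"
  by (auto simp: allowed_def)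

text \<open>Forbidden pairs of points of the same variable are irrelevant.\<close>

definition net :: "'v set \<Rightarrow> ('v \<times> 'a) set \<Rightarrow> (('v \<times> 'a) \<times> ('v \<times> 'a)) set \<Rightarrow> ('v, 'a) csp" where
  "net V X N = \<lparr>vars = V, dmn = (\<lambda>v. {a. (v, a) \<in> X}),
     rel = (\<lambda>u v. {(a, b). (u, a) \<in> X \<and> (v, b) \<in> X \<and> allowed N (u, a) (v, b)})\<rparr>"

definition posE :: "('v \<times> 'a) set \<Rightarrow> (('v \<times> 'a) \<times> ('v \<times> 'a)) set \<Rightarrow> (('v \<times> 'a) \<times> ('v \<times> 'a)) set" where
  "posE X N = {(p, q). p \<in> X \<and> q \<in> X \<and> fst p \<noteq> fst q \<and> allowed N p q}"

definition negE :: "('v \<times> 'a) set \<Rightarrow> (('v \<times> 'a) \<times> ('v \<times> 'a)) set \<Rightarrow> (('v \<times> 'a) \<times> ('v \<times> 'a)) set" where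
  "negE X N = {(p, q). p \<in> X \<and> q \<in> X \<and> fst p \<noteq> fst q \<and> \<not> allowed N p q}"

lemma sym_posE: "sym (posE X N)" and sym_negE: "sym (negE X N)"
  by (auto simp: posE_def negE_def sym_def allowed_sym)

lemma pattern_of_net:
  "fst ` X \<subseteq> V \<Longrightarrow> pattern_of (net V X N) = tgt X (posE X N) (negE X N)"
  by (auto simp: pattern_of_def net_def tgt_def posE_def negE_def)

lemma is_instance_net:
  assumes "finite V" "finite X"
  shows "is_instance (net V X N)"
proof -
  have "{a. (v, a) \<in> X} \<subseteq> snd ` X" for v by force
  then have "finite {a. (v, a) \<in> X}" for v using assms(2) finite_subset by blast
  then show ?thesis using assms(1) by (auto simp: is_instance_def net_def allowed_sym)
qed

definition edges :: "(('v \<times> 'a) \<times> ('v \<times> 'a)) set \<Rightarrow> ('v \<times> 'v) set" where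
  "edges Ng = {(fst p, fst q) | p q. (p, q) \<in> Ng}"

lemma sym_edges: "sym Ng \<Longrightarrow> sym (edges Ng)"
  unfolding edges_def sym_def by blast

definition solves :: "('v \<times> 'a) set \<Rightarrow> (('v \<times> 'a) \<times> ('v \<times> 'a)) set \<Rightarrow> 'v set \<Rightarrow> ('v \<Rightarrow> 'a) \<Rightarrow> bool" where
  "solves X N A s \<longleftrightarrow> (\<forall>v\<in>A. (v, s v) \<in> X) \<and>
     (\<forall>u\<in>A. \<forall>v\<in>A. u \<noteq> v \<longrightarrow> allowed N (u, s u) (v, s v))"

lemma is_solution_net: "is_solution (net V X N) s \<longleftrightarrow> solves X N V s"
  by (auto simp: is_solution_def net_def solves_def)

section \<open>Replacing a fragment by a constraint between its neighbours\<close>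

definition extends :: "('v \<times> 'a) set \<Rightarrow> (('v \<times> 'a) \<times> ('v \<times> 'a)) set \<Rightarrow> 'v set \<Rightarrow> 'v \<times> 'a \<Rightarrow> 'v \<times> 'a \<Rightarrow> bool" where
  "extends X N A p q \<longleftrightarrow>
     (\<exists>s. solves X N A s \<and> (\<forall>v\<in>A. allowed N (v, s v) p \<and> allowed N (v, s v) q))"

text \<open>Values of \<open>u\<close> and \<open>w\<close> that on their own do not extend to \<open>A\<close> are removed first: afterwards both
  points of a newly forbidden pair conflict with some point of \<open>A\<close>, so that a path through \<open>A\<close> can
  replace the new negative edge.\<close>

definition elim_pts where
  "elim_pts X N A u w = {p \<in> X. fst p \<notin> A \<and> (fst p \<in> {u, w} \<longrightarrow> extends X N A p p)}"

text \<open>For \<open>u = w\<close> the added pairs consist of points of a single variable and have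
  no effect; the constraint imposed by \<open>A\<close> is then expressed by \<open>elim_pts\<close>
  alone.\<close>

definition elim_neg where
  "elim_neg X N A u w = {(p, q). p \<in> elim_pts X N A u w \<and> q \<in> elim_pts X N A u w \<and>
     (\<not> allowed N p q \<or> fst p = u \<and> fst q = w \<and> \<not> extends X N A p q)}"

lemma elim_allowed:
  assumes "p \<in> elim_pts X N A u w" "q \<in> elim_pts X N A u w"
  shows "allowed (elim_neg X N A u w) p q \<longleftrightarrow> allowed N p q \<and>
     (fst p = u \<and> fst q = w \<longrightarrow> extends X N A p q) \<and> (fst q = u \<and> fst p = w \<longrightarrow> extends X N A q p)"
proof -
  have "(x, y) \<in> elim_neg X N A u w \<longleftrightarrow> \<not> allowed N x y \<or> fst x = u \<and> fst y = w \<and> \<not> extends X N A x y"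
    if "x \<in> elim_pts X N A u w" "y \<in> elim_pts X N A u w" for x y
    using that unfolding elim_neg_def by blast
  from this[OF assms] this[OF assms(2,1)] show ?thesis
    unfolding allowed_def[of "elim_neg X N A u w"] using allowed_sym[of N] by blast
qed

text \<open>Outside of \<open>A\<close> only \<open>u\<close> and \<open>w\<close> can conflict with
  values of \<open>A\<close>, so a solution of the rest is completed by any solution on
  \<open>A\<close> that is compatible with its values at \<open>u\<close> and
  \<open>w\<close>.\<close>

lemma elim_solvable:
  assumes u: "u \<in> V - A" and w: "w \<in> V - A" and A: "A \<subseteq> V"
    and nb: "nbh (edges (negE X N)) V A \<subseteq> {u, w}"
  defines "X' \<equiv> elim_pts X N A u w" and "N' \<equiv> elim_neg X N A u w"
  shows "(\<exists>s. solves X N V s) \<longleftrightarrow> (\<exists>s. solves X' N' (V - A) s)"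
proof -
  have allowed': "allowed N' p q \<longleftrightarrow> allowed N p q \<and>
     (fst p = u \<and> fst q = w \<longrightarrow> extends X N A p q) \<and> (fst q = u \<and> fst p = w \<longrightarrow> extends X N A q p)"
    if "p \<in> X'" "q \<in> X'" for p q
    using elim_allowed[OF that[unfolded X'_def]] unfolding N'_def .
  show ?thesis
  proof
    assume "\<exists>s. solves X N V s"
    then obtain s where s: "solves X N V s" ..
    have ext: "extends X N A (x, s x) (y, s y)" if "x \<in> V - A" "y \<in> V - A" for x y
      unfolding extends_def using s A that by (intro exI[of _ s]) (auto simp: solves_def)
    have X': "(v, s v) \<in> X'" if "v \<in> V - A" for v
      using that s ext unfolding X'_def elim_pts_def solves_def by auto
    have "solves X' N' (V - A) s"
      unfolding solves_def
    proof (intro conjI ballI impI)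
      fix x y assume xy: "x \<in> V - A" "y \<in> V - A" "x \<noteq> y"
      have "allowed N (x, s x) (y, s y)" using s xy by (auto simp: solves_def)
      then show "allowed N' (x, s x) (y, s y)"
        using allowed'[OF X'[OF xy(1)] X'[OF xy(2)]] ext[OF xy(1,2)] ext[OF xy(2,1)] by auto
    qed (rule X')
    then show "\<exists>s. solves X' N' (V - A) s" by blast
  next
    assume "\<exists>s. solves X' N' (V - A) s"
    then obtain s where s: "solves X' N' (V - A) s" ..
    have sX': "(v, s v) \<in> X'" if "v \<in> V - A" for v using s that by (auto simp: solves_def)
    have rest: "allowed N (x, s x) (y, s y)" if "x \<in> V - A" "y \<in> V - A" "x \<noteq> y" for x y
      using s that allowed'[OF sX'[OF that(1)] sX'[OF that(2)]] unfolding solves_def by blast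
    have "extends X N A (u, s u) (w, s w)"
    proof (cases "u = w")
      case True
      then show ?thesis using sX'[OF u] by (auto simp: X'_def elim_pts_def)
    next
      case False
      then have "allowed N' (u, s u) (w, s w)" using s u w by (auto simp: solves_def)
      then show ?thesis
        using allowed'[OF sX'[OF u] sX'[OF w]] unfolding fst_conv by blast
    qed
    then obtain r where "solves X N A r \<and>
        (\<forall>v\<in>A. allowed N (v, r v) (u, s u) \<and> allowed N (v, r v) (w, s w))"
      unfolding extends_def ..
    then have r: "solves X N A r" "\<And>v. v \<in> A \<Longrightarrow> allowed N (v, r v) (u, s u)"
        "\<And>v. v \<in> A \<Longrightarrow> allowed N (v, r v) (w, s w)" by blast+
    define t where "t v = (if v \<in> A then r v else s v)" for v
    have tX: "(v, t v) \<in> X" if "v \<in> V" for v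
      using that r(1) sX' by (auto simp: t_def solves_def X'_def elim_pts_def)
    have cross: "allowed N (x, t x) (y, t y)" if "x \<in> A" "y \<in> V - A" for x y
    proof (cases "y \<in> {u, w}")
      case True
      then show ?thesis using r(2,3)[OF that(1)] that by (auto simp: t_def)
    next
      case False
      show ?thesis
      proof (rule ccontr)
        assume "\<not> ?thesis"
        then have "((x, t x), (y, t y)) \<in> negE X N" using tX that A by (auto simp: negE_def)
        then have "(x, y) \<in> edges (negE X N)" unfolding edges_def by force
        then have "y \<in> nbh (edges (negE X N)) V A" using that by (auto simp: nbh_def)
        with nb False show False by blast
      qed
    qed
    have "allowed N (x, t x) (y, t y)" if "x \<in> V" "y \<in> V" "x \<noteq> y" for x y
    proof (cases "x \<in> A")
      case x: True
      show ?thesis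
      proof (cases "y \<in> A")
        case True
        then show ?thesis using x r(1) that by (auto simp: t_def solves_def)
      qed (use cross x that in auto)
    next
      case x: False
      show ?thesis
      proof (cases "y \<in> A")
        case True
        then show ?thesis using cross[of y x] x that by (auto simp: allowed_sym)
      qed (use rest x that in \<open>auto simp: t_def\<close>)
    qed
    then have "solves X N V t" using tX by (auto simp: solves_def)
    then show "\<exists>s. solves X N V s" by blast
  qed
qed

text \<open>The values of a solution that is compatible with both ends are joined pairwise by
  positive edges, so the route may visit the variables in any order.\<close>

lemma posroute_solution:
  assumes "distinct cs" "(a, b) \<in> Ps"
    and "\<And>v. v \<in> set cs \<Longrightarrow> (v, s v) \<in> X \<and> (a, (v, s v)) \<in> Ps \<and> ((v, s v), b) \<in> Ps"
    and "\<And>v v'. v \<in> set cs \<Longrightarrow> v' \<in> set cs \<Longrightarrow> v \<noteq> v' \<Longrightarrow> ((v, s v), (v', s v')) \<in> Ps"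
  shows "posroute X Ps cs a b"
  using assms
proof (induction cs arbitrary: a)
  case (Cons c cs)
  have "posroute X Ps cs (c, s c) b"
    using Cons.prems by (intro Cons.IH) auto
  then show ?case using Cons.prems(3)[of c] by (auto intro!: bexI[of _ "(c, s c)"])
qed simp

text \<open>Adjacent variables have some forbidden pair, and consecutive pairs need not fit together
  because a negative route may change the point inside a variable.\<close>

lemma negroute_linked:
  assumes "linked (edges Ng) (c # cs)" "Ng \<subseteq> X \<times> X" "(a, r) \<in> Ng" "fst r = c" "(r', b) \<in> Ng"
    "fst r' = last (c # cs)"
  shows "negroute X Ng (c # cs) a b"
  using assms
proof (induction cs arbitrary: c a r)
  case Nil
  then show ?case by auto
next
  case (Cons d cs)
  then obtain p q where pq: "(p, q) \<in> Ng" "fst p = c" "fst q = d" by (auto simp: edges_def)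
  have "negroute X Ng (d # cs) p b"
    using Cons.prems by (intro Cons.IH[OF _ _ pq(1)]) (auto simp: pq)
  then show ?case using Cons.prems pq unfolding negroute.simps(2)[of X Ng c] by blast
qed

lemma negroute_ex:
  assumes "linked (edges Ng) (u # cs @ [w])" "Ng \<subseteq> X \<times> X"
  shows "\<exists>a\<in>X. \<exists>b\<in>X. fst a = u \<and> fst b = w \<and> negroute X Ng cs a b"
  using assms(1)
proof (induction cs arbitrary: u)
  case Nil
  then obtain a b where ab: "(a, b) \<in> Ng" "fst a = u" "fst b = w" by (auto simp: edges_def)
  then have "a \<in> X" "b \<in> X" using assms(2) by auto
  with ab show ?case by auto
next
  case (Cons c cs)
  then obtain a f where af: "(a, f) \<in> Ng" "fst a = u" "fst f = c" by (auto simp: edges_def)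
  moreover have "linked (edges Ng) (c # cs @ [w])" using Cons.prems by simp
  from Cons.IH[OF this] obtain f' b where
    "f' \<in> X" "b \<in> X" "fst f' = c" "fst b = w" "negroute X Ng cs f' b" by blast
  moreover have "a \<in> X" "f \<in> X" using af assms(2) by auto
  ultimately show ?case by (intro bexI[of _ a] bexI[of _ b]) auto
qed

text \<open>Apart from deleting points, the reduction only turns positive edges into negative ones,
  so just the new negative edges have to be realised. By \<open>single_neg\<close> the occurrence
  uses at most one of them, say between \<open>a\<close> and \<open>b\<close>; it is routed along a
  path in \<open>A\<close> from a variable conflicting with \<open>a\<close> to one conflicting with
  \<open>b\<close>. The positive edges between \<open>u\<close> and \<open>w\<close> have to take
  the same route.\<close>

lemma elim_occurs_TM:
  fixes u w :: 'v and X :: "('v \<times> 'a) set"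
  assumes P: "is_pattern P" "single_neg P" and conn: "connected (edges (negE X N)) A"
  defines "X' \<equiv> elim_pts X N A u w" and "N' \<equiv> elim_neg X N A u w"
  assumes occ: "occurs_TM P (tgt X' (posE X' N') (negE X' N'))"
  shows "occurs_TM P (tgt X (posE X N) (negE X N))"
proof -
  have X': "X' \<subseteq> X" "\<And>p. p \<in> X' \<Longrightarrow> fst p \<notin> A" by (auto simp: X'_def elim_pts_def)
  have allowed': "allowed N' p q \<longleftrightarrow> allowed N p q \<and>
     (fst p = u \<and> fst q = w \<longrightarrow> extends X N A p q) \<and> (fst q = u \<and> fst p = w \<longrightarrow> extends X N A q p)"
    if "p \<in> X'" "q \<in> X'" for p q
    using elim_allowed[OF that[unfolded X'_def]] unfolding N'_def .
  have pos: "posE X' N' \<subseteq> posE X N" using X'(1) allowed' by (auto simp: posE_def)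
  have neg: "(p, q) \<in> negE X N" if "(p, q) \<in> negE X' N'" "\<not> allowed N p q" for p q
    using that X'(1) by (auto simp: negE_def)
  have neg': "(p, q) \<in> negE X N" if "(p, q) \<in> negE X' N'" "{fst p, fst q} \<noteq> {u, w}" for p q
  proof -
    have pq: "p \<in> X'" "q \<in> X'" "fst p \<noteq> fst q" "\<not> allowed N' p q" using that(1) by (auto simp: negE_def)
    then have "\<not> allowed N p q" using allowed'[OF pq(1,2)] that(2) by (auto simp: insert_commute)
    then show ?thesis using neg that(1) by blast
  qed
  obtain S where S: "subdivision P S" and SP: "occurs_SP S (tgt X' (posE X' N') (negE X' N'))"
    using occ by (auto simp: occurs_TM_def)
  have pat: "is_pattern S" "single_neg S" using subdivision_facts[OF S P(1)] P(2) by auto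
  note D = patternD[OF pat(1)]
  from SP obtain h where h: "\<And>x. x \<in> pts S \<Longrightarrow> h x \<in> X'"
    "\<And>x y. x \<in> pts S \<Longrightarrow> y \<in> pts S \<Longrightarrow> fst (h x) = fst (h y) \<Longrightarrow> (x, y) \<in> same S"
    "\<And>x y. (x, y) \<in> same S \<Longrightarrow> fst (h x) = fst (h y)"
    "\<And>x y. (x, y) \<in> pos S \<Longrightarrow> (h x, h y) \<in> posE X' N'"
    "\<And>x y. (x, y) \<in> neg S \<Longrightarrow> (h x, h y) \<in> negE X' N'"
    by (elim occurs_SP_tgtE) (rule that; assumption)
  have SPI: "occurs_SP S (tgt X' (posE X' N') Ng)"
    if "\<And>x y. (x, y) \<in> neg S \<Longrightarrow> (h x, h y) \<in> Ng" for Ng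
  proof (rule occurs_SP_tgtI[of S h])
    show "h x \<in> X' \<and> h y \<in> X' \<and> fst (h x) = fst (h y)" if "(x, y) \<in> same S" for x y
      using h(1,3) D(4)[OF that] that by blast
    show "fst (h x) \<noteq> fst (h y)" if "x \<in> pts S" "y \<in> pts S" "(x, y) \<notin> same S" for x y
      using h(2) that by blast
  qed (use h that in blast)+
  show ?thesis
  proof (cases "\<exists>x y. (x, y) \<in> neg S \<and> fst (h x) = u \<and> fst (h y) = w \<and> allowed N (h x) (h y)")
    case False
    have "(h x, h y) \<in> negE X N" if xy: "(x, y) \<in> neg S" for x y
    proof (cases "allowed N (h x) (h y)")
      case True
      have "(y, x) \<in> neg S" using D(3)[OF xy] by simp
      then have "{fst (h x), fst (h y)} \<noteq> {u, w}"
        using False xy True allowed_sym by (metis doubleton_eq_iff)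
      then show ?thesis using neg' h(5)[OF xy] by blast
    qed (use neg h(5)[OF xy] in blast)
    from occurs_SP_mono[OF SPI X'(1) pos order_refl] this S show ?thesis
      unfolding occurs_TM_def by blast
  next
    case True
    then obtain x0 y0 where xy0: "(x0, y0) \<in> neg S" "fst (h x0) = u" "fst (h y0) = w" "allowed N (h x0) (h y0)"
      by blast
    define a b where "a = h x0" and "b = h y0"
    have ab: "a \<in> X'" "b \<in> X'" "fst a = u" "fst b = w" "allowed N a b" "(a, b) \<in> negE X' N'"
      using xy0 h(1,5) D(3)[OF xy0(1)] by (auto simp: a_def b_def)
    then have uw: "u \<noteq> w" by (auto simp: negE_def)
    have not_ext: "\<not> extends X N A a b"
      using ab uw allowed'[OF ab(1,2)] by (auto simp: negE_def)
    have ext: "extends X N A a a" "extends X N A b b"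
      using ab by (auto simp: X'_def elim_pts_def)
    \<comment> \<open>Since \<open>q\<close> alone extends to \<open>A\<close> but not together with
      \<open>p\<close>, a solution compatible with \<open>q\<close> must conflict with
      \<open>p\<close> somewhere in \<open>A\<close>. This is where the removal of values in
      \<open>elim_pts\<close> pays off.\<close>
    have hit: "\<exists>r. (p, r) \<in> negE X N \<and> fst r \<in> A"
      if pq: "p \<in> X'" "extends X N A q q" "\<not> (extends X N A p q \<and> extends X N A q p)" for p q
    proof -
      obtain s where s: "solves X N A s" "\<And>v. v \<in> A \<Longrightarrow> allowed N (v, s v) q"
        using pq(2) by (auto simp: extends_def)
      then obtain v where "v \<in> A" "\<not> allowed N (v, s v) p"
        using pq(3) unfolding extends_def by blast
      moreover have "fst p \<noteq> v" using X'(2)[OF pq(1)] \<open>v \<in> A\<close> by blast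
      moreover have "(v, s v) \<in> X" using s(1) \<open>v \<in> A\<close> by (auto simp: solves_def)
      moreover have "p \<in> X" using pq(1) X'(1) by blast
      ultimately have "(p, (v, s v)) \<in> negE X N"
        by (simp add: negE_def allowed_sym[of N p])
      with \<open>v \<in> A\<close> show ?thesis by auto
    qed
    obtain r where r: "(a, r) \<in> negE X N" "fst r \<in> A"
      using hit[OF ab(1) ext(2)] not_ext by blast
    obtain r' where r': "(b, r') \<in> negE X N" "fst r' \<in> A"
      using hit[OF ab(2) ext(1)] not_ext by blast
    have "\<exists>cs. linked (edges (negE X N)) (fst r # cs) \<and> distinct (fst r # cs) \<and>
        set (fst r # cs) \<subseteq> A \<and> last (fst r # cs) = fst r'"
    proof (cases "fst r = fst r'")
      case True
      then show ?thesis using r by (intro exI[of _ "[]"]) auto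
    next
      case False
      moreover have "conn (edges (negE X N)) A (fst r) (fst r')"
        using conn r r' by (auto simp: connected_def)
      ultimately obtain xs where "distinct (fst r # xs @ [fst r'])" "set xs \<subseteq> A"
        "linked (edges (negE X N)) (fst r # xs @ [fst r'])"
        using conn_path by metis
      then show ?thesis using r r' by (intro exI[of _ "xs @ [fst r']"]) auto
    qed
    then obtain cs where cs: "linked (edges (negE X N)) (fst r # cs)" "distinct (fst r # cs)"
      "set (fst r # cs) \<subseteq> A" "last (fst r # cs) = fst r'" by blast
    have negE_sub: "negE X N \<subseteq> X \<times> X" "posE X N \<subseteq> X \<times> X" for X :: "('v \<times> 'a) set" and N
      by (auto simp: negE_def posE_def)
    have route: "negroute X (negE X N) (fst r # cs) a b"
      using negroute_linked[OF cs(1) negE_sub(1) r(1) refl symD[OF sym_negE r'(1)]] cs(4) by simp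
    \<comment> \<open>Between \<open>u\<close> and \<open>w\<close> only the negative edge actually
      used is kept, because the route is guaranteed for no other pair of points.\<close>
    define Ng where "Ng = {(p, q) \<in> negE X' N'. {fst p, fst q} = {u, w} \<longrightarrow> (p, q) = (a, b) \<or> (p, q) = (b, a)}"
    have "(h x, h y) \<in> Ng" if xy: "(x, y) \<in> neg S" for x y
    proof -
      have pts: "x \<in> pts S" "y \<in> pts S" "x0 \<in> pts S" "y0 \<in> pts S" "(y, x) \<in> neg S"
        using D(3)[OF xy] D(3)[OF xy0(1)] by auto
      have "(h x, h y) = (a, b) \<or> (h x, h y) = (b, a)" if "{fst (h x), fst (h y)} = {u, w}"
      proof -
        from that consider "fst (h x) = u" "fst (h y) = w" | "fst (h x) = w" "fst (h y) = u"
          by (auto simp: doubleton_eq_iff)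
        then show ?thesis
        proof cases
          case 1
          then have "(x, x0) \<in> same S" "(y, y0) \<in> same S" using h(2) pts xy0 by auto
          then show ?thesis using pat(2) xy xy0(1) unfolding single_neg_def a_def b_def by blast
        next
          case 2
          then have "(y, x0) \<in> same S" "(x, y0) \<in> same S" using h(2) pts xy0 by auto
          then show ?thesis using pat(2) pts(5) xy0(1) unfolding single_neg_def a_def b_def by blast
        qed
      qed
      then show ?thesis using h(5)[OF xy] by (auto simp: Ng_def)
    qed
    then have "occurs_TM P (tgt X' (posE X' N') Ng)"
      using SPI S unfolding occurs_TM_def by blast
    then show ?thesis
    proof (rule occurs_TM_route[OF P(1) _ _ _ negE_sub(2,1) sym_posE sym_negE sym_posE _ uw cs(2)])
      show "posE X' N' \<subseteq> X' \<times> X'" by (rule negE_sub)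
      show "Ng \<subseteq> X' \<times> X'" using negE_sub(1)[of X' N'] by (auto simp: Ng_def)
      show "sym Ng" using sym_negE[of X' N'] by (auto simp: Ng_def sym_def insert_commute)
      show "u \<notin> set (fst r # cs)" "w \<notin> set (fst r # cs)" using cs(3) X'(2) ab by blast+
      show "X' \<subseteq> X" by (rule X')
      show "fst x \<notin> set (fst r # cs)" if "x \<in> X'" for x using cs(3) X'(2)[OF that] by blast
      show "(p, q) \<in> posE X N" if "(p, q) \<in> posE X' N'" for p q using pos that by blast
      show "(p, q) \<in> negE X N" if "(p, q) \<in> Ng" "{fst p, fst q} \<noteq> {u, w}" for p q
        using neg' that by (auto simp: Ng_def)
      show "negroute X (negE X N) (fst r # cs) p q" if "(p, q) \<in> Ng" "fst p = u" "fst q = w" for p q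
        using that ab uw route by (auto simp: Ng_def)
      \<comment> \<open>A pair still joined by a positive edge after the reduction extends to
        \<open>A\<close>, and the extension supplies the middle points.\<close>
      show "posroute X (posE X N) (fst r # cs) p q" if pq: "(p, q) \<in> posE X' N'" "fst p = u" "fst q = w" for p q
      proof -
        have pqX: "p \<in> X'" "q \<in> X'" using pq by (auto simp: posE_def)
        then have "extends X N A p q" using pq allowed' by (auto simp: posE_def)
        then obtain s where s: "solves X N A s" "\<And>v. v \<in> A \<Longrightarrow> allowed N (v, s v) p"
          "\<And>v. v \<in> A \<Longrightarrow> allowed N (v, s v) q" by (auto simp: extends_def)
        show ?thesis
        proof (rule posroute_solution[OF cs(2), where s = s])
          show "(p, q) \<in> posE X N" using pos pq by blast
          fix v assume "v \<in> set (fst r # cs)"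
          then have v: "v \<in> A" using cs(3) by blast
          then have "(v, s v) \<in> X" "fst p \<noteq> v" "fst q \<noteq> v" "p \<in> X" "q \<in> X"
            using s(1) X'(1) X'(2)[OF pqX(1)] X'(2)[OF pqX(2)] pqX unfolding solves_def by blast+
          then show "(v, s v) \<in> X \<and> (p, (v, s v)) \<in> posE X N \<and> ((v, s v), q) \<in> posE X N"
            using s(2,3)[OF v] by (auto simp: posE_def allowed_sym[of N p])
          fix v' assume "v' \<in> set (fst r # cs)" "v \<noteq> v'"
          then show "((v, s v), (v', s v')) \<in> posE X N"
            using v cs(3) s(1) by (auto simp: posE_def solves_def)
        qed
      qed
    qed
  qed
qed

section \<open>Excluding the pattern inside minimal fragments\<close>

lemma occurs_SP_imp_TM:
  assumes "occurs_SP P (tgt X Ps Ng)"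
  shows "occurs_TM P (tgt X Ps Ng)"
proof -
  obtain h' where h': "pattern_hom h' P (tgt X Ps Ng)" "preserves_parts h' P (tgt X Ps Ng)"
    using assms by (auto simp: occurs_SP_def)
  define g where "g z = (case z of Orig x \<Rightarrow> h' x | _ \<Rightarrow> undefined)" for z
  have "pattern_hom g (orig_pattern P) (tgt X Ps Ng)"
    using h'(1) by (force simp: pattern_hom_def orig_pattern_def g_def)
  moreover have "preserves_parts g (orig_pattern P) (tgt X Ps Ng)"
    using h'(2) by (force simp: preserves_parts_def orig_pattern_def g_def)
  ultimately show ?thesis
    unfolding occurs_TM_def occurs_SP_def using subdivision.none by blast
qed

lemma edgesI: "(p, q) \<in> Ng \<Longrightarrow> (fst p, fst q) \<in> edges Ng"
  unfolding edges_def by blast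

lemma linked_mono:
  "linked E xs \<Longrightarrow> (\<And>x y. x \<in> set xs \<Longrightarrow> y \<in> set xs \<Longrightarrow> (x, y) \<in> E \<Longrightarrow> (x, y) \<in> F) \<Longrightarrow> linked F xs"
  unfolding linked_def by (erule successively_mono) auto

lemma on_cycle_mono: "on_cycle E L s t \<Longrightarrow> E \<subseteq> F \<Longrightarrow> on_cycle F L s t"
  unfolding on_cycle_def by (meson linked_mono subsetD)

section \<open>The extended pattern and its occurrences along cycles\<close>

locale extended_pattern =
  fixes P0 P :: "'x pattern"
    and U1 U2 U3 :: "'x set"
    and p1 p2 r1 r2 q1 q2 :: 'x
  assumes P0: "is_pattern P0"
    and parts_P0: "parts P0 = {U1, U2, U3}" "U1 \<noteq> U2" "U1 \<noteq> U3" "U2 \<noteq> U3"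
    and neg12: "\<exists>\<^sub>\<le>\<^sub>1e. e \<in> neg P0 \<inter> U1 \<times> U2"
    and neg23: "\<exists>\<^sub>\<le>\<^sub>1e. e \<in> neg P0 \<inter> U2 \<times> U3"
    and none13: "(pos P0 \<union> neg P0) \<inter> U1 \<times> U3 = {}"
    and new: "distinct [p1, p2, r1, r2, q1, q2]" "{p1, p2, r1, r2, q1, q2} \<inter> pts P0 = {}"
    and P: "P = \<lparr>pts = pts P0 \<union> {p1, p2, r1, r2, q1, q2},
              same = same P0 \<union> (U1 \<union> {p1, p2}) \<times> (U1 \<union> {p1, p2})
                     \<union> (U3 \<union> {r1, r2}) \<times> (U3 \<union> {r1, r2})
                     \<union> {q1, q2} \<times> {q1, q2},
              pos = pos P0,
              neg = neg P0 \<union> {(p1, r1), (r1, p1), (p2, q1), (q1, p2), (q2, r2), (r2, q2)}\<rparr>"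
begin

lemma in_parts: "U1 \<in> parts P0" "U2 \<in> parts P0" "U3 \<in> parts P0"
  using parts_P0 by auto

lemmas part12 = partD[OF P0 in_parts(1,2) parts_P0(2)]
lemmas part13 = partD[OF P0 in_parts(1,3) parts_P0(3)]
lemmas part23 = partD[OF P0 in_parts(2,3) parts_P0(4)]

lemma nonempty: "U1 \<noteq> {}" "U2 \<noteq> {}" "U3 \<noteq> {}"
  using in_parts patternD(1,5)[OF P0] unfolding parts_def by (fast elim: quotientE)+

lemma pts_P0: "pts P0 = U1 \<union> U2 \<union> U3"
proof
  show "pts P0 \<subseteq> U1 \<union> U2 \<union> U3"
    using Union_quotient[OF patternD(1)[OF P0]] parts_P0(1) unfolding parts_def by auto
qed (use part12(1,2) part13(2) in auto)

lemma same_P0: "same P0 = U1 \<times> U1 \<union> U2 \<times> U2 \<union> U3 \<times> U3"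
proof -
  have "(x, y) \<in> same P0 \<longleftrightarrow> (x, y) \<in> U1 \<times> U1 \<union> U2 \<times> U2 \<union> U3 \<times> U3" for x y
  proof (cases "x \<in> pts P0")
    case True
    then consider "x \<in> U1" "x \<notin> U2" "x \<notin> U3" | "x \<in> U2" "x \<notin> U1" "x \<notin> U3"
      | "x \<in> U3" "x \<notin> U1" "x \<notin> U2"
      unfolding pts_P0 using part12(3) part13(3) part23(3) by blast
    then show ?thesis
      using part12(4,5)[of x y] part13(5)[of x y] by cases auto
  next
    case False
    then show ?thesis using patternD(4)[OF P0, of x y] pts_P0 by blast
  qed
  then show ?thesis by auto
qed

text \<open>The use of the missing edges between \<open>U1\<close> and \<open>U3\<close>: since
  \<open>U2\<close> takes part in every edge, routes between the variables of the other two parts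
  never have to carry an edge of \<open>P0\<close>.\<close>

lemma edge_P0:
  assumes "(x, y) \<in> pos P0 \<union> neg P0"
  shows "x \<in> U2 \<and> y \<in> U1 \<union> U3 \<or> y \<in> U2 \<and> x \<in> U1 \<union> U3"
proof -
  have "x \<in> pts P0" "y \<in> pts P0" "(x, y) \<notin> same P0" "(y, x) \<in> pos P0 \<union> neg P0"
    using assms patternD(2,3)[OF P0] by blast+
  then show ?thesis using none13 assms unfolding pts_P0 same_P0 by blast
qed

lemma P_simps:
  "pts P = pts P0 \<union> {p1, p2, r1, r2, q1, q2}"
  "same P = same P0 \<union> (U1 \<union> {p1, p2}) \<times> (U1 \<union> {p1, p2}) \<union> (U3 \<union> {r1, r2}) \<times> (U3 \<union> {r1, r2})
     \<union> {q1, q2} \<times> {q1, q2}"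
  "pos P = pos P0"
  "neg P = neg P0 \<union> {(p1, r1), (r1, p1), (p2, q1), (q1, p2), (q2, r2), (r2, q2)}"
  by (simp_all add: P)

lemma disjoint: "U1 \<inter> U2 = {}" "U1 \<inter> U3 = {}" "U2 \<inter> U3 = {}"
  using part12(3) part13(3) part23(3) by auto

lemma new_notin: "z \<in> {p1, p2, r1, r2, q1, q2} \<Longrightarrow> z \<notin> U1 \<and> z \<notin> U2 \<and> z \<notin> U3"
  using new(2) unfolding pts_P0 by blast

text \<open>Numbers the four parts, so that questions about \<open>same P\<close> become comparisons
  of numbers. The value 4 stands for \<open>U4\<close> on points of \<open>P\<close> and is a
  default elsewhere.\<close>

definition cls :: "'x \<Rightarrow> nat" where
  "cls x = (if x \<in> U1 \<union> {p1, p2} then 1 else if x \<in> U2 then 2 else if x \<in> U3 \<union> {r1, r2} then 3 else 4)"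

lemma cls_simps:
  "x \<in> U1 \<Longrightarrow> cls x = 1" "x \<in> U2 \<Longrightarrow> cls x = 2" "x \<in> U3 \<Longrightarrow> cls x = 3"
  "cls p1 = 1" "cls p2 = 1" "cls r1 = 3" "cls r2 = 3" "cls q1 = 4" "cls q2 = 4"
proof -
  show "x \<in> U1 \<Longrightarrow> cls x = 1" by (simp add: cls_def)
  show "x \<in> U2 \<Longrightarrow> cls x = 2" using disjoint new_notin[of p1] new_notin[of p2] by (auto simp: cls_def)
  show "x \<in> U3 \<Longrightarrow> cls x = 3" using disjoint new_notin[of p1] new_notin[of p2] by (auto simp: cls_def)
qed (use new(1) new_notin in \<open>auto simp: cls_def\<close>)

lemma cls_iff:
  "x \<in> U1 \<union> {p1, p2} \<longleftrightarrow> x \<in> pts P \<and> cls x = 1" "x \<in> U2 \<longleftrightarrow> x \<in> pts P \<and> cls x = 2"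
  "x \<in> U3 \<union> {r1, r2} \<longleftrightarrow> x \<in> pts P \<and> cls x = 3" "x \<in> {q1, q2} \<longleftrightarrow> x \<in> pts P \<and> cls x = 4"
proof -
  have val: "x \<in> U1 \<union> {p1, p2} \<Longrightarrow> cls x = 1" "x \<in> U3 \<union> {r1, r2} \<Longrightarrow> cls x = 3" "x \<in> {q1, q2} \<Longrightarrow> cls x = 4"
    using cls_simps by auto
  have pts: "x \<in> pts P \<longleftrightarrow> x \<in> U1 \<union> {p1, p2} \<or> x \<in> U2 \<or> x \<in> U3 \<union> {r1, r2} \<or> x \<in> {q1, q2}"
    unfolding P_simps pts_P0 by blast
  show "x \<in> U1 \<union> {p1, p2} \<longleftrightarrow> x \<in> pts P \<and> cls x = 1" "x \<in> U2 \<longleftrightarrow> x \<in> pts P \<and> cls x = 2"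
    "x \<in> U3 \<union> {r1, r2} \<longleftrightarrow> x \<in> pts P \<and> cls x = 3" "x \<in> {q1, q2} \<longleftrightarrow> x \<in> pts P \<and> cls x = 4"
    using val cls_simps(2)[of x] unfolding pts by fastforce+
qed

lemma cls_range: "cls x \<in> {1, 2, 3, 4}"
  by (auto simp: cls_def)

lemma same_P: "(x, y) \<in> same P \<longleftrightarrow> x \<in> pts P \<and> y \<in> pts P \<and> cls x = cls y"
proof -
  define A B Q where "A = U1 \<union> {p1, p2}" and "B = U3 \<union> {r1, r2}" and "Q = {q1, q2}"
  have "U1 \<times> U1 \<subseteq> A \<times> A" "U3 \<times> U3 \<subseteq> B \<times> B" by (auto simp: A_def B_def)
  then have "same P = A \<times> A \<union> U2 \<times> U2 \<union> B \<times> B \<union> Q \<times> Q"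
    unfolding P_simps same_P0 A_def[symmetric] B_def[symmetric] Q_def[symmetric] by auto
  then have "(x, y) \<in> same P \<longleftrightarrow> x \<in> A \<and> y \<in> A \<or> x \<in> U2 \<and> y \<in> U2 \<or> x \<in> B \<and> y \<in> B \<or> x \<in> Q \<and> y \<in> Q"
    by simp
  then show ?thesis
    unfolding A_def B_def Q_def cls_iff using cls_range[of x] by (elim insertE) auto
qed

lemma is_pattern_P: "is_pattern P"
proof (rule patternI, goal_cases)
  case (4 x y)
  then have "(x, y) \<in> pos P0" by (simp add: P_simps)
  then show ?case
    using patternD(2)[OF P0] edge_P0[of x y] cls_simps(1-3) unfolding same_P P_simps(1,3) by auto
next
  case (5 x y)
  then consider "(x, y) \<in> neg P0"
    | "(x, y) \<in> {(p1, r1), (r1, p1), (p2, q1), (q1, p2), (q2, r2), (r2, q2)}"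
    by (auto simp: P_simps)
  then show ?case
  proof cases
    case 1
    then show ?thesis
      using patternD(3)[OF P0] edge_P0[of x y] cls_simps(1-3) unfolding same_P P_simps(1,4) by auto
  next
    case 2
    then show ?thesis using cls_simps(4-9) unfolding same_P P_simps(1,4) by auto
  qed
qed (auto simp: same_P)

text \<open>Negative edges of \<open>P0\<close> all meet \<open>U2\<close>, whereas the new ones
  join the other three parts pairwise, one edge for each pair.\<close>

lemma single_neg_P: "single_neg P"
proof -
  have u12: "x = x' \<and> y = y'"
    if "(x, y) \<in> neg P0" "(x', y') \<in> neg P0" "x \<in> U1" "x' \<in> U1" "y \<in> U2" "y' \<in> U2" for x y x' y'
    using neg12 that unfolding Uniq_def by blast
  have u23: "x = x' \<and> y = y'"
    if "(x, y) \<in> neg P0" "(x', y') \<in> neg P0" "x \<in> U2" "x' \<in> U2" "y \<in> U3" "y' \<in> U3" for x y x' y'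
    using neg23 that unfolding Uniq_def by blast
  have old: "x = x' \<and> y = y'"
    if *: "(x, y) \<in> neg P0" "(x', y') \<in> neg P0" "cls x = cls x'" "cls y = cls y'" for x y x' y'
  proof -
    have sw: "(y, x) \<in> neg P0" "(y', x') \<in> neg P0" using patternD(3)[OF P0] * by blast+
    from edge_P0[of x y] edge_P0[of x' y'] * cls_simps(1-3)
    consider "x \<in> U2" "y \<in> U1" "x' \<in> U2" "y' \<in> U1" | "x \<in> U2" "y \<in> U3" "x' \<in> U2" "y' \<in> U3"
      | "x \<in> U1" "y \<in> U2" "x' \<in> U1" "y' \<in> U2" | "x \<in> U3" "y \<in> U2" "x' \<in> U3" "y' \<in> U2"
      by auto
    then show ?thesis
      using u12[of y x y' x'] u23[of x y x' y'] u12[of x y x' y'] u23[of y x y' x'] * sw by cases auto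
  qed
  have mixed: False
    if "(x, y) \<in> neg P0" "(x', y') \<in> {(p1, r1), (r1, p1), (p2, q1), (q1, p2), (q2, r2), (r2, q2)}"
      "cls x = cls x'" "cls y = cls y'" for x y x' y'
    using edge_P0[of x y] cls_simps that by auto
  show ?thesis
    unfolding single_neg_def
  proof (intro allI impI)
    fix x y x' y'
    assume *: "(x, y) \<in> neg P" "(x', y') \<in> neg P" "(x, x') \<in> same P" "(y, y') \<in> same P"
    then have c: "cls x = cls x'" "cls y = cls y'" by (auto simp: same_P)
    from *(1,2) show "x = x' \<and> y = y'"
      unfolding P_simps
    proof (elim UnE, goal_cases)
      case 1 then show ?case using old c by blast
    next
      case 2 then show ?case using mixed[OF _ _ c] by blast
    next
      case 3 then show ?case using mixed[OF _ _ c[symmetric]] by blast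
    next
      case 4 then show ?case using c cls_simps(4-9) by auto
    qed
  qed
qed

text \<open>The first inner variable \<open>d\<close> of one arc carries \<open>U4\<close>. The edge
  between \<open>p2\<close> and \<open>q1\<close> is then an edge of the cycle, the one between
  \<open>q2\<close> and \<open>r2\<close> follows the rest \<open>es\<close> of this arc, and the
  one between \<open>p1\<close> and \<open>r1\<close> follows the other arc \<open>cs\<close>. Both
  routes are contracted to single negative edges, so that \<open>P\<close> occurs without any
  subdivision, and are then expanded one after the other.\<close>

lemma occurs_TM_cycle:
  fixes X :: "('v \<times> 'a) set"
  assumes sub: "Ps \<subseteq> X \<times> X" "Ng \<subseteq> X \<times> X" and sym: "sym Ps" "sym Ng"
    and occ: "occurs_SP P0 (tgt X0 Ps Ng)" and X0: "X0 \<subseteq> X"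
    and cycle: "\<And>v1 v2 v3. {v1, v2, v3} \<subseteq> fst ` X0 \<Longrightarrow> distinct [v1, v2, v3] \<Longrightarrow>
      \<exists>L. v2 \<notin> L \<and> on_cycle (edges Ng) L v1 v3"
  shows "occurs_TM P (tgt X Ps Ng)"
proof -
  from occ obtain h where h: "\<And>x. x \<in> pts P0 \<Longrightarrow> h x \<in> X0"
    "\<And>x y. x \<in> pts P0 \<Longrightarrow> y \<in> pts P0 \<Longrightarrow> fst (h x) = fst (h y) \<Longrightarrow> (x, y) \<in> same P0"
    "\<And>x y. (x, y) \<in> same P0 \<Longrightarrow> fst (h x) = fst (h y)"
    "\<And>x y. (x, y) \<in> pos P0 \<Longrightarrow> (h x, h y) \<in> Ps"
    "\<And>x y. (x, y) \<in> neg P0 \<Longrightarrow> (h x, h y) \<in> Ng"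
    by (elim occurs_SP_tgtE) (rule that; assumption)
  obtain x1 x2 x3 where x: "x1 \<in> U1" "x2 \<in> U2" "x3 \<in> U3" using nonempty by auto
  define v1 v2 v3 where "v1 = fst (h x1)" and "v2 = fst (h x2)" and "v3 = fst (h x3)"
  have xp: "x1 \<in> pts P0" "x2 \<in> pts P0" "x3 \<in> pts P0" using x pts_P0 by auto
  have hU: "fst (h y) = v1" if "y \<in> U1" for y
    using h(3)[of y x1] that x unfolding same_P0 v1_def by blast
  have hU2: "fst (h y) = v2" if "y \<in> U2" for y
    using h(3)[of y x2] that x unfolding same_P0 v2_def by blast
  have hU3: "fst (h y) = v3" if "y \<in> U3" for y
    using h(3)[of y x3] that x unfolding same_P0 v3_def by blast
  have v: "distinct [v1, v2, v3]" "{v1, v2, v3} \<subseteq> fst ` X0"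
  proof -
    have "(x1, x2) \<notin> same P0" "(x1, x3) \<notin> same P0" "(x2, x3) \<notin> same P0"
      using x disjoint unfolding same_P0 by blast+
    then show "distinct [v1, v2, v3]"
      using h(2) xp unfolding v1_def v2_def v3_def by auto
    show "{v1, v2, v3} \<subseteq> fst ` X0" using h(1) xp unfolding v1_def v2_def v3_def by auto
  qed
  obtain L cs ds where L: "v2 \<notin> L" "ds \<noteq> []" "distinct (v1 # v3 # cs @ ds)" "set (cs @ ds) \<subseteq> L"
    "linked (edges Ng) (v1 # cs @ [v3])" "linked (edges Ng) (v1 # ds @ [v3])"
    using cycle[OF v(2,1)] unfolding on_cycle_def by blast
  \<comment> \<open>This is why \<open>on_cycle\<close> asks for an inner vertex on one of the arcs;
    the other may be a single edge.\<close>
  obtain d es where ds: "ds = d # es" using L(2) by (cases ds) auto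
  have dist: "distinct cs" "distinct es" "d \<notin> set cs \<union> set es" "set cs \<inter> set es = {}"
    "v1 \<notin> set cs \<union> set es" "v2 \<notin> set cs \<union> set es" "v3 \<notin> set cs \<union> set es"
    "d \<noteq> v1" "d \<noteq> v2" "d \<noteq> v3" "v1 \<noteq> v2" "v1 \<noteq> v3" "v2 \<noteq> v3"
    using L v(1) ds by auto
  obtain \<alpha>2 \<delta>1 where e1: "(\<alpha>2, \<delta>1) \<in> Ng" "fst \<alpha>2 = v1" "fst \<delta>1 = d"
    using L(6) ds by (auto simp: edges_def)
  have "linked (edges Ng) (d # es @ [v3])" using L(6) ds by simp
  from negroute_ex[OF this sub(2)] obtain \<delta>2 \<beta>2 where
    e2: "\<delta>2 \<in> X" "\<beta>2 \<in> X" "fst \<delta>2 = d" "fst \<beta>2 = v3" "negroute X Ng es \<delta>2 \<beta>2" by blast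
  define X1 where "X1 = {z \<in> X. fst z \<notin> set es}"
  \<comment> \<open>Contraction of \<open>es\<close>: its variables are deleted, and the only edge
    left between \<open>d\<close> and \<open>v3\<close> is the negative one that stands for the
    route. Positive edges between them are discarded, so no positive route along \<open>es\<close>
    is required.\<close>
  define res1 where "res1 R = {(a, b) \<in> R. a \<in> X1 \<and> b \<in> X1 \<and> {fst a, fst b} \<noteq> {d, v3}}"
    for R :: "(('v \<times> 'a) \<times> ('v \<times> 'a)) set"
  define Ng1 where "Ng1 = res1 Ng \<union> {(\<delta>2, \<beta>2), (\<beta>2, \<delta>2)}"
  have res1_sym: "sym (res1 R)" if "sym R" for R
    using that unfolding res1_def sym_def by (auto simp: insert_commute)
  have Ng1: "Ng1 \<subseteq> X1 \<times> X1" "sym Ng1" "res1 Ps \<subseteq> X1 \<times> X1" "sym (res1 Ps)"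
  proof -
    show "Ng1 \<subseteq> X1 \<times> X1" using e2 dist by (auto simp: Ng1_def res1_def X1_def)
    show "sym Ng1" using res1_sym[OF sym(2)] by (auto simp: Ng1_def sym_def)
    show "res1 Ps \<subseteq> X1 \<times> X1" by (auto simp: res1_def)
    show "sym (res1 Ps)" using res1_sym[OF sym(1)] .
  qed
  have "linked (edges Ng1) (v1 # cs @ [v3])"
  proof (rule linked_mono[OF L(5)])
    fix a b assume ab: "a \<in> set (v1 # cs @ [v3])" "b \<in> set (v1 # cs @ [v3])" "(a, b) \<in> edges Ng"
    then obtain p q where pq: "(p, q) \<in> Ng" "fst p = a" "fst q = b" by (auto simp: edges_def)
    have "a \<notin> insert d (set es)" "b \<notin> insert d (set es)" using ab(1,2) dist by auto
    then have "(p, q) \<in> Ng1"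
      using pq sub(2) by (auto simp: Ng1_def res1_def X1_def doubleton_eq_iff)
    with pq show "(a, b) \<in> edges Ng1" using edgesI by metis
  qed
  from negroute_ex[OF this Ng1(1)] obtain \<alpha>1 \<beta>1 where
    e3: "\<alpha>1 \<in> X1" "\<beta>1 \<in> X1" "fst \<alpha>1 = v1" "fst \<beta>1 = v3" "negroute X1 Ng1 cs \<alpha>1 \<beta>1" by blast
  define X2 where "X2 = {z \<in> X1. fst z \<notin> set cs}"
  define res2 where "res2 R = {(a, b) \<in> R. a \<in> X2 \<and> b \<in> X2 \<and> {fst a, fst b} \<noteq> {v1, v3}}"
    for R :: "(('v \<times> 'a) \<times> ('v \<times> 'a)) set"
  define Ng2 where "Ng2 = res2 Ng1 \<union> {(\<alpha>1, \<beta>1), (\<beta>1, \<alpha>1)}"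
  have res2_sym: "sym (res2 R)" if "sym R" for R
    using that unfolding res2_def sym_def by (auto simp: insert_commute)
  have Ng2: "Ng2 \<subseteq> X2 \<times> X2" "sym Ng2" "res2 (res1 Ps) \<subseteq> X2 \<times> X2" "sym (res2 (res1 Ps))"
  proof -
    show "Ng2 \<subseteq> X2 \<times> X2" using e3 dist by (auto simp: Ng2_def res2_def X2_def)
    show "sym Ng2" using res2_sym[OF Ng1(2)] by (auto simp: Ng2_def sym_def)
    show "res2 (res1 Ps) \<subseteq> X2 \<times> X2" by (auto simp: res2_def)
    show "sym (res2 (res1 Ps))" using res2_sym[OF Ng1(4)] .
  qed
  define g where "g y = (if y \<in> pts P0 then h y else if y = p1 then \<alpha>1 else if y = p2 then \<alpha>2
      else if y = r1 then \<beta>1 else if y = r2 then \<beta>2 else if y = q1 then \<delta>1 else \<delta>2)" for y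
  have g_new: "g p1 = \<alpha>1" "g p2 = \<alpha>2" "g r1 = \<beta>1" "g r2 = \<beta>2" "g q1 = \<delta>1" "g q2 = \<delta>2"
    using new by (auto simp: g_def)
  have g_old: "g y = h y" if "y \<in> pts P0" for y using that by (simp add: g_def)
  define var where "var n = (if n = 1 then v1 else if n = 2 then v2 else if n = 3 then v3 else d)" for n :: nat
  have g_var: "fst (g y) = var (cls y)" if "y \<in> pts P" for y
    using that cls_simps g_new g_old hU hU2 hU3 pts_P0 e1 e2 e3 unfolding P_simps var_def by auto
  have var_inj: "var m = var n \<Longrightarrow> m = n" if "m \<in> {1, 2, 3, 4}" "n \<in> {1, 2, 3, 4}" for m n
    using that dist by (auto simp: var_def split: if_splits)
  have "e1X": "\<alpha>2 \<in> X" "\<delta>1 \<in> X" using e1 sub(2) by auto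
  have g_X: "g y \<in> X2" if "y \<in> pts P" for y
  proof -
    have "g y \<in> X"
      using that g_new g_old h(1) X0 e1X e2 e3 by (auto simp: P_simps X1_def)
    moreover have "fst (g y) \<notin> set cs \<union> set es"
      unfolding g_var[OF that] using dist by (auto simp: var_def)
    ultimately show ?thesis by (simp add: X1_def X2_def)
  qed
  \<comment> \<open>An edge of \<open>P0\<close> has an end over \<open>v2\<close>, which is not on
    the cycle, so it is not among the discarded edges.\<close>
  have old_edge: "(g a, g b) \<in> res2 (res1 R)" if ab: "(a, b) \<in> pos P0 \<union> neg P0" "(h a, h b) \<in> R" for a b R
  proof -
    have pts: "a \<in> pts P0" "b \<in> pts P0" using ab(1) patternD(2,3)[OF P0] by blast+
    then have "g a \<in> X2" "g b \<in> X2" using g_X by (auto simp: P_simps)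
    moreover have "{fst (h a), fst (h b)} \<noteq> {d, v3}" "{fst (h a), fst (h b)} \<noteq> {v1, v3}"
      using edge_P0[OF ab(1)] hU hU2 hU3 dist by (auto simp: doubleton_eq_iff)
    ultimately show ?thesis using ab(2) g_old pts by (auto simp: res2_def res1_def X2_def)
  qed
  have new_edge: "(\<alpha>2, \<delta>1) \<in> Ng2" "(\<delta>2, \<beta>2) \<in> Ng2"
  proof -
    have m: "\<alpha>2 \<in> X2" "\<delta>1 \<in> X2" "\<delta>2 \<in> X2" "\<beta>2 \<in> X2"
      using g_X[of p2] g_X[of q1] g_X[of q2] g_X[of r2] g_new by (auto simp: P_simps)
    then show "(\<alpha>2, \<delta>1) \<in> Ng2"
      using e1 dist by (auto simp: Ng2_def res2_def Ng1_def res1_def X2_def doubleton_eq_iff)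
    show "(\<delta>2, \<beta>2) \<in> Ng2"
      using m e2 dist by (auto simp: Ng2_def res2_def Ng1_def doubleton_eq_iff)
  qed
  have "occurs_SP P (tgt X2 (res2 (res1 Ps)) Ng2)"
  proof (rule occurs_SP_tgtI[of P g])
    show "g y \<in> X2 \<and> g z \<in> X2 \<and> fst (g y) = fst (g z)" if "(y, z) \<in> same P" for y z
      using that g_X g_var by (auto simp: same_P)
    show "fst (g y) \<noteq> fst (g z)" if "y \<in> pts P" "z \<in> pts P" "(y, z) \<notin> same P" for y z
      using that g_var var_inj[OF cls_range cls_range] by (auto simp: same_P)
    show "(g y, g z) \<in> res2 (res1 Ps)" if "(y, z) \<in> pos P" for y z
      using that h(4) old_edge by (auto simp: P_simps)
    show "(g y, g z) \<in> Ng2" if "(y, z) \<in> neg P" for y z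
    proof (cases "(y, z) \<in> neg P0")
      case True
      then have "(g y, g z) \<in> res2 (res1 Ng)" using h(5) old_edge by blast
      then show ?thesis by (auto simp: Ng2_def Ng1_def res2_def)
    next
      case False
      have e: "(\<alpha>1, \<beta>1) \<in> Ng2" by (simp add: Ng2_def)
      from False that show ?thesis
        using e new_edge e[THEN symD[OF Ng2(2)]] new_edge[THEN symD[OF Ng2(2)]] g_new
        by (auto simp: P_simps)
    qed
  qed (rule g_X)
  from occurs_SP_imp_TM[OF this]
  have "occurs_TM P (tgt X1 (res1 Ps) Ng1)"
  proof (rule occurs_TM_route[OF is_pattern_P _ Ng2(3,1) Ng1(3,1) Ng1(4,2) Ng2(4,2)])
    show "v1 \<noteq> v3" "distinct cs" "v1 \<notin> set cs" "v3 \<notin> set cs" using dist by auto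
    show "negroute X1 Ng1 cs a b" if "(a, b) \<in> Ng2" "fst a = v1" "fst b = v3" for a b
      using that e3 dist by (auto simp: Ng2_def res2_def)
    show "(a, b) \<in> Ng1" if "(a, b) \<in> Ng2" "{fst a, fst b} \<noteq> {v1, v3}" for a b
      using that e3 by (auto simp: Ng2_def res2_def)
  qed (auto simp: X2_def res2_def)
  then show ?thesis
  proof (rule occurs_TM_route[OF is_pattern_P _ Ng1(3,1) sub sym Ng1(4,2)])
    show "d \<noteq> v3" "distinct es" "d \<notin> set es" "v3 \<notin> set es" using dist by auto
    show "negroute X Ng es a b" if "(a, b) \<in> Ng1" "fst a = d" "fst b = v3" for a b
      using that e2 dist by (auto simp: Ng1_def res1_def)
    show "(a, b) \<in> Ng" if "(a, b) \<in> Ng1" "{fst a, fst b} \<noteq> {d, v3}" for a b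
      using that e2 by (auto simp: Ng1_def res1_def)
  qed (auto simp: X1_def res1_def)
qed

text \<open>The cycle found in the torso may use the added edge between \<open>u\<close> and
  \<open>w\<close>. It is realised by a path \<open>zs\<close> outside of \<open>A\<close>, along
  which the occurrence is rerouted at the end. With fewer than two neighbours there is no added
  edge, and the cycle already lies in the instance.\<close>

lemma fragment_occurs_TM:
  fixes X :: "('v \<times> 'a) set"
  assumes frag: "minimal_fragment (edges (negE X N)) V A u w" and XV: "fst ` X \<subseteq> V"
    and occ: "occurs_SP P0 (tgt X0 (posE X0 N) (negE X0 N))" and X0: "X0 \<subseteq> X" "fst ` X0 \<subseteq> A"
  shows "occurs_TM P (tgt X (posE X N) (negE X N))"
proof -
  let ?E = "edges (negE X N)"
  interpret minimal_fragment ?E V A u w by fact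
  define B where "B = nbh ?E V A"
  have cyc: "on_cycle (torso ?E V A) (A \<union> B - {v2}) v1 v3"
    if "{v1, v2, v3} \<subseteq> fst ` X0" "distinct [v1, v2, v3]" for v1 v2 v3
    unfolding B_def by (rule torso_cycle) (use that X0(2) in auto)
  have sub: "posE Y N \<subseteq> Y \<times> Y" "negE Y N \<subseteq> Y \<times> Y" for Y :: "('v \<times> 'a) set"
    by (auto simp: posE_def negE_def)
  have mono: "posE X0 N \<subseteq> posE X N" "negE X0 N \<subseteq> negE X N"
    using X0(1) by (auto simp: posE_def negE_def)
  have B: "B \<subseteq> {u, w}" "B \<inter> A = {}" "conn ?E (V - A) u w"
    using fragment_facts by (auto simp: B_def nbh_def)
  show ?thesis
  proof (cases "B = {u, w} \<and> u \<noteq> w")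
    case False
    then have "a = b" if "a \<in> B" "b \<in> B" for a b using B(1) that by blast
    then have "torso ?E V A \<subseteq> ?E" unfolding torso_def B_def by blast
    then have "\<exists>L. v2 \<notin> L \<and> on_cycle ?E L v1 v3"
      if "{v1, v2, v3} \<subseteq> fst ` X0" "distinct [v1, v2, v3]" for v1 v2 v3
      using on_cycle_mono[OF cyc[OF that]] by blast
    then show ?thesis
      using occurs_SP_mono[OF occ order_refl mono]
      by (intro occurs_TM_cycle[OF sub sym_posE sym_negE _ X0(1)])
  next
    case True
    then obtain zs where zs: "distinct (u # zs @ [w])" "set zs \<subseteq> V - A" "linked ?E (u # zs @ [w])"
      using conn_path[OF B(3)] by blast
    define X1 where "X1 = {z \<in> X. fst z \<in> A \<union> B}"
    \<comment> \<open>The virtual edges between \<open>u\<close> and \<open>w\<close>: pairs of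
      points joined by a negative route along \<open>zs\<close>. Real edges between \<open>u\<close>
      and \<open>w\<close> are discarded, as they need not have such a route; the occurrence of
      \<open>P0\<close> lies over \<open>A\<close> and uses none of them.\<close>
    define R where "R = {(a, b). a \<in> X1 \<and> b \<in> X1 \<and> fst a = u \<and> fst b = w \<and> negroute X (negE X N) zs a b}"
    define Ps1 where "Ps1 = {(a, b) \<in> posE X N. a \<in> X1 \<and> b \<in> X1 \<and> {fst a, fst b} \<noteq> {u, w}}"
    define Ng1 where "Ng1 = {(a, b) \<in> negE X N. a \<in> X1 \<and> b \<in> X1 \<and> {fst a, fst b} \<noteq> {u, w}} \<union> R \<union> R\<inverse>"
    have sub1: "Ps1 \<subseteq> X1 \<times> X1" "Ng1 \<subseteq> X1 \<times> X1" by (auto simp: Ps1_def Ng1_def R_def)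
    have sym1: "sym Ps1" "sym Ng1"
      using sym_posE[of X N] sym_negE[of X N]
      by (auto simp: Ps1_def Ng1_def sym_def insert_commute)
    have X01: "X0 \<subseteq> X1" using X0 by (auto simp: X1_def)
    have in_A: "{fst a, fst b} \<noteq> {u, w}" if "a \<in> X0" for a b
      using that X0(2) B True by (auto simp: doubleton_eq_iff)
    have "posE X0 N \<subseteq> Ps1" "negE X0 N \<subseteq> Ng1"
      using mono sub[of X0] X01 in_A by (fastforce simp: Ps1_def Ng1_def)+
    note occ1 = occurs_SP_mono[OF occ order_refl this]
    have "\<exists>a\<in>X. \<exists>b\<in>X. fst a = u \<and> fst b = w \<and> negroute X (negE X N) zs a b"
      by (rule negroute_ex[OF zs(3) sub(2)])
    then obtain a0 b0 where "(a0, b0) \<in> R" "fst a0 = u" "fst b0 = w"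
      using True by (auto simp: R_def X1_def)
    then have uw: "(u, w) \<in> edges Ng1" "(w, u) \<in> edges Ng1"
      using edgesI[of a0 b0 Ng1] edgesI[of b0 a0 Ng1] by (auto simp: Ng1_def)
    have "torso ?E V A \<subseteq> edges Ng1"
    proof
      fix e assume e: "e \<in> torso ?E V A"
      obtain a b where ab: "e = (a, b)" by (cases e)
      show "e \<in> edges Ng1"
      proof (cases "{a, b} = {u, w}")
        case True
        then show ?thesis using uw ab by (auto simp: doubleton_eq_iff)
      next
        case False
        then have "(a, b) \<in> ?E" "a \<in> A \<union> B" "b \<in> A \<union> B"
          using e True unfolding ab torso_def B_def by auto
        then obtain p q where "(p, q) \<in> negE X N" "fst p = a" "fst q = b" by (auto simp: edges_def)
        moreover from this have "(p, q) \<in> Ng1"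
          using False sub(2)[of X] \<open>a \<in> A \<union> B\<close> \<open>b \<in> A \<union> B\<close> by (auto simp: Ng1_def X1_def)
        ultimately show ?thesis using ab edgesI by metis
      qed
    qed
    then have "\<exists>L. v2 \<notin> L \<and> on_cycle (edges Ng1) L v1 v3"
      if "{v1, v2, v3} \<subseteq> fst ` X0" "distinct [v1, v2, v3]" for v1 v2 v3
      using on_cycle_mono[OF cyc[OF that]] by blast
    then have "occurs_TM P (tgt X1 Ps1 Ng1)"
      by (intro occurs_TM_cycle[OF sub1 sym1 occ1 X01])
    then show ?thesis
    proof (rule occurs_TM_route[OF is_pattern_P _ sub1 sub sym_posE sym_negE sym1])
      show "u \<noteq> w" "distinct zs" "u \<notin> set zs" "w \<notin> set zs" using zs(1) by auto
      show "X1 \<subseteq> X" by (auto simp: X1_def)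
      show "fst x \<notin> set zs" if "x \<in> X1" for x using that zs True by (auto simp: X1_def)
      show "(a, b) \<in> posE X N" if "(a, b) \<in> Ps1" for a b using that by (auto simp: Ps1_def)
      show "(a, b) \<in> negE X N" if "(a, b) \<in> Ng1" "{fst a, fst b} \<noteq> {u, w}" for a b
        using that by (auto simp: Ng1_def R_def)
      show "posroute X (posE X N) zs a b" if "(a, b) \<in> Ps1" "fst a = u" "fst b = w" for a b
        using that by (auto simp: Ps1_def)
      show "negroute X (negE X N) zs a b" if "(a, b) \<in> Ng1" "fst a = u" "fst b = w" for a b
        using that True by (auto simp: Ng1_def R_def)
    qed
  qed
qed

end

section \<open>The algorithm\<close>

type_synonym point = "nat \<times> nat"

text \<open>Written with a bounded quantifier over a list, like the other tests below, so that the
  closure properties of polynomial time apply directly.\<close>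

definition ok :: "(point \<times> point) list \<Rightarrow> point \<Rightarrow> point \<Rightarrow> bool" where
  "ok ng p q \<longleftrightarrow> (\<forall>e\<in>set ng. e \<noteq> (p, q) \<and> e \<noteq> (q, p))"

definition adj :: "point list \<Rightarrow> (point \<times> point) list \<Rightarrow> nat \<Rightarrow> nat \<Rightarrow> bool" where
  "adj ps ng u v \<longleftrightarrow> u \<noteq> v \<and> (\<exists>p\<in>set ps. fst p = u \<and> (\<exists>q\<in>set ps. fst q = v \<and> \<not> ok ng p q))"

definition mem :: "nat list \<Rightarrow> nat \<Rightarrow> bool" where
  "mem S v \<longleftrightarrow> (\<exists>s\<in>set S. s = v)"

definition grow :: "nat list \<Rightarrow> point list \<Rightarrow> (point \<times> point) list \<Rightarrow> nat list \<Rightarrow> nat list" where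
  "grow ws ps ng S = filter (\<lambda>v. mem S v \<or> (\<exists>s\<in>set S. adj ps ng s v)) ws"

definition pairs :: "'a list \<Rightarrow> ('a \<times> 'a) list" where
  "pairs xs = concat (map (\<lambda>x. map (\<lambda>y. (x, y)) xs) xs)"

text \<open>The list of pairs is only a counter: a relation on \<open>ws\<close> has at most
  quadratically many pairs, so its closure is reached after that many rounds of growth.\<close>

definition reach :: "nat list \<Rightarrow> point list \<Rightarrow> (point \<times> point) list \<Rightarrow> nat \<Rightarrow> nat list" where
  "reach ws ps ng y = fold (\<lambda>_ S. grow ws ps ng S) (pairs ws) (filter (\<lambda>v. v = y) ws)"

text \<open>A fragment with neighbours among \<open>u\<close> and \<open>w\<close> is a connected
  component of the other vertices, so polynomially many candidates cover all fragments.\<close>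

definition cands :: "nat list \<Rightarrow> point list \<Rightarrow> (point \<times> point) list \<Rightarrow> (nat \<times> nat \<times> nat list) list" where
  "cands vs ps ng = filter (\<lambda>c. snd (snd c) \<noteq> [] \<and>
       mem (reach (filter (\<lambda>v. \<not> mem (snd (snd c)) v) vs) ps ng (fst c)) (fst (snd c)))
     (concat (map (\<lambda>u. concat (map (\<lambda>w. map (\<lambda>y.
        (u, w, reach (filter (\<lambda>v. v \<noteq> u \<and> v \<noteq> w) vs) ps ng y)) vs) vs)) vs))"

definition best :: "nat list \<Rightarrow> point list \<Rightarrow> (point \<times> point) list \<Rightarrow> (nat \<times> nat \<times> nat list) list" where
  "best vs ps ng = filter (\<lambda>c. \<forall>c'\<in>set (cands vs ps ng). length (snd (snd c)) \<le> length (snd (snd c')))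
     (cands vs ps ng)"

definition dom_list :: "point list \<Rightarrow> nat \<Rightarrow> point list" where
  "dom_list ps v = filter (\<lambda>p. fst p = v) ps"

text \<open>Arranged so that its encoding is literally a \<open>table\<close>; the diagonal blocks
  compare values, as the input format demands.\<close>

definition tab :: "nat list \<Rightarrow> point list \<Rightarrow> (point \<times> point) list \<Rightarrow> bool list list list list" where
  "tab vs ps ng = map (\<lambda>u. map (\<lambda>v. map (\<lambda>p. map (\<lambda>q.
     if u = v then snd p = snd q else ok ng p q) (dom_list ps v)) (dom_list ps u)) vs) vs"

text \<open>A state consists of the variables, the points \<open>(v, a)\<close> and the forbidden pairs of points.\<close>

type_synonym state = "nat list \<times> point list \<times> (point \<times> point) list"

text \<open>The parameter \<open>sol\<close> stands for the algorithm that solves the instances without \<open>P0\<close>.\<close>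

definition ext :: "(bool list list list list \<Rightarrow> bool) \<Rightarrow> state \<Rightarrow> nat list \<Rightarrow> point \<Rightarrow> point \<Rightarrow> bool" where
  "ext sol st A p q = sol (tab A
     (filter (\<lambda>r. mem A (fst r) \<and> ok (snd (snd st)) r p \<and> ok (snd (snd st)) r q) (fst (snd st)))
     (snd (snd st)))"

definition elim_ps :: "(bool list list list list \<Rightarrow> bool) \<Rightarrow> state \<Rightarrow> nat \<times> nat \<times> nat list \<Rightarrow> point list" where
  "elim_ps sol st c = filter (\<lambda>p. \<not> mem (snd (snd c)) (fst p) \<and>
     (fst p = fst c \<or> fst p = fst (snd c) \<longrightarrow> ext sol st (snd (snd c)) p p)) (fst (snd st))"

definition elim_ng :: "(bool list list list list \<Rightarrow> bool) \<Rightarrow> state \<Rightarrow> nat \<times> nat \<times> nat list \<Rightarrow> (point \<times> point) list" where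
  "elim_ng sol st c = filter (\<lambda>e. \<not> ok (snd (snd st)) (fst e) (snd e) \<or>
       fst (fst e) = fst c \<and> fst (snd e) = fst (snd c) \<and> \<not> ext sol st (snd (snd c)) (fst e) (snd e))
     (pairs (elim_ps sol st c))"

definition elim_st :: "(bool list list list list \<Rightarrow> bool) \<Rightarrow> state \<Rightarrow> nat \<times> nat \<times> nat list \<Rightarrow> state" where
  "elim_st sol st c =
     (filter (\<lambda>v. \<not> mem (snd (snd c)) v) (fst st), elim_ps sol st c, elim_ng sol st c)"

definition step_st :: "(bool list list list list \<Rightarrow> bool) \<Rightarrow> state \<Rightarrow> state" where
  "step_st sol st = (if best (fst st) (fst (snd st)) (snd (snd st)) \<noteq> []
     then elim_st sol st (hd (best (fst st) (fst (snd st)) (snd (snd st)))) else st)"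

text \<open>Variables and values are renamed to positions in the table. The size of a domain is the
  number of rows of its diagonal block.\<close>

definition init_ps :: "bool list list list list \<Rightarrow> point list" where
  "init_ps t = concat (map (\<lambda>iR. concat (map (\<lambda>jB. if fst iR = fst jB
     then map (\<lambda>ar. (fst iR, fst ar)) (enum (snd jB)) else []) (enum (snd iR)))) (enum t))"

text \<open>The diagonal blocks contribute pairs of points of the same variable, which have no
  effect.\<close>

definition init_ng :: "bool list list list list \<Rightarrow> (point \<times> point) list" where
  "init_ng t = concat (map (\<lambda>iR. concat (map (\<lambda>jB. concat (map (\<lambda>ar. map (\<lambda>bx.
     ((fst iR, fst ar), (fst jB, fst bx))) (filter (\<lambda>bx. \<not> snd bx) (enum (snd ar)))) (enum (snd jB))))
     (enum (snd iR)))) (enum t))"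

definition init_st :: "bool list list list list \<Rightarrow> state" where
  "init_st t = (map fst (enum t), init_ps t, init_ng t)"

text \<open>The list of variables is used as a counter: every round with at least two variables left
  removes some of them, so this many rounds suffice.\<close>

definition final_st :: "(bool list list list list \<Rightarrow> bool) \<Rightarrow> bool list list list list \<Rightarrow> state" where
  "final_st sol t = fold (\<lambda>_ st. step_st sol st) (fst (init_st t)) (init_st t)"

definition solvable_st :: "state \<Rightarrow> bool" where
  "solvable_st st \<longleftrightarrow> (\<forall>v\<in>set (fst st). \<exists>p\<in>set (fst (snd st)). fst p = v)"

section \<open>Correctness of the algorithm\<close>

lemma mem_iff [simp]: "mem S v \<longleftrightarrow> v \<in> set S"
  by (auto simp: mem_def)

lemma ok_iff: "ok ng p q \<longleftrightarrow> allowed (set ng) p q"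
  by (auto simp: ok_def allowed_def)

lemma set_pairs: "set (pairs xs) = set xs \<times> set xs"
  by (auto simp: pairs_def)

lemma adj_iff: "adj ps ng u v \<longleftrightarrow> (u, v) \<in> edges (negE (set ps) (set ng))"
  unfolding adj_def edges_def negE_def ok_iff mem_Collect_eq prod.case prod.inject by blast

lemma length_pairs: "length (pairs xs) = length xs * length xs"
  by (simp add: pairs_def length_concat o_def sum_list_triv)

lemma set_reach:
  assumes "y \<in> set ws"
  shows "set (reach ws ps ng y) = component (edges (negE (set ps) (set ng))) (set ws) y"
proof -
  define R where "R = edges (negE (set ps) (set ng)) \<inter> set ws \<times> set ws"
  have iter: "set (fold (\<lambda>_ S. grow ws ps ng S) xs (filter (\<lambda>v. v = y) ws)) =
      {v. \<exists>j\<le>length xs. (y, v) \<in> R ^^ j}" for xs :: "(nat \<times> nat) list"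
  proof (induction xs rule: rev_induct)
    case Nil
    then show ?case using assms by auto
  next
    case (snoc x xs)
    let ?S = "{v. \<exists>j\<le>length xs. (y, v) \<in> R ^^ j}"
    have sub: "v \<in> set ws" if "(y, v) \<in> R ^^ j" for v j
      using that assms by (cases j) (auto simp: R_def)
    have "set (grow ws ps ng S) = {v \<in> set ws. v \<in> set S \<or> (\<exists>s\<in>set S. (s, v) \<in> edges (negE (set ps) (set ng)))}"
      for S by (auto simp: grow_def adj_iff)
    then have "set (fold (\<lambda>_ S. grow ws ps ng S) (xs @ [x]) (filter (\<lambda>v. v = y) ws)) =
        {v \<in> set ws. v \<in> ?S \<or> (\<exists>s\<in>?S. (s, v) \<in> edges (negE (set ps) (set ng)))}"
      unfolding snoc[symmetric] by simp
    also have "\<dots> = {v. v \<in> ?S \<or> (\<exists>s\<in>?S. (s, v) \<in> R)}"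
      using sub by (auto simp: R_def)
    also have "\<dots> = {v. \<exists>j\<le>length (xs @ [x]). (y, v) \<in> R ^^ j}"
    proof (intro equalityI subsetI; clarify)
      fix v assume "v \<in> ?S \<or> (\<exists>s\<in>?S. (s, v) \<in> R)"
      then show "\<exists>j\<le>length (xs @ [x]). (y, v) \<in> R ^^ j"
      proof
        assume "\<exists>s\<in>?S. (s, v) \<in> R"
        then obtain s j where "j \<le> length xs" "(y, s) \<in> R ^^ j" "(s, v) \<in> R" by auto
        then show ?thesis by (intro exI[of _ "Suc j"]) auto
      qed (auto intro: le_SucI)
    next
      fix v j assume j: "j \<le> length (xs @ [x])" "(y, v) \<in> R ^^ j" "\<not> (\<exists>s\<in>?S. (s, v) \<in> R)"
      show "\<exists>j\<le>length xs. (y, v) \<in> R ^^ j"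
      proof (cases "j = Suc (length xs)")
        case True
        then obtain s where "(y, s) \<in> R ^^ length xs" "(s, v) \<in> R" using j(2) by auto
        with j(3) show ?thesis by blast
      next
        case False
        then have "j \<le> length xs" using j(1) by simp
        with j(2) show ?thesis by blast
      qed
    qed
    finally show ?case .
  qed
  have fin: "finite R" by (auto simp: R_def)
  have "R \<subseteq> set ws \<times> set ws" by (auto simp: R_def)
  then have "card R \<le> card (set ws \<times> set ws)" by (intro card_mono) auto
  also have "\<dots> \<le> length (pairs ws)"
    by (simp add: card_cartesian_product length_pairs card_length mult_le_mono)
  finally have card: "card R \<le> length (pairs ws)" .
  have "R\<^sup>* = (\<Union>n\<in>{n. n \<le> card R}. R ^^ n)" by (rule rtrancl_finite_eq_relpow[OF fin])
  then have "{v. \<exists>j\<le>length (pairs ws). (y, v) \<in> R ^^ j} = {v. (y, v) \<in> R\<^sup>*}"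
    using card by (auto intro: relpow_imp_rtrancl) (meson order_trans)
  also have "\<dots> = component (edges (negE (set ps) (set ng))) (set ws) y"
  proof -
    have "v \<in> set ws" if "(y, v) \<in> R\<^sup>*" for v
      using that assms by (induction rule: rtrancl_induct) (auto simp: R_def)
    then show ?thesis using assms by (auto simp: component_def conn_def R_def)
  qed
  finally show ?thesis unfolding reach_def iter .
qed

lemma reach_empty: "y \<notin> set ws \<Longrightarrow> reach ws ps ng y = []"
proof -
  assume y: "y \<notin> set ws"
  have "fold (\<lambda>_ S. grow ws ps ng S) xs [] = []" for xs :: "(nat \<times> nat) list"
    by (induction xs) (auto simp: grow_def)
  moreover have "filter (\<lambda>v. v = y) ws = []" using y by (auto simp: filter_empty_conv)
  ultimately show ?thesis by (simp add: reach_def)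
qed

text \<open>As a sublist of \<open>ws\<close> the result has no repetitions if \<open>ws\<close> has
  none, so that comparing lengths amounts to comparing cardinalities.\<close>

lemma reach_filter: "\<exists>Q. reach ws ps ng y = filter Q ws"
proof -
  have "\<exists>Q. fold (\<lambda>_ S. grow ws ps ng S) xs (filter (\<lambda>v. v = y) ws) = filter Q ws" for xs :: "(nat \<times> nat) list"
    by (induction xs rule: rev_induct) (auto simp: grow_def)
  then show ?thesis by (simp add: reach_def)
qed

lemma mem_cands:
  "(u, w, A) \<in> set (cands vs ps ng) \<longleftrightarrow> u \<in> set vs \<and> w \<in> set vs \<and> A \<noteq> [] \<and>
     w \<in> set (reach (filter (\<lambda>v. v \<notin> set A) vs) ps ng u) \<and>
     (\<exists>y\<in>set vs. A = reach (filter (\<lambda>v. v \<noteq> u \<and> v \<noteq> w) vs) ps ng y)"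
  unfolding cands_def by auto

lemma cands_fragment:
  assumes "(u, w, A) \<in> set (cands vs ps ng)"
  defines "E \<equiv> edges (negE (set ps) (set ng))"
  shows "fragment E (set vs) (set A) u w"
proof -
  have sym: "sym E" unfolding E_def by (intro sym_edges sym_negE)
  let ?W = "set vs - {u, w}" and ?ws = "filter (\<lambda>v. v \<noteq> u \<and> v \<noteq> w) vs"
  obtain y where y: "u \<in> set vs" "w \<in> set vs" "A \<noteq> []" "A = reach ?ws ps ng y"
    "w \<in> set (reach (filter (\<lambda>v. v \<notin> set A) vs) ps ng u)"
    using assms(1) unfolding mem_cands by blast
  have W: "set ?ws = ?W" by auto
  have yW: "y \<in> set ?ws" using y(3,4) reach_empty by blast
  then have A: "set A = component E ?W y" using set_reach[OF yW] y(4) W by (simp add: E_def)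
  have AW: "set A \<subseteq> ?W" unfolding A by (rule component_sub)
  have "nbh E (set vs) (set A) \<subseteq> {u, w}"
  proof
    fix z assume "z \<in> nbh E (set vs) (set A)"
    then obtain x where "x \<in> set A" "(x, z) \<in> E" "z \<in> set vs" "z \<notin> set A" by (auto simp: nbh_def)
    then show "z \<in> {u, w}" using component_closed[of x E ?W y z] A by auto
  qed
  moreover have "u \<in> set (filter (\<lambda>v. v \<notin> set A) vs)" using AW y(1) by auto
  from set_reach[OF this, of ps ng] y(5) have "conn E (set vs - set A) u w"
    by (simp add: component_def E_def set_diff_eq)
  ultimately show ?thesis
    using y(1-3) AW connected_component[OF sym, of ?W y] A by (auto simp: fragment_def)
qed

text \<open>A connected set with neighbours among \<open>u\<close> and \<open>w\<close> cannot be
  left once these two are deleted, so it is the component of each of its vertices.\<close>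

lemma fragment_cands:
  assumes frag: "fragment (edges (negE (set ps) (set ng))) (set vs) B u w"
  shows "\<exists>A. (u, w, A) \<in> set (cands vs ps ng) \<and> set A = B"
proof -
  let ?E = "edges (negE (set ps) (set ng))"
  let ?ws = "filter (\<lambda>v. v \<noteq> u \<and> v \<noteq> w) vs"
  have sym: "sym ?E" by (intro sym_edges sym_negE)
  have B: "B \<noteq> {}" "B \<subseteq> set vs" "connected ?E B" "u \<in> set vs - B" "w \<in> set vs - B"
    "nbh ?E (set vs) B \<subseteq> {u, w}" "conn ?E (set vs - B) u w"
    using frag by (auto simp: fragment_def)
  obtain y where y: "y \<in> B" using B(1) by auto
  define A where "A = reach ?ws ps ng y"
  have yW: "y \<in> set ?ws" using y B by auto
  have AB: "set A = B"
  proof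
    show "B \<subseteq> set A"
    proof
      fix z assume "z \<in> B"
      then have "conn ?E B y z" using B(3) y by (auto simp: connected_def)
      then have "conn ?E (set ?ws) y z" by (rule conn_mono) (use B in auto)
      then show "z \<in> set A" unfolding A_def set_reach[OF yW] by (simp add: component_def)
    qed
    have "z \<in> B" if "conn ?E (set ?ws) y z" for z
      using that
    proof (induction rule: conn_induct)
      case (step x z)
      show ?case
      proof (rule ccontr)
        assume "z \<notin> B"
        then have "z \<in> nbh ?E (set vs) B" using step by (auto simp: nbh_def)
        then show False using B(6) step(3) by auto
      qed
    qed (rule y)
    then show "set A \<subseteq> B" unfolding A_def set_reach[OF yW] by (auto simp: component_def)
  qed
  have "w \<in> set (reach (filter (\<lambda>v. v \<notin> set A) vs) ps ng u)"
    using set_reach[of u "filter (\<lambda>v. v \<notin> set A) vs" ps ng] B(4,7) AB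
    by (simp add: component_def set_diff_eq)
  moreover have "A \<noteq> []" using AB B(1) by auto
  ultimately have "(u, w, A) \<in> set (cands vs ps ng)"
    unfolding mem_cands using B A_def y by auto
  with AB show ?thesis by blast
qed

text \<open>Every fragment occurs among the candidates, also those with other boundary vertices, so
  a shortest candidate has no fragment as a proper subset.\<close>

lemma best_minimal:
  assumes "distinct vs" "(u, w, A) \<in> set (best vs ps ng)"
  shows "minimal_fragment (edges (negE (set ps) (set ng))) (set vs) (set A) u w"
proof
  show "sym (edges (negE (set ps) (set ng)))" by (intro sym_edges sym_negE)
  have c: "(u, w, A) \<in> set (cands vs ps ng)" using assms(2) by (simp add: best_def)
  then show "fragment (edges (negE (set ps) (set ng))) (set vs) (set A) u w" by (rule cands_fragment)
  have len: "length A' = card (set A')" if c': "(u', w', A') \<in> set (cands vs ps ng)" for u' w' A'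
  proof -
    obtain y where "A' = reach (filter (\<lambda>v. v \<noteq> u' \<and> v \<noteq> w') vs) ps ng y"
      using c' unfolding mem_cands by blast
    then have "distinct A'" using reach_filter assms(1) by (metis distinct_filter)
    then show ?thesis by (simp add: distinct_card)
  qed
  fix B u' w' assume B: "B \<subset> set A"
  show "\<not> fragment (edges (negE (set ps) (set ng))) (set vs) B u' w'"
  proof
    assume "fragment (edges (negE (set ps) (set ng))) (set vs) B u' w'"
    then obtain A' where A': "(u', w', A') \<in> set (cands vs ps ng)" "set A' = B"
      using fragment_cands by blast
    then have "length A \<le> length A'" using assms(2) by (force simp: best_def)
    moreover have "card B < card (set A)" using B by (simp add: psubset_card_mono)
    ultimately show False using len[OF A'(1)] len[OF c] A'(2) by simp
  qed
qed

text \<open>A component of what remains after deleting a vertex \<open>u\<close> is a fragment with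
  both boundary vertices equal to \<open>u\<close>; the graph need not be connected. Hence the
  elimination can only get stuck when at most one variable is left.\<close>

lemma best_nonempty:
  assumes "distinct vs" "length vs \<ge> 2"
  shows "best vs ps ng \<noteq> []"
proof -
  obtain u y zs where vs: "vs = u # y # zs" using assms(2) by (metis Suc_le_length_iff numeral_2_eq_2)
  let ?E = "edges (negE (set ps) (set ng))" and ?W = "set vs - {u}"
  have sym: "sym ?E" by (intro sym_edges sym_negE)
  have y: "y \<in> ?W" using assms(1) vs by auto
  have "nbh ?E (set vs) (component ?E ?W y) \<subseteq> {u, u}"
  proof
    fix z assume "z \<in> nbh ?E (set vs) (component ?E ?W y)"
    then obtain x where "x \<in> component ?E ?W y" "(x, z) \<in> ?E" "z \<in> set vs" "z \<notin> component ?E ?W y"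
      by (auto simp: nbh_def)
    then show "z \<in> {u, u}" using component_closed[of x ?E ?W y z] by auto
  qed
  then have "fragment ?E (set vs) (component ?E ?W y) u u"
    unfolding fragment_def
  proof (intro conjI)
    show "component ?E ?W y \<noteq> {}" using component_self[OF y] by blast
    show "connected ?E (component ?E ?W y)" by (rule connected_component[OF sym])
    show "component ?E ?W y \<subseteq> set vs" "u \<in> set vs - component ?E ?W y" "u \<in> set vs - component ?E ?W y"
      and "conn ?E (set vs - component ?E ?W y) u u"
      using component_sub[of ?E ?W y] vs by (auto intro!: conn_refl)
  qed
  then have ne: "cands vs ps ng \<noteq> []" using fragment_cands by fastforce
  let ?f = "\<lambda>c :: nat \<times> nat \<times> nat list. length (snd (snd c))"
  obtain c where "is_arg_min ?f (\<lambda>c. c \<in> set (cands vs ps ng)) c"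
    using ne ex_is_arg_min_if_finite[of "set (cands vs ps ng)" ?f] by auto
  then have "c \<in> set (cands vs ps ng)" "\<forall>c'\<in>set (cands vs ps ng). ?f c \<le> ?f c'"
    unfolding is_arg_min_linorder by blast+
  then have "\<exists>c\<in>set (cands vs ps ng). \<forall>c'\<in>set (cands vs ps ng). ?f c \<le> ?f c'" by blast
  then show ?thesis by (auto simp: best_def filter_empty_conv)
qed

lemma encode_tab:
  "encode (tab vs ps ng) = table (net (set vs) (set ps) (set ng)) vs (\<lambda>v. map snd (dom_list ps v))"
proof -
  have bit: "ok ng p q \<longleftrightarrow> (snd p, snd q) \<in> rel (net (set vs) (set ps) (set ng)) u v"
    if "p \<in> set (dom_list ps u)" "q \<in> set (dom_list ps v)" for p q u v
  proof -
    have "p \<in> set ps" "fst p = u" "q \<in> set ps" "fst q = v" using that by (auto simp: dom_list_def)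
    then show ?thesis by (cases p; cases q) (auto simp: net_def ok_iff)
  qed
  show ?thesis
    unfolding tab_def table_def encode_list_def encode_bool_def map_map o_def
    by (intro arg_cong[where f = list_tree] map_cong refl) (simp add: bit)
qed

lemma encodes_tab:
  assumes "distinct vs" "distinct ps"
  shows "encodes (encode (tab vs ps ng)) (net (set vs) (set ps) (set ng))"
  unfolding encodes_def
proof (intro exI conjI ballI)
  show "distinct vs" by fact
  show "encode (tab vs ps ng) = table (net (set vs) (set ps) (set ng)) vs (\<lambda>v. map snd (dom_list ps v))"
    by (rule encode_tab)
  fix v
  show "distinct (map snd (dom_list ps v))"
    using assms(2) by (auto simp: dom_list_def distinct_map inj_on_def)
  show "set (map snd (dom_list ps v)) = dmn (net (set vs) (set ps) (set ng)) v"
    by (force simp: dom_list_def net_def)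
qed (simp add: net_def)

definition solvable :: "state \<Rightarrow> bool" where
  "solvable st \<longleftrightarrow> (\<exists>s. solves (set (fst (snd st))) (set (snd (snd st))) (set (fst st)) s)"

context extended_pattern
begin

text \<open>Invariant of the elimination; excluding \<open>P\<close> is what keeps every call of the
  solver for \<open>P0\<close> inside its promise.\<close>

definition avoids :: "state \<Rightarrow> bool" where
  "avoids st \<longleftrightarrow> distinct (fst st) \<and> distinct (fst (snd st)) \<and> fst ` set (fst (snd st)) \<subseteq> set (fst st) \<and>
     \<not> occurs_TM P (tgt (set (fst (snd st))) (posE (set (fst (snd st))) (set (snd (snd st))))
       (negE (set (fst (snd st))) (set (snd (snd st)))))"

text \<open>The instances handed to the solver live on a minimal fragment, where an occurrence of
  \<open>P0\<close> would yield \<open>P\<close> as a topological minor.\<close>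

lemma sub_instance:
  assumes "avoids (vs, ps, ng)" "(u, w, A) \<in> set (best vs ps ng)"
    and "qs = filter (\<lambda>r. mem A (fst r) \<and> ok ng r p \<and> ok ng r q) ps"
  shows "net (set A) (set qs) (set ng) \<in> CSP_SP P0"
    and "encodes (encode (tab A qs ng)) (net (set A) (set qs) (set ng))"
proof -
  have qs: "set qs \<subseteq> set ps" "fst ` set qs \<subseteq> set A" "distinct qs"
    using assms(1) unfolding assms(3) by (auto simp: avoids_def)
  have vs: "distinct vs" "fst ` set ps \<subseteq> set vs" using assms(1) by (auto simp: avoids_def)
  have "\<not> occurs_SP P0 (tgt (set qs) (posE (set qs) (set ng)) (negE (set qs) (set ng)))"
    using fragment_occurs_TM[OF best_minimal[OF vs(1) assms(2)] vs(2) _ qs(1,2)] assms(1)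
    by (auto simp: avoids_def)
  then show "net (set A) (set qs) (set ng) \<in> CSP_SP P0"
    by (simp add: CSP_SP_def is_instance_net pattern_of_net[OF qs(2)])
  have "(u, w, A) \<in> set (cands vs ps ng)" using assms(2) by (simp add: best_def)
  then obtain y where "A = reach (filter (\<lambda>v. v \<noteq> u \<and> v \<noteq> w) vs) ps ng y"
    unfolding mem_cands by blast
  then have "distinct A" using reach_filter vs(1) by (metis distinct_filter)
  then show "encodes (encode (tab A qs ng)) (net (set A) (set qs) (set ng))"
    using qs(3) by (rule encodes_tab)
qed

end

locale P0_solver = extended_pattern P0 P for P0 P :: "'x pattern" +
  fixes sol :: "bool list list list list \<Rightarrow> bool"
  assumes sol: "\<And>I t. I \<in> CSP_SP P0 \<Longrightarrow> encodes (encode t) I \<Longrightarrow> sol t \<longleftrightarrow> (\<exists>s. is_solution I s)"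
begin

lemma ext_iff:
  assumes "avoids st" "(u, w, A) \<in> set (best (fst st) (fst (snd st)) (snd (snd st)))"
  shows "ext sol st A p q \<longleftrightarrow> extends (set (fst (snd st))) (set (snd (snd st))) (set A) p q"
proof -
  obtain vs ps ng where st: "st = (vs, ps, ng)" by (cases st)
  define qs where "qs = filter (\<lambda>r. mem A (fst r) \<and> ok ng r p \<and> ok ng r q) ps"
  note sub = sub_instance[OF assms[unfolded st fst_conv snd_conv] qs_def]
  have "ext sol st A p q \<longleftrightarrow> (\<exists>s. solves (set qs) (set ng) (set A) s)"
    unfolding ext_def st fst_conv snd_conv qs_def[symmetric] sol[OF sub] is_solution_net ..
  also have "\<dots> \<longleftrightarrow> extends (set ps) (set ng) (set A) p q"
    by (auto simp: extends_def solves_def qs_def ok_iff)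
  finally show ?thesis by (simp add: st)
qed

lemma elim_st_sets:
  assumes "avoids st" "c \<in> set (best (fst st) (fst (snd st)) (snd (snd st)))" "c = (u, w, A)"
  defines "X \<equiv> set (fst (snd st))" and "N \<equiv> set (snd (snd st))"
  shows "set (fst (elim_st sol st c)) = set (fst st) - set A"
    and "set (fst (snd (elim_st sol st c))) = elim_pts X N (set A) u w"
    and "set (snd (snd (elim_st sol st c))) = elim_neg X N (set A) u w"
proof -
  have ext: "ext sol st A p q \<longleftrightarrow> extends X N (set A) p q" for p q
    using ext_iff assms unfolding X_def N_def by blast
  show "set (fst (elim_st sol st c)) = set (fst st) - set A"
    by (auto simp: elim_st_def assms(3))
  have ps: "set (elim_ps sol st c) = elim_pts X N (set A) u w"
    by (auto simp: elim_ps_def elim_pts_def assms(3) ext X_def)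
  then show "set (fst (snd (elim_st sol st c))) = elim_pts X N (set A) u w"
    by (simp add: elim_st_def)
  show "set (snd (snd (elim_st sol st c))) = elim_neg X N (set A) u w"
    by (auto simp: elim_st_def elim_ng_def elim_neg_def set_pairs ps[unfolded assms(3)] assms(3) ext ok_iff N_def)
qed

lemma step_st:
  assumes "avoids st"
  shows "avoids (step_st sol st)" "solvable (step_st sol st) \<longleftrightarrow> solvable st"
    and "length (fst st) \<ge> 2 \<Longrightarrow> length (fst (step_st sol st)) < length (fst st)"
    and "length (fst (step_st sol st)) \<le> length (fst st)"
proof -
  obtain vs ps ng where st: "st = (vs, ps, ng)" by (cases st)
  let ?goal = "avoids (step_st sol st) \<and> (solvable (step_st sol st) \<longleftrightarrow> solvable st) \<and>
    (length vs \<ge> 2 \<longrightarrow> length (fst (step_st sol st)) < length vs) \<and>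
    length (fst (step_st sol st)) \<le> length vs"
  have vs: "distinct vs" "distinct ps" "fst ` set ps \<subseteq> set vs"
    using assms by (auto simp: avoids_def st)
  have ?goal
  proof (cases "best vs ps ng = []")
    case True
    then show ?thesis
      using assms best_nonempty[OF vs(1), of ps ng] by (auto simp: step_st_def st)
  next
    case False
    define c where "c = hd (best vs ps ng)"
    have c: "c \<in> set (best vs ps ng)" using False by (simp add: c_def)
    obtain u w A where uwA: "c = (u, w, A)" by (cases c)
    have step: "step_st sol st = elim_st sol st c" using False by (simp add: step_st_def st c_def)
    interpret minimal_fragment "edges (negE (set ps) (set ng))" "set vs" "set A" u w
      using best_minimal[OF vs(1)] c uwA by blast
    have frag: "set A \<noteq> {}" "set A \<subseteq> set vs" "connected (edges (negE (set ps) (set ng))) (set A)"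
      "u \<in> set vs - set A" "w \<in> set vs - set A" "nbh (edges (negE (set ps) (set ng))) (set vs) (set A) \<subseteq> {u, w}"
      using fragment by (auto simp: fragment_def)
    note sets = elim_st_sets[OF assms _ uwA, unfolded st fst_conv snd_conv, OF c]
    have "solvable (step_st sol st) \<longleftrightarrow> solvable st"
      unfolding solvable_def step unfolding st sets fst_conv snd_conv
      using elim_solvable[OF frag(4,5,2,6)] by simp
    moreover have "avoids (step_st sol st)"
      unfolding avoids_def step
    proof (intro conjI)
      show "distinct (fst (elim_st sol st c))" using vs by (simp add: elim_st_def st)
      show "distinct (fst (snd (elim_st sol st c)))" using vs by (simp add: elim_st_def elim_ps_def st)
      show "fst ` set (fst (snd (elim_st sol st c))) \<subseteq> set (fst (elim_st sol st c))"
        unfolding st sets using vs(3) by (auto simp: elim_pts_def)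
      show "\<not> occurs_TM P (tgt (set (fst (snd (elim_st sol st c))))
          (posE (set (fst (snd (elim_st sol st c)))) (set (snd (snd (elim_st sol st c)))))
          (negE (set (fst (snd (elim_st sol st c)))) (set (snd (snd (elim_st sol st c))))))"
        unfolding st sets
        using elim_occurs_TM[OF is_pattern_P single_neg_P frag(3)] assms by (auto simp: avoids_def st)
    qed
    moreover have "hd A \<in> set A" using frag(1) by simp
    then have "length (fst (step_st sol st)) < length vs"
      unfolding step unfolding elim_st_def st uwA
      using length_filter_less[of "hd A" vs "\<lambda>v. v \<notin> set A"] frag(2) by auto
    ultimately show ?thesis by simp
  qed
  then show "avoids (step_st sol st)" "solvable (step_st sol st) \<longleftrightarrow> solvable st"
    "length (fst st) \<ge> 2 \<Longrightarrow> length (fst (step_st sol st)) < length (fst st)"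
    "length (fst (step_st sol st)) \<le> length (fst st)"
    by (simp_all add: st)
qed

lemma solvable_st_iff:
  assumes "length (fst st) \<le> 1"
  shows "solvable_st st \<longleftrightarrow> solvable st"
proof -
  obtain vs ps ng where st: "st = (vs, ps, ng)" by (cases st)
  from assms consider "vs = []" | v where "vs = [v]"
    by (cases vs) (auto simp: st)
  then show ?thesis
    by cases (force simp: solvable_st_def solvable_def solves_def st)+
qed

lemma final_st:
  assumes "avoids (init_st t)"
  shows "solvable_st (final_st sol t) \<longleftrightarrow> solvable (init_st t)"
proof -
  \<comment> \<open>The maximum with 1 accounts for the rounds that need not change anything once at
    most one variable is left.\<close>
  have iter: "avoids (fold (\<lambda>_ st. step_st sol st) xs st) \<and>
      (solvable (fold (\<lambda>_ st. step_st sol st) xs st) \<longleftrightarrow> solvable st) \<and>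
      (length (fst (fold (\<lambda>_ st. step_st sol st) xs st)) \<le> max 1 (length (fst st) - length xs))"
    if "avoids st" for xs :: "nat list" and st
    using that
  proof (induction xs arbitrary: st)
    case (Cons x xs)
    show ?case
      using Cons.IH[OF step_st(1)[OF Cons.prems]] step_st(2-4)[OF Cons.prems] by fastforce
  qed auto
  from iter[OF assms, of "fst (init_st t)"] solvable_st_iff[of "final_st sol t"] show ?thesis
    by (simp add: final_st_def)
qed

end

section \<open>Reading the input\<close>

lemma mem_enum: "z \<in> set (enum xs) \<longleftrightarrow> fst z < length xs \<and> snd z = xs ! fst z"
  by (auto simp: enum_def in_set_zip intro: exI[of _ "fst z"])

lemma mem_map_enum:
  "x \<in> set (concat (map f (enum xs))) \<longleftrightarrow> (\<exists>i<length xs. x \<in> set (f (i, xs ! i)))"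
  "y \<in> set (map g (filter Q (enum xs))) \<longleftrightarrow> (\<exists>i<length xs. Q (i, xs ! i) \<and> y = g (i, xs ! i))"
  "y \<in> set (map g (enum xs)) \<longleftrightarrow> (\<exists>i<length xs. y = g (i, xs ! i))"
  by (force simp: mem_enum)+

lemma distinct_enum: "distinct (enum xs)"
  by (simp add: enum_def distinct_zipI1)

lemma distinct_concat_map:
  assumes "distinct xs" "\<And>x. x \<in> set xs \<Longrightarrow> distinct (f x)"
    and "\<And>x y. x \<in> set xs \<Longrightarrow> y \<in> set xs \<Longrightarrow> x \<noteq> y \<Longrightarrow> set (f x) \<inter> set (f y) = {}"
  shows "distinct (concat (map f xs))"
  using assms
proof (induction xs)
  case (Cons x xs)
  have "set (f x) \<inter> set (f y) = {}" if "y \<in> set xs" for y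
    using Cons.prems(3)[of x y] Cons.prems(1) that by auto
  then show ?case using Cons by auto
qed simp

lemma distinct_init_ps: "distinct (init_ps t)"
  unfolding init_ps_def
proof (intro distinct_concat_map distinct_enum, goal_cases)
  case (1 x y)
  have "inj_on (\<lambda>ar. (fst x, fst ar)) (set (enum (snd y)))"
    by (auto simp: inj_on_def mem_enum prod_eq_iff)
  then show ?case using distinct_enum[of "snd y"] by (cases "fst x = fst y") (simp_all add: distinct_map)
next
  case (2 x y z)
  then have "fst y \<noteq> fst z" by (auto simp: mem_enum prod_eq_iff)
  then show ?case by auto
next
  case (3 x y)
  then have "fst x \<noteq> fst y" by (auto simp: mem_enum prod_eq_iff)
  then show ?case by auto
qed

lemma mem_init_ps:
  "(i, a) \<in> set (init_ps t) \<longleftrightarrow> i < length t \<and> i < length (t ! i) \<and> a < length (t ! i ! i)"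
proof -
  have if_set: "x \<in> set (if b then xs else []) \<longleftrightarrow> b \<and> x \<in> set xs" for b and xs :: "point list" and x
    by simp
  show ?thesis unfolding init_ps_def mem_map_enum if_set fst_conv snd_conv prod.inject by auto
qed

lemma mem_init_ng:
  "((i, a), (j, b)) \<in> set (init_ng t) \<longleftrightarrow> i < length t \<and> j < length (t ! i) \<and>
     a < length (t ! i ! j) \<and> b < length (t ! i ! j ! a) \<and> \<not> t ! i ! j ! a ! b"
  unfolding init_ng_def mem_map_enum by auto

lemma occurs_TM_hom:
  assumes "occurs_TM P Q" "pattern_hom g Q Q'" "preserves_parts g Q Q'"
  shows "occurs_TM P Q'"
proof -
  obtain S h where S: "subdivision P S" "pattern_hom h S Q" "preserves_parts h S Q"
    using assms(1) by (auto simp: occurs_TM_def occurs_SP_def)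
  have "pattern_hom (g \<circ> h) S Q'"
    using S(2) assms(2) unfolding pattern_hom_def by (fastforce simp: image_subset_iff)
  moreover have "preserves_parts (g \<circ> h) S Q'"
    using S(2,3) assms(3) unfolding preserves_parts_def pattern_hom_def by (simp add: image_subset_iff)
  ultimately show ?thesis using S(1) by (auto simp: occurs_TM_def occurs_SP_def)
qed

locale table_input =
  fixes I :: "(nat, nat) csp" and vs :: "nat list" and ds :: "nat \<Rightarrow> nat list"
  assumes inst: "is_instance I" and vs: "distinct vs" "set vs = vars I"
    and ds: "\<And>v. v \<in> vars I \<Longrightarrow> distinct (ds v) \<and> set (ds v) = dmn I v"
begin

definition t :: "bool list list list list" where
  "t = map (\<lambda>u. map (\<lambda>v. map (\<lambda>a. map (\<lambda>b. if u = v then a = b else (a, b) \<in> rel I u v) (ds v)) (ds u)) vs) vs"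

lemma encode_t: "encode t = table I vs ds"
  unfolding t_def table_def encode_list_def encode_bool_def map_map o_def ..

abbreviation "X \<equiv> set (init_ps t)"
abbreviation "N \<equiv> set (init_ng t)"

text \<open>Translates positions in the table back to points of \<open>I\<close>. Parts are
  preserved since \<open>vs\<close> has no repetitions.\<close>

definition point where "point p = (vs ! fst p, ds (vs ! fst p) ! snd p)"

lemma mem_X: "p \<in> X \<longleftrightarrow> fst p < length vs \<and> snd p < length (ds (vs ! fst p))"
  by (cases p) (auto simp: mem_init_ps t_def)

lemma point_X:
  assumes "p \<in> X"
  shows "vs ! fst p \<in> vars I" "ds (vs ! fst p) ! snd p \<in> dmn I (vs ! fst p)"
proof -
  show "vs ! fst p \<in> vars I" using assms vs(2) nth_mem unfolding mem_X by blast
  then show "ds (vs ! fst p) ! snd p \<in> dmn I (vs ! fst p)"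
    using ds assms nth_mem unfolding mem_X by blast
qed

lemma mem_N:
  assumes "p \<in> X" "q \<in> X" "fst p \<noteq> fst q"
  shows "(p, q) \<in> N \<longleftrightarrow> (snd (point p), snd (point q)) \<notin> rel I (fst (point p)) (fst (point q))"
proof -
  obtain i a j b where pq: "p = (i, a)" "q = (j, b)" by (cases p; cases q)
  have "i < length vs" "a < length (ds (vs ! i))" "j < length vs" "b < length (ds (vs ! j))"
    using assms(1,2) unfolding mem_X pq by auto
  moreover have "vs ! i \<noteq> vs ! j" using assms(3) calculation vs(1) by (simp add: pq nth_eq_iff_index_eq)
  ultimately show ?thesis
    unfolding pq mem_init_ng by (simp add: t_def point_def)
qed

lemma allowed_N:
  assumes "p \<in> X" "q \<in> X" "fst p \<noteq> fst q"
  shows "allowed N p q \<longleftrightarrow> (snd (point p), snd (point q)) \<in> rel I (fst (point p)) (fst (point q))"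
proof -
  have "fst (point p) \<noteq> fst (point q)"
    using assms vs(1) by (auto simp: mem_X point_def nth_eq_iff_index_eq)
  moreover have "fst (point p) \<in> vars I" "fst (point q) \<in> vars I"
    using point_X(1)[OF assms(1)] point_X(1)[OF assms(2)] by (simp_all add: point_def)
  ultimately have "rel I (fst (point q)) (fst (point p)) = (rel I (fst (point p)) (fst (point q)))\<inverse>"
    using inst unfolding is_instance_def by blast
  then have "(snd (point q), snd (point p)) \<in> rel I (fst (point q)) (fst (point p)) \<longleftrightarrow>
      (snd (point p), snd (point q)) \<in> rel I (fst (point p)) (fst (point q))" by blast
  then show ?thesis
    using mem_N[OF assms] mem_N[OF assms(2,1) not_sym[OF assms(3)]] unfolding allowed_def by argo
qed

lemma occurs_TM_point:
  assumes "occurs_TM P (tgt X (posE X N) (negE X N))"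
  shows "occurs_TM P (pattern_of I)"
proof (rule occurs_TM_hom[OF assms, of point])
  have mem: "point p \<in> pts (pattern_of I)" if "p \<in> X" for p
    using point_X[OF that] by (auto simp: pattern_of_def point_def)
  have neq: "fst (point p) \<noteq> fst (point q)" if "p \<in> X" "q \<in> X" "fst p \<noteq> fst q" for p q
    using that vs(1) by (auto simp: mem_X point_def nth_eq_iff_index_eq)
  have eq: "fst (point p) = fst (point q)" if "fst p = fst q" for p q
    using that by (simp add: point_def)
  have pat: "(x, y) \<in> same (pattern_of I) \<longleftrightarrow> fst x = fst y"
    "(x, y) \<in> pos (pattern_of I) \<longleftrightarrow> fst x \<noteq> fst y \<and> (snd x, snd y) \<in> rel I (fst x) (fst y)"
    "(x, y) \<in> neg (pattern_of I) \<longleftrightarrow> fst x \<noteq> fst y \<and> (snd x, snd y) \<notin> rel I (fst x) (fst y)"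
    if "x \<in> pts (pattern_of I)" "y \<in> pts (pattern_of I)" for x y
    using that by (auto simp: pattern_of_def)
  show "pattern_hom point (tgt X (posE X N) (negE X N)) (pattern_of I)"
    unfolding pattern_hom_def
  proof (intro conjI)
    show "point ` pts (tgt X (posE X N) (negE X N)) \<subseteq> pts (pattern_of I)"
      using mem by (auto simp: tgt_def)
    show "\<forall>(x, y)\<in>same (tgt X (posE X N) (negE X N)). (point x, point y) \<in> same (pattern_of I)"
    proof clarify
      fix i a j b assume "((i, a), (j, b)) \<in> same (tgt X (posE X N) (negE X N))"
      then have X: "(i, a) \<in> X" "(j, b) \<in> X" and "fst (i, a) = fst (j, b)" by (auto simp: tgt_def)
      then show "(point (i, a), point (j, b)) \<in> same (pattern_of I)"
        unfolding pat(1)[OF mem[OF X(1)] mem[OF X(2)]] by (intro eq)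
    qed
    show "\<forall>(x, y)\<in>pos (tgt X (posE X N) (negE X N)). (point x, point y) \<in> pos (pattern_of I)"
    proof clarify
      fix i a j b assume "((i, a), (j, b)) \<in> pos (tgt X (posE X N) (negE X N))"
      then have X: "(i, a) \<in> X" "(j, b) \<in> X" "fst (i, a) \<noteq> fst (j, b)" and "allowed N (i, a) (j, b)"
        by (auto simp: tgt_def posE_def)
      then show "(point (i, a), point (j, b)) \<in> pos (pattern_of I)"
        unfolding pat(2)[OF mem[OF X(1)] mem[OF X(2)]] allowed_N[OF X] using neq[OF X] by blast
    qed
    show "\<forall>(x, y)\<in>neg (tgt X (posE X N) (negE X N)). (point x, point y) \<in> neg (pattern_of I)"
    proof clarify
      fix i a j b assume "((i, a), (j, b)) \<in> neg (tgt X (posE X N) (negE X N))"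
      then have X: "(i, a) \<in> X" "(j, b) \<in> X" "fst (i, a) \<noteq> fst (j, b)" and "\<not> allowed N (i, a) (j, b)"
        by (auto simp: tgt_def negE_def)
      then show "(point (i, a), point (j, b)) \<in> neg (pattern_of I)"
        unfolding pat(3)[OF mem[OF X(1)] mem[OF X(2)]] allowed_N[OF X] using neq[OF X] by blast
    qed
  qed
  show "preserves_parts point (tgt X (posE X N) (negE X N)) (pattern_of I)"
    unfolding preserves_parts_def
  proof (intro ballI impI)
    fix x y assume "x \<in> pts (tgt X (posE X N) (negE X N))" "y \<in> pts (tgt X (posE X N) (negE X N))"
      "(x, y) \<notin> same (tgt X (posE X N) (negE X N))"
    then have X: "x \<in> X" "y \<in> X" "fst x \<noteq> fst y" by (auto simp: tgt_def)
    then show "(point x, point y) \<notin> same (pattern_of I)"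
      unfolding pat(1)[OF mem[OF X(1)] mem[OF X(2)]] by (rule neq)
  qed
qed

lemma init_vars: "fst (init_st t) = [0..<length vs]"
  by (simp add: init_st_def enum_def t_def)

lemma solvable_init_iff: "solvable (init_st t) \<longleftrightarrow> (\<exists>s. solves X N {..<length vs} s)"
  unfolding solvable_def init_vars by (simp add: init_st_def lessThan_atLeast0)

lemma solvable_init: "solvable (init_st t) \<longleftrightarrow> (\<exists>s. is_solution I s)"
proof
  assume "solvable (init_st t)"
  then obtain s where s: "solves X N {..<length vs} s"
    unfolding solvable_init_iff by blast
  define idx where "idx v = (SOME i. i < length vs \<and> vs ! i = v)" for v
  have idx: "idx v < length vs \<and> vs ! idx v = v" if "v \<in> vars I" for v
  proof -
    have "\<exists>i. i < length vs \<and> vs ! i = v" using that vs(2) by (metis in_set_conv_nth)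
    from someI_ex[OF this] show ?thesis unfolding idx_def .
  qed
  have sX: "(idx v, s (idx v)) \<in> X" if "v \<in> vars I" for v
    using s idx[OF that] by (auto simp: solves_def)
  define r where "r v = ds v ! s (idx v)" for v
  have point: "point (idx v, s (idx v)) = (v, r v)" if "v \<in> vars I" for v
    using idx[OF that] by (simp add: point_def r_def)
  have "is_solution I r"
    unfolding is_solution_def
  proof (intro conjI ballI impI)
    fix v assume v: "v \<in> vars I"
    show "r v \<in> dmn I v" using point_X(2)[OF sX[OF v]] idx[OF v] by (simp add: r_def)
    fix u assume u: "u \<in> vars I" "v \<noteq> u"
    then have "idx v \<noteq> idx u" using idx v by metis
    moreover have "allowed N (idx v, s (idx v)) (idx u, s (idx u))"
      using s idx[OF v] idx[OF u(1)] calculation by (auto simp: solves_def)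
    ultimately show "(r v, r u) \<in> rel I v u"
      using allowed_N[OF sX[OF v] sX[OF u(1)]] point v u by simp
  qed
  then show "\<exists>s. is_solution I s" by blast
next
  assume "\<exists>s. is_solution I s"
  then obtain r where r: "is_solution I r" by blast
  define s where "s i = (SOME a. a < length (ds (vs ! i)) \<and> ds (vs ! i) ! a = r (vs ! i))" for i
  have var: "vs ! i \<in> vars I" if "i < length vs" for i using that vs(2) nth_mem by blast
  have s: "s i < length (ds (vs ! i)) \<and> ds (vs ! i) ! s i = r (vs ! i)" if "i < length vs" for i
  proof -
    have "r (vs ! i) \<in> set (ds (vs ! i))" using r ds[OF var[OF that]] var[OF that] by (auto simp: is_solution_def)
    then have "\<exists>a. a < length (ds (vs ! i)) \<and> ds (vs ! i) ! a = r (vs ! i)" by (metis in_set_conv_nth)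
    from someI_ex[OF this] show ?thesis unfolding s_def .
  qed
  have sX: "(i, s i) \<in> X" if "i < length vs" for i using s that by (simp add: mem_X)
  have "solves X N {..<length vs} s"
    unfolding solves_def
  proof (intro conjI ballI impI)
    fix i assume i: "i \<in> {..<length vs}"
    then show "(i, s i) \<in> X" using sX by simp
    fix j assume j: "j \<in> {..<length vs}" "i \<noteq> j"
    then have "vs ! i \<noteq> vs ! j" using i vs(1) by (simp add: nth_eq_iff_index_eq)
    then have "(r (vs ! i), r (vs ! j)) \<in> rel I (vs ! i) (vs ! j)"
      using r var i j by (auto simp: is_solution_def)
    then show "allowed N (i, s i) (j, s j)"
      using allowed_N[OF sX sX, of i j] s i j by (simp add: point_def)
  qed
  then show "solvable (init_st t)"
    unfolding solvable_init_iff by blast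
qed

end

context extended_pattern
begin

lemma encodes_init:
  assumes "I \<in> CSP_TM P" "encodes x I"
  obtains t where "encode t = x" "avoids (init_st t)" "solvable (init_st t) \<longleftrightarrow> (\<exists>s. is_solution I s)"
proof -
  obtain vs ds where *: "distinct vs" "set vs = vars I"
    "\<forall>v\<in>vars I. distinct (ds v) \<and> set (ds v) = dmn I v" "x = table I vs ds"
    using assms(2) by (auto simp: encodes_def)
  interpret table_input I vs ds
    using assms(1) * by unfold_locales (auto simp: CSP_TM_def)
  have "\<not> occurs_TM P (tgt X (posE X N) (negE X N))"
    using occurs_TM_point assms(1) by (auto simp: CSP_TM_def)
  moreover have "fst ` X \<subseteq> {..<length vs}" by (auto simp: mem_X)
  ultimately have "avoids (init_st t)"
    unfolding avoids_def init_vars using distinct_init_ps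
    by (auto simp: init_st_def lessThan_atLeast0)
  then show thesis using that encode_t *(4) solvable_init by metis
qed

end

section \<open>Running time\<close>

lemma ptime_hd:
  fixes f :: "'a::enc \<Rightarrow> 'b::enc list"
  assumes "ptime D f" "\<And>x. x \<in> D \<Longrightarrow> f x \<noteq> []"
  shows "ptime D (\<lambda>x. hd (f x))"
proof -
  have "runs GoLeft (encode ys) (encode (hd ys)) 1" if "ys \<noteq> []" for ys :: "'b list"
    using goleft[of "encode ys"] that by (cases ys) auto
  moreover have "sz (hd ys) \<le> sz ys" if "ys \<noteq> []" for ys :: "'b list"
    using sz_mem[of "hd ys" ys] that by simp
  ultimately have "ptime {ys. ys \<noteq> []} (hd :: 'b list \<Rightarrow> 'b)"
    by (intro ptimeI[OF _ polybd_const[of _ 1] polybd_mono[OF polybd_sz], where p = GoLeft]) blast+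
  from ptime_comp[OF this assms(1)] assms(2) show ?thesis by simp
qed

lemma ptime_ok:
  assumes "ptime D a" "ptime D b" "ptime D c"
  shows "ptime D (\<lambda>x. ok (a x) (b x) (c x))"
proof -
  have "ptime UNIV (\<lambda>z. ok (fst z) (fst (snd z)) (snd (snd z)))"
    unfolding ok_def by (intro ptime_intros)
  from ptime_comp[OF this ptime_pair[OF assms(1) ptime_pair[OF assms(2,3)]] UNIV_I]
  show ?thesis by simp
qed

lemma ptime_adj:
  assumes "ptime D a" "ptime D b" "ptime D c" "ptime D d"
  shows "ptime D (\<lambda>x. adj (a x) (b x) (c x) (d x))"
proof -
  have "ptime UNIV (\<lambda>z. adj (fst z) (fst (snd z)) (fst (snd (snd z))) (snd (snd (snd z))))"
    unfolding adj_def by (intro ptime_intros ptime_ok)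
  from ptime_comp[OF this ptime_pair[OF assms(1) ptime_pair[OF assms(2) ptime_pair[OF assms(3,4)]]] UNIV_I]
  show ?thesis by simp
qed

lemma ptime_mem:
  assumes "ptime D a" "ptime D b"
  shows "ptime D (\<lambda>x. mem (a x) (b x))"
proof -
  have "ptime UNIV (\<lambda>z. mem (fst z) (snd z))"
    unfolding mem_def by (intro ptime_intros)
  from ptime_comp[OF this ptime_pair[OF assms] UNIV_I] show ?thesis by simp
qed

lemma ptime_grow:
  assumes "ptime D a" "ptime D b" "ptime D c" "ptime D d"
  shows "ptime D (\<lambda>x. grow (a x) (b x) (c x) (d x))"
proof -
  have "ptime UNIV (\<lambda>z. grow (fst z) (fst (snd z)) (fst (snd (snd z))) (snd (snd (snd z))))"
    unfolding grow_def by (intro ptime_intros ptime_adj ptime_mem)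
  from ptime_comp[OF this ptime_pair[OF assms(1) ptime_pair[OF assms(2) ptime_pair[OF assms(3,4)]]] UNIV_I]
  show ?thesis by simp
qed

lemma ptime_pairs:
  assumes "ptime D a"
  shows "ptime D (\<lambda>x. pairs (a x))"
proof -
  have "ptime UNIV (\<lambda>z :: 'b list. pairs z)"
    unfolding pairs_def by (intro ptime_intros)
  from ptime_comp[OF this assms UNIV_I] show ?thesis by simp
qed

lemma ptime_reach:
  assumes "ptime D a" "ptime D b" "ptime D c" "ptime D d"
  shows "ptime D (\<lambda>x. reach (a x) (b x) (c x) (d x))"
proof -
  have "ptime UNIV (\<lambda>z. fold (\<lambda>_ S. grow (fst z) (fst (snd z)) (fst (snd (snd z))) S) (pairs (fst z))
      (filter (\<lambda>v. v = snd (snd (snd z))) (fst z)))"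
  proof (rule ptime_fold_inv[where E = UNIV and Inv = "\<lambda>z S. \<exists>Q. S = filter Q (fst z)" and B = "\<lambda>z. sz (fst z)"])
    show "ptime UNIV (\<lambda>(y :: nat \<times> nat, S, z :: nat list \<times> point list \<times> (point \<times> point) list \<times> nat).
        grow (fst z) (fst (snd z)) (fst (snd (snd z))) S)"
      unfolding split_def by (intro ptime_intros ptime_grow)
  qed (auto intro!: ptime_pairs ptime_intros ptime_sz sz_filter simp: grow_def)
  from ptime_comp[OF this ptime_pair[OF assms(1) ptime_pair[OF assms(2) ptime_pair[OF assms(3,4)]]] UNIV_I]
  show ?thesis by (simp add: reach_def)
qed

lemma ptime_cands:
  assumes "ptime D a" "ptime D b" "ptime D c"
  shows "ptime D (\<lambda>x. cands (a x) (b x) (c x))"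
proof -
  have "ptime UNIV (\<lambda>z. cands (fst z) (fst (snd z)) (snd (snd z)))"
    unfolding cands_def by (intro ptime_intros ptime_mem ptime_reach)
  from ptime_comp[OF this ptime_pair[OF assms(1) ptime_pair[OF assms(2,3)]] UNIV_I]
  show ?thesis by simp
qed

lemma ptime_best:
  assumes "ptime D a" "ptime D b" "ptime D c"
  shows "ptime D (\<lambda>x. best (a x) (b x) (c x))"
proof -
  have "ptime UNIV (\<lambda>z. best (fst z) (fst (snd z)) (snd (snd z)))"
    unfolding best_def by (intro ptime_intros ptime_cands)
  from ptime_comp[OF this ptime_pair[OF assms(1) ptime_pair[OF assms(2,3)]] UNIV_I]
  show ?thesis by simp
qed

lemma ptime_tab:
  assumes "ptime D a" "ptime D b" "ptime D c"
  shows "ptime D (\<lambda>x. tab (a x) (b x) (c x))"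
proof -
  have "ptime UNIV (\<lambda>z. tab (fst z) (fst (snd z)) (snd (snd z)))"
    unfolding tab_def dom_list_def by (intro ptime_intros ptime_ok)
  from ptime_comp[OF this ptime_pair[OF assms(1) ptime_pair[OF assms(2,3)]] UNIV_I]
  show ?thesis by simp
qed

lemma ptime_init_st: "ptime D init_st"
proof -
  have "ptime D (\<lambda>t. init_st t)"
    unfolding init_st_def init_ps_def init_ng_def by (intro ptime_intros)
  then show ?thesis .
qed

lemma ptime_solvable_st: "ptime D f \<Longrightarrow> ptime D (\<lambda>x. solvable_st (f x))"
proof -
  assume f: "ptime D f"
  have "ptime UNIV (\<lambda>st. solvable_st st)"
    unfolding solvable_st_def by (intro ptime_intros)
  from ptime_comp[OF this f UNIV_I] show ?thesis .
qed

lemma sz_pairs: "sz (pairs xs) \<le> sz xs * sz xs * Suc (Suc (sz xs + sz xs))"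
proof -
  have "sz z \<le> Suc (sz xs + sz xs)" if z: "z \<in> set (pairs xs)" for z
  proof -
    obtain x y where "z = (x, y)" "x \<in> set xs" "y \<in> set xs" using z unfolding set_pairs by blast
    then show ?thesis using sz_mem[of x xs] sz_mem[of y xs] by simp
  qed
  from sz_list_le[of "pairs xs", OF this]
  have "sz (pairs xs) \<le> length xs * length xs * Suc (Suc (sz xs + sz xs))"
    by (simp add: length_pairs)
  also have "\<dots> \<le> sz xs * sz xs * Suc (Suc (sz xs + sz xs))"
    by (intro mult_le_mono length_le_sz) simp
  finally show ?thesis .
qed

section \<open>Running time of the elimination loop\<close>

context P0_solver
begin

context
  assumes ptime_sol: "ptime {t. \<exists>I\<in>CSP_SP P0. encodes (encode t) I} sol"
begin

definition cand_of :: "state \<Rightarrow> (nat \<times> nat \<times> nat list) set" where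
  "cand_of st = set (best (fst st) (fst (snd st)) (snd (snd st)))"

text \<open>The hypothesis \<open>prom\<close> puts every call of the solver inside its class, where
  its running time is bounded.\<close>

lemma ptime_ext:
  assumes "ptime D a" "ptime D b" "ptime D c" "ptime D d"
    and prom: "\<And>x. x \<in> D \<Longrightarrow> avoids (a x) \<and> (\<exists>u w. (u, w, b x) \<in> cand_of (a x))"
  shows "ptime D (\<lambda>x. ext sol (a x) (b x) (c x) (d x))"
proof -
  define F :: "(state \<times> nat list \<times> point \<times> point) set" where "F = {z. avoids (fst z) \<and> (\<exists>u w. (u, w, fst (snd z)) \<in> cand_of (fst z))}"
  have "ptime F (\<lambda>z. ext sol (fst z) (fst (snd z)) (fst (snd (snd z))) (snd (snd (snd z))))"
    unfolding ext_def
  proof (rule ptime_comp[OF ptime_sol])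
    show "ptime F (\<lambda>z. tab (fst (snd z)) (filter (\<lambda>r. mem (fst (snd z)) (fst r) \<and>
        ok (snd (snd (fst z))) r (fst (snd (snd z))) \<and> ok (snd (snd (fst z))) r (snd (snd (snd z))))
        (fst (snd (fst z)))) (snd (snd (fst z))))"
      by (intro ptime_tab ptime_intros ptime_mem ptime_ok)
    fix z assume "z \<in> F"
    then obtain u w where "avoids (fst z)" "(u, w, fst (snd z)) \<in> cand_of (fst z)"
      by (auto simp: F_def)
    then show "tab (fst (snd z)) (filter (\<lambda>r. mem (fst (snd z)) (fst r) \<and>
        ok (snd (snd (fst z))) r (fst (snd (snd z))) \<and> ok (snd (snd (fst z))) r (snd (snd (snd z))))
        (fst (snd (fst z)))) (snd (snd (fst z))) \<in> {t. \<exists>I\<in>CSP_SP P0. encodes (encode t) I}"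
      using sub_instance[of "fst (fst z)" "fst (snd (fst z))" "snd (snd (fst z))" u w "fst (snd z)" _
          "fst (snd (snd z))" "snd (snd (snd z))", OF _ _ refl]
      unfolding cand_of_def by auto
  qed
  from ptime_comp[OF this ptime_pair[OF assms(1) ptime_pair[OF assms(2) ptime_pair[OF assms(3,4)]]]] prom
  show ?thesis by (simp add: F_def)
qed

lemma ptime_elim_ps:
  "ptime {(st, c). avoids st \<and> c \<in> cand_of st} (\<lambda>z. elim_ps sol (fst z) (snd z))"
  unfolding elim_ps_def by (intro ptime_intros ptime_mem ptime_ext) force

lemma ptime_elim_st:
  "ptime {(st, c). avoids st \<and> c \<in> cand_of st} (\<lambda>z. elim_st sol (fst z) (snd z))"
  unfolding elim_st_def elim_ng_def
  by (intro ptime_intros ptime_mem ptime_ok ptime_pairs ptime_elim_ps ptime_ext) force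

text \<open>The branch condition becomes part of the promise, so the head of the list of best
  fragments is taken only when it exists.\<close>

lemma ptime_step_st: "ptime {st. avoids st} (\<lambda>st. step_st sol st)"
  unfolding step_st_def
proof (intro ptime_if ptime_neq_Nil ptime_best ptime_fst ptime_snd ptime_id)
  show "ptime {st \<in> {st. avoids st}. best (fst st) (fst (snd st)) (snd (snd st)) \<noteq> []}
    (\<lambda>st. elim_st sol st (hd (best (fst st) (fst (snd st)) (snd (snd st)))))"
    by (rule ptime_comp[OF ptime_elim_st ptime_pair[OF ptime_id], simplified])
       (auto intro!: ptime_hd ptime_best ptime_fst ptime_snd ptime_id simp: cand_of_def)
qed

text \<open>Variables and points only decrease, and each elimination selects the forbidden pairs
  anew among all pairs of the remaining points. So the state stays polynomial in the initial one,
  however many rounds are made.\<close>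

lemma ptime_final_st:
  "ptime {t. avoids (init_st t)} (\<lambda>t. final_st sol t)"
proof -
  define n where "n t = sz (init_st t)" for t
  \<comment> \<open>The product bounds the list of all pairs of points; the summand
    \<open>n t\<close> is for the forbidden pairs of the initial state.\<close>
  define m where "m t = n t + n t * n t * Suc (Suc (n t + n t))" for t
  define inv where "inv t st \<longleftrightarrow>
    avoids st \<and> sz (fst st) \<le> n t \<and> sz (fst (snd st)) \<le> n t \<and> sz (snd (snd st)) \<le> m t" for t st
  have "inv t (step_st sol st)" if "inv t st" for t st
  proof (cases "best (fst st) (fst (snd st)) (snd (snd st)) = []")
    case True
    then show ?thesis using that by (simp add: step_st_def)
  next
    case False
    define c where "c = hd (best (fst st) (fst (snd st)) (snd (snd st)))"
    have step: "step_st sol st = elim_st sol st c" using False by (simp add: step_st_def c_def)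
    have bounds: "avoids st" "sz (fst st) \<le> n t" "sz (fst (snd st)) \<le> n t"
      using that by (simp_all add: inv_def)
    have ps: "sz (elim_ps sol st c) \<le> n t"
      unfolding elim_ps_def by (rule order_trans[OF sz_filter bounds(3)])
    have "sz (elim_ng sol st c) \<le> sz (pairs (elim_ps sol st c))"
      unfolding elim_ng_def by (rule sz_filter)
    also have "\<dots> \<le> sz (elim_ps sol st c) * sz (elim_ps sol st c) *
        Suc (Suc (sz (elim_ps sol st c) + sz (elim_ps sol st c)))" by (rule sz_pairs)
    also have "\<dots> \<le> n t * n t * Suc (Suc (n t + n t))"
      using ps by (intro mult_le_mono Suc_le_mono[THEN iffD2] add_mono)
    finally have "sz (elim_ng sol st c) \<le> m t" by (simp add: m_def)
    moreover have "sz (filter (\<lambda>v. \<not> mem (snd (snd c)) v) (fst st)) \<le> n t"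
      by (rule order_trans[OF sz_filter bounds(2)])
    ultimately have "sz (fst (step_st sol st)) \<le> n t" "sz (fst (snd (step_st sol st))) \<le> n t"
      "sz (snd (snd (step_st sol st))) \<le> m t"
      unfolding step using ps by (simp_all add: elim_st_def)
    then show ?thesis using step_st(1)[OF bounds(1)] by (simp add: inv_def)
  qed
  then have step: "(y, st, t) \<in> {(y, st, t). avoids st} \<and> inv t (step_st sol st)" if "inv t st"
    for y :: nat and t st using that unfolding inv_def by blast
  have "ptime {(y, st, t). avoids st} (\<lambda>(y :: nat, st, t :: bool list list list list). step_st sol st)"
    unfolding split_def
    by (rule ptime_comp[OF ptime_step_st]) (auto intro!: ptime_fst ptime_snd ptime_id)
  then show ?thesis
    unfolding final_st_def
  proof (rule ptime_fold_inv[OF ptime_fst[OF ptime_init_st] ptime_init_st,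
        where Inv = inv and B = "\<lambda>t. 2 + n t + n t + m t"])
    show "inv t (init_st t)" if "t \<in> {t. avoids (init_st t)}" for t
      using that unfolding inv_def m_def n_def by (cases "init_st t") auto
    show "polybd {t. avoids (init_st t)} (\<lambda>t. 2 + n t + n t + m t)"
      unfolding m_def n_def
      by (intro polybd_add polybd_mult polybd_Suc polybd_const ptime_sz ptime_init_st)
    \<comment> \<open>The constant 2 counts the pairing nodes of a state.\<close>
    show "sz st \<le> 2 + n t + n t + m t" if "inv t st" for t st
      using that by (cases st) (simp add: inv_def)
  qed (rule step)
qed

end

end

context extended_pattern
begin

lemma topological_minor_tractable:
  assumes "sub_pattern_tractable P0"
  shows "topological_minor_tractable P"
proof -
  obtain p q where pq: "\<And>I x. I \<in> CSP_SP P0 \<Longrightarrow> encodes x I \<Longrightarrow>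
      \<exists>y n. runs p x y n \<and> n \<le> poly q (nodes x) \<and> (y \<noteq> Leaf \<longleftrightarrow> (\<exists>s. is_solution I s))"
    using assms unfolding sub_pattern_tractable_def tractable_def by blast
  \<comment> \<open>Divergence counts as a negative answer, which makes \<open>sol\<close> total.
    Determinism makes it agree with the program wherever that halts.\<close>
  define sol where "sol t \<longleftrightarrow> (\<exists>y n. runs p (encode t) y n \<and> y \<noteq> Leaf)" for t :: "bool list list list list"
  interpret P0_solver U1 U2 U3 p1 p2 r1 r2 q1 q2 P0 P sol
  proof unfold_locales
    fix I and t :: "bool list list list list" assume "I \<in> CSP_SP P0" "encodes (encode t) I"
    from pq[OF this] obtain y n where "runs p (encode t) y n" "y \<noteq> Leaf \<longleftrightarrow> (\<exists>s. is_solution I s)"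
      by blast
    then show "sol t \<longleftrightarrow> (\<exists>s. is_solution I s)"
      unfolding sol_def using runs_deterministic by blast
  qed
  have "ptime {t. \<exists>I\<in>CSP_SP P0. encodes (encode t) I} sol"
  \<comment> \<open>Any tree other than \<open>Leaf\<close> means yes, so the answer is normalised
    to the encoding of a truth value, at a cost of at most 4 further steps.\<close>
  proof (rule ptimeI[where T = "\<lambda>t. poly q (sz t) + 4" and p = "Cond p (Pair MkLeaf MkLeaf) MkLeaf"])
    fix t :: "bool list list list list"
    assume "t \<in> {t. \<exists>I\<in>CSP_SP P0. encodes (encode t) I}"
    then obtain I y n where y: "runs p (encode t) y n" "n \<le> poly q (sz t)"
      using pq unfolding sz_def by blast
    then have sol: "sol t \<longleftrightarrow> y \<noteq> Leaf"
      unfolding sol_def using runs_deterministic by blast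
    show "\<exists>n\<le>poly q (sz t) + 4. runs (Cond p (Pair MkLeaf MkLeaf) MkLeaf) (encode t) (encode (sol t)) n"
    proof (cases "y = Leaf")
      case True
      then have "runs (Cond p (Pair MkLeaf MkLeaf) MkLeaf) (encode t) (encode (sol t)) (n + 1 + 1)"
        using cond_false[OF _ mkleaf] y(1) sol by simp
      with y(2) show ?thesis by (intro exI[of _ "n + 1 + 1"]) simp
    next
      case False
      then have "runs (Cond p (Pair MkLeaf MkLeaf) MkLeaf) (encode t) (encode (sol t)) (n + (1 + 1 + 1) + 1)"
        using cond_true[OF y(1) False pair[OF mkleaf mkleaf]] sol by simp
      with y(2) show ?thesis by (intro exI[of _ "n + (1 + 1 + 1) + 1"]) simp
    qed
  next
    show "polybd {t. \<exists>I\<in>CSP_SP P0. encodes (encode t) I} (\<lambda>t. poly q (sz t) + 4)"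
      by (intro polybd_intros)
    have "sz (sol t) \<le> 1" for t by (cases "sol t") auto
    then show "polybd {t. \<exists>I\<in>CSP_SP P0. encodes (encode t) I} (\<lambda>t. sz (sol t))"
      by (intro polybd_mono[OF polybd_const[of _ 1]])
  qed
  from ptimeE[OF ptime_solvable_st[OF ptime_final_st[OF this]]] obtain p' q' where
    p': "\<And>t. t \<in> {t. avoids (init_st t)} \<Longrightarrow>
      \<exists>n\<le>poly q' (sz t). runs p' (encode t) (encode (solvable_st (final_st sol t))) n"
    by metis
  have "\<exists>y n. runs p' x y n \<and> n \<le> poly q' (nodes x) \<and> (y \<noteq> Leaf \<longleftrightarrow> (\<exists>s. is_solution I s))"
    if I: "I \<in> CSP_TM P" "encodes x I" for I x
  proof -
    obtain t where t: "encode t = x" "avoids (init_st t)" "solvable (init_st t) \<longleftrightarrow> (\<exists>s. is_solution I s)"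
      using encodes_init[OF I] by blast
    have "encode b \<noteq> Leaf \<longleftrightarrow> b" for b :: bool by (cases b) auto
    then have "encode (solvable_st (final_st sol t)) \<noteq> Leaf \<longleftrightarrow> (\<exists>s. is_solution I s)"
      unfolding final_st[OF t(2)] t(3) by blast
    with p'[of t] t(1,2) show ?thesis by (auto simp: sz_def)
  qed
  then show ?thesis unfolding topological_minor_tractable_def tractable_def by blast
qed

end

theorem theorem5p3:
  fixes P0 P :: "'x pattern"
    and U1 U2 U3 :: "'x set"
    and p1 p2 r1 r2 q1 q2 :: 'x
  assumes "is_pattern P0"
    and "sub_pattern_tractable P0"
    and "parts P0 = {U1, U2, U3}" "U1 \<noteq> U2" "U1 \<noteq> U3" "U2 \<noteq> U3"
    and "\<exists>\<^sub>\<le>\<^sub>1e. e \<in> neg P0 \<inter> U1 \<times> U2"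
    and "\<exists>\<^sub>\<le>\<^sub>1e. e \<in> neg P0 \<inter> U2 \<times> U3"
    and "(pos P0 \<union> neg P0) \<inter> U1 \<times> U3 = {}"
    and "distinct [p1, p2, r1, r2, q1, q2]"
    and "{p1, p2, r1, r2, q1, q2} \<inter> pts P0 = {}"
    and "P = \<lparr>pts = pts P0 \<union> {p1, p2, r1, r2, q1, q2},
              same = same P0 \<union> (U1 \<union> {p1, p2}) \<times> (U1 \<union> {p1, p2})
                     \<union> (U3 \<union> {r1, r2}) \<times> (U3 \<union> {r1, r2})
                     \<union> {q1, q2} \<times> {q1, q2},
              pos = pos P0,
              neg = neg P0 \<union> {(p1, r1), (r1, p1), (p2, q1), (q1, p2), (q2, r2), (r2, q2)}\<rparr>"
  shows "topological_minor_tractable P"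
proof -
  interpret extended_pattern P0 P U1 U2 U3 p1 p2 r1 r2 q1 q2
    by (rule extended_pattern.intro) fact+
  show ?thesis using assms(2) by (rule topological_minor_tractable)
qed

end
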